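(* Let $X$ be a real separable Hilbert space, $(T_t)_{t\ge 0}$ a strongly continuous semigroup of bounded linear operators on $X$ with infinitesimal generator $A$, let $b\in X$, let $M$ be a Lévy measure on $X$, and let $(P_t)_{t\ge 0}$ be the generalised Mehler semigroup associated with $(T_t)_{t\ge0}$ and the characteristics $[b,0,M]$. Assume: (1) there is an orthonormal basis $\{h_n\mid n\in\mathbb N\}$ of $X$ consisting of eigenvectors of $A^*$, and $\int_{B_1^c}|x|\,M(dx)<\infty$; (2) the limit $b_\infty:=\lim_{t\to\infty}b_t$ exists in $X$; (3) $\int_0^\infty\int_X(1\wedge|T_sx|^2)\,M(dx)\,ds<\infty$; (4) $\lim_{t\to\infty}T_tx=0$ for every $x\in X$; (5) there is a function $h:(0,\infty)\to(0,\infty)$ with $h\in L^1((0,\infty))$ such that $h(t)M-M\circ T_t^{-1}$ is a positive measure for every $t>0$; (6) $\int_X|y|^2e^{s|y|}M(dy)<\infty$ for every $s\in(0,\infty)$, and there exist $C_0>0$, $\gamma\ge1$, $s_0>0$ such that $\psi(s):=\int_{B_1^c}|y|e^{s|y|}M(dy)\ge C_0e^{\gamma s}$ for every $s\ge s_0$. Let $\sigma$ be the unique invariant probability measure of $(P_t)_{t\ge0}$. Then any Lipschitz continuous function $g:X\to\mathbb R$ with Lipschitz constant less than or equal to $1$ belongs to $L^1(X,\sigma)$, and there exist positive constants $c_0,c_1,c_2$ and $t_0$ such that $$\sigma\big(\{g\ge m_\sigma(g)+t\}\big)\le\begin{cases}\exp(-c_0t^2),&t\in(0,t_0),\\ \exp\big(-c_1t\,\psi^{-1}(c_2t)\big),&t\in[t_0,\infty).\end{cases}$$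 Moreover, for all sufficiently small $c>0$, $$\int_Xe^{c\,g\,\psi^{-1}(|g|)}\,d\sigma<\infty.$$
   Context: $X$ may be finite or infinite dimensional, with inner product $\langle\cdot,\cdot\rangle$ and norm $|\cdot|$; $X^*$ is identified with $X$; $B_1$ is the open unit ball centred at $0$ and $B_1^c$ its complement. $B_b(X)$ is the space of bounded Borel functions $X\to\mathbb R$. A Lévy measure on $X$ is a Borel measure $M$ with $M(\{0\})=0$ and $\int_X(1\wedge|x|^2)M(dx)<\infty$. For $T\in\mathcal L(X)$, $(M\circ T^{-1})(B)=M(T^{-1}(B))$. Mehler semigroup: set $\lambda(\xi)=-i\langle\xi,b\rangle-\int_X\big(e^{i\langle x,\xi\rangle}-1-i\langle x,\xi\rangle\chi_{B_1}(x)\big)M(dx)$. Standing assumption: $\lambda$ is continuous for the Sazonov topology (the topology generated by the seminorms $x\mapsto|Tx|$, $T$ Hilbert–Schmidt on $X$). For $t\ge0$, $\mu_t$ is the Borel probability measure on $X$ with characteristic function $\widehat{\mu_t}(\xi)=\exp\big(-\int_0^t\lambda(T_s^*\xi)ds\big)$, and $(P_tf)(x)=\int_Xf(T_tx+y)\mu_t(dy)$ for $f\in B_b(X)$. Moreover $$b_t=\int_0^tT_sb\,ds+\int_0^t\int_XT_sx\big(\chi_{B_1}(T_sx)-\chi_{B_1}(x)\big)M(dx)ds.$$ Invariant measure: a Borel probability measure $\sigma$ is invariant if $\int_XP_tf\,d\sigma=\int_Xf\,d\sigma$ for all $t\ge0$, $f\in B_b(X)$. Under (1)–(4) it is known that there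 is exactly one invariant measure $\sigma$; it is the infinitely divisible law with Lévy–Khinchine characteristics $[b_\infty,0,M_\infty]$, where $M_\infty(\{0\})=0$ and $M_\infty(B)=\int_0^\infty M(T_s^{-1}(B))ds$ for Borel $B\not\ni0$; also $\mu_t\to\sigma$ weakly as $t\to\infty$. $m_\sigma(g)=\int_Xg\,d\sigma$. The function $\psi:(0,\infty)\to(0,\infty)$ is continuous and strictly increasing with $\psi(s)\to\infty$ as $s\to\infty$; $\psi^{-1}$ is its inverse, extended by $\psi^{-1}(r)=0$ for $0\le r\le\lim_{s\to0^+}\psi(s)$. *)

theory Defs
  imports "HOL-Probability.Probability"
begin

text \<open>
  A real separable Hilbert space is a type of sort
  \<open>{real_inner, banach, polish_space}\<close>: complete and second countable.
\<close>

definition orthonormal_basis :: "'a::real_inner set \<Rightarrow> bool" where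
  "orthonormal_basis B \<longleftrightarrow>
     pairwise orthogonal B \<and> (\<forall>e\<in>B. norm e = 1) \<and> closure (span B) = UNIV"

subsection \<open>Semigroups and their generators\<close>

text \<open>A semigroup is a function of a real time; only its values at times \<open>t \<ge> 0\<close> matter.\<close>

definition C0_semigroup :: "(real \<Rightarrow> 'a::real_normed_vector \<Rightarrow>\<^sub>L 'a) \<Rightarrow> bool" where
  "C0_semigroup T \<longleftrightarrow>
     T 0 = id_blinfun \<and>
     (\<forall>s\<ge>0. \<forall>t\<ge>0. T (s + t) = T s o\<^sub>L T t) \<and>
     (\<forall>x. ((\<lambda>t. T t x) \<longlongrightarrow> x) (at_right 0))"

definition generator_dom :: "(real \<Rightarrow> 'a::real_normed_vector \<Rightarrow>\<^sub>L 'a) \<Rightarrow> 'a set" where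
  "generator_dom T = {x. \<exists>y. ((\<lambda>t. (T t x - x) /\<^sub>R t) \<longlongrightarrow> y) (at_right 0)}"

text \<open>Meaningful on \<open>generator_dom T\<close> only.\<close>

definition generator :: "(real \<Rightarrow> 'a::real_normed_vector \<Rightarrow>\<^sub>L 'a) \<Rightarrow> 'a \<Rightarrow> 'a" where
  "generator T x = Lim (at_right 0) (\<lambda>t. (T t x - x) /\<^sub>R t)"

text \<open>
  The graph of the adjoint of an operator \<open>A\<close> with dense domain \<open>D\<close>: \<open>(y, z)\<close> belongs to it
  iff \<open>y\<close> is in the domain of the adjoint and the adjoint maps \<open>y\<close> to \<open>z\<close>.
\<close>

definition adjoint_graph :: "'a::real_inner set \<Rightarrow> ('a \<Rightarrow> 'a) \<Rightarrow> ('a \<times> 'a) set" where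
  "adjoint_graph D A = {(y, z). \<forall>x\<in>D. A x \<bullet> y = x \<bullet> z}"

definition eigenvector_of_graph :: "('a::real_vector \<times> 'a) set \<Rightarrow> 'a \<Rightarrow> bool" where
  "eigenvector_of_graph G v \<longleftrightarrow> v \<noteq> 0 \<and> (\<exists>a::real. (v, a *\<^sub>R v) \<in> G)"

subsection \<open>Levy measures and the characteristic exponent\<close>

definition levy_measure :: "'a::real_normed_vector measure \<Rightarrow> bool" where
  "levy_measure M \<longleftrightarrow>
     sets M = sets borel \<and> emeasure M {0} = 0 \<and>
     (\<integral>\<^sup>+x. ennreal (min 1 ((norm x)\<^sup>2)) \<partial>M) < \<infinity>"

definition levy_exponent :: "'a::real_inner \<Rightarrow> 'a measure \<Rightarrow> 'a \<Rightarrow> complex" where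
  "levy_exponent b M \<xi> =
     - \<i> * complex_of_real (\<xi> \<bullet> b) -
     (LINT x|M. exp (\<i> * complex_of_real (x \<bullet> \<xi>)) - 1 -
                \<i> * complex_of_real (x \<bullet> \<xi>) * indicator (ball 0 1) x)"

definition hilbert_schmidt :: "('a::real_inner \<Rightarrow>\<^sub>L 'a) \<Rightarrow> bool" where
  "hilbert_schmidt S \<longleftrightarrow>
     (\<exists>B. orthonormal_basis B \<and> (\<lambda>e. (norm (S e))\<^sup>2) summable_on B)"

definition sazonov_topology :: "'a::real_inner topology" where
  "sazonov_topology =
     topology_generated_by
       {{y. norm (blinfun_apply S (y - x)) < \<epsilon>} | S x \<epsilon>. hilbert_schmidt S \<and> 0 < \<epsilon>}"

subsection \<open>Generalised Mehler semigroups\<close>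

definition char_fun :: "'a::real_inner measure \<Rightarrow> 'a \<Rightarrow> complex" where
  "char_fun \<mu> \<xi> = (LINT x|\<mu>. exp (\<i> * complex_of_real (x \<bullet> \<xi>)))"

text \<open>
  The condition determines \<open>\<mu> t\<close> for \<open>t \<ge> 0\<close>, since a Borel probability measure on a
  separable Hilbert space is determined by its characteristic function.
\<close>

definition mehler_measures ::
  "(real \<Rightarrow> 'a::{real_inner, banach, polish_space} \<Rightarrow>\<^sub>L 'a) \<Rightarrow> 'a \<Rightarrow> 'a measure \<Rightarrow>
   (real \<Rightarrow> 'a measure) \<Rightarrow> bool" where
  "mehler_measures T b M \<mu> \<longleftrightarrow>
     (\<forall>t\<ge>0. prob_space (\<mu> t) \<and> sets (\<mu> t) = sets borel \<and>
       (\<forall>\<xi>. char_fun (\<mu> t) \<xi> =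
          exp (- (LINT s:{0..t}|lborel. levy_exponent b M (adjoint (blinfun_apply (T s)) \<xi>)))))"

definition mehler ::
  "(real \<Rightarrow> 'a::real_normed_vector \<Rightarrow>\<^sub>L 'a) \<Rightarrow> (real \<Rightarrow> 'a measure) \<Rightarrow>
   real \<Rightarrow> ('a \<Rightarrow> real) \<Rightarrow> 'a \<Rightarrow> real" where
  "mehler T \<mu> t f x = (LINT y|\<mu> t. f (T t x + y))"

definition invariant_measure ::
  "(real \<Rightarrow> ('a::topological_space \<Rightarrow> real) \<Rightarrow> 'a \<Rightarrow> real) \<Rightarrow> 'a measure \<Rightarrow> bool" where
  "invariant_measure P \<sigma> \<longleftrightarrow>
     prob_space \<sigma> \<and> sets \<sigma> = sets borel \<and>
     (\<forall>t\<ge>0. \<forall>f. f \<in> borel_measurable borel \<and> bounded (range f) \<longrightarrow>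
        (LINT x|\<sigma>. P t f x) = (LINT x|\<sigma>. f x))"

text \<open>The drift \<open>b\<^sub>t\<close> in the Levy--Khinchine triple of \<open>\<mu> t\<close>.\<close>

definition mehler_drift ::
  "(real \<Rightarrow> 'a::{real_inner, banach, polish_space} \<Rightarrow>\<^sub>L 'a) \<Rightarrow> 'a \<Rightarrow> 'a measure \<Rightarrow>
   real \<Rightarrow> 'a" where
  "mehler_drift T b M t =
     (LINT s:{0..t}|lborel. T s b) +
     (LINT s:{0..t}|lborel. LINT x|M.
        (indicator (ball 0 1) (T s x) - indicator (ball 0 1) x :: real) *\<^sub>R T s x)"

subsection \<open>The tail moment function and its inverse\<close>

definition tail_exp_moment :: "'a::real_normed_vector measure \<Rightarrow> real \<Rightarrow> real" where
  "tail_exp_moment M s = (LINT y:- ball 0 1|M. norm y * exp (s * norm y))"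

text \<open>
  Inverse of a continuous, strictly increasing \<open>\<psi> : (0,\<infinity>) \<rightarrow> (0,\<infinity>)\<close> tending to infinity,
  extended by \<open>0\<close> up to the right limit of \<open>\<psi>\<close> at \<open>0\<close>.
\<close>

definition ext_inverse :: "(real \<Rightarrow> real) \<Rightarrow> real \<Rightarrow> real" where
  "ext_inverse \<psi> r = (if r \<le> Lim (at_right 0) \<psi> then 0 else the_inv_into {0<..} \<psi> r)"

end

theory Submission
  imports Defs
begin

text \<open>
  Say that a law has Laplace bound \<open>C\<close> at \<open>l\<close> if \<open>E exp (l (g - E g)) \<le> exp C\<close> for all bounded
  1-Lipschitz \<open>g\<close>. Conditioning on one summand shows that these bounds add up under convolution,
  and \<open>1 + x \<le> exp x\<close> gives every law the bound \<open>E (exp (l |u|) - 1 - l |u|)\<close>. A compound Poisson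
  law is a limit of convolution powers of laws \<open>(1 - m/n) \<delta>\<^sub>0 + \<nu>/n\<close>, so an infinitely divisible
  law without Gaussian part and with Levy measure \<open>\<nu>\<close> has the bound
  \<open>\<integral> (exp (l |u|) - 1 - l |u|) \<nu>(du)\<close>; the limit is taken on characteristic functions, for
  finite-dimensional projections smoothed by a Gaussian. The Levy measure of \<open>\<mu> t\<close> is the image of
  \<open>ds M(dx)\<close> under \<open>(s, x) \<mapsto> T s x\<close>, and the domination hypothesis bounds it by \<open>(\<integral> h) M\<close>,
  uniformly in \<open>t\<close>. By invariance and stability the bound passes to \<open>\<sigma>\<close>. Chernoff's inequality with
  \<open>l\<close> proportional to \<open>t\<close>, respectively with \<open>2 l = \<psi>\<^sup>-\<^sup>1 (c t)\<close>, gives the two regimes; the last claim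
  uses \<open>\<psi> (s + d) \<ge> exp d * \<psi> s\<close>, by which \<open>\<psi>\<^sup>-\<^sup>1 (K r) \<le> \<psi>\<^sup>-\<^sup>1 r + ln K\<close>.
\<close>

section \<open>Laplace bounds and convolution\<close>

text \<open>Fixing \<open>l\<close> and testing only bounded functions makes the bound meaningful
  for every law and lets it survive any limit in which the two integrals converge; unbounded
  \<open>g\<close> enters at the end, by truncation. In infinite dimensions, pointwise convergence
  of characteristic functions does not give weak convergence. So the Poisson approximation is
  carried out on the span of finitely many basis vectors, and the projections are removed afterwards
  under one fixed law, where dominated convergence suffices. As the Levy measure has a second
  moment, all jumps are compensated rather than only the small ones. The difference goes into a
  linear functional of \<open>\<xi>\<close>, which is represented by a vector on finite spans only.
  The jumps are kept as a map \<open>Y\<close> on a measure space \<open>N\<close>; for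
  \<open>\<mu> t\<close> this is \<open>T s x\<close> on \<open>(0, t] \<times> X\<close>. In the
  Chernoff step the second-moment term costs \<open>l\<^sup>2 * exp l\<close>. By
  \<open>l * exp l \<le> exp (2 * l)\<close> and the growth hypothesis,
  \<open>\<psi> (2 * l)\<close> absorbs it: this is why \<open>2 * l\<close>, and not
  \<open>l\<close>, is matched with the inverse of \<open>\<psi>\<close>.\<close>

definition laplace_bounded :: "real \<Rightarrow> real \<Rightarrow> 'a::metric_space measure \<Rightarrow> bool" where
  "laplace_bounded l C \<mu> \<longleftrightarrow>
     (\<forall>g. 1-lipschitz_on UNIV g \<longrightarrow> bounded (range g) \<longrightarrow>
        (LINT x|\<mu>. exp (l * g x)) \<le> exp (l * (LINT x|\<mu>. g x) + C))"

lemma laplace_bounded_mono: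
  assumes "laplace_bounded l C \<mu>" "C \<le> D"
  shows "laplace_bounded l D \<mu>"
  unfolding laplace_bounded_def
proof safe
  fix g :: "'a \<Rightarrow> real"
  assume "1-lipschitz_on UNIV g" "bounded (range g)"
  then have "(LINT x|\<mu>. exp (l * g x)) \<le> exp (l * (LINT x|\<mu>. g x) + C)"
    using assms(1) by (simp add: laplace_bounded_def)
  also have "\<dots> \<le> exp (l * (LINT x|\<mu>. g x) + D)" using assms(2) by simp
  finally show "(LINT x|\<mu>. exp (l * g x)) \<le> exp (l * (LINT x|\<mu>. g x) + D)" .
qed

definition add_conv :: "'a::real_normed_vector measure \<Rightarrow> 'a measure \<Rightarrow> 'a measure" where
  "add_conv \<mu> \<nu> = distr (\<mu> \<Otimes>\<^sub>M \<nu>) borel (\<lambda>(x, y). x + y)"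

definition borel_prob :: "'a::topological_space measure \<Rightarrow> bool" where
  "borel_prob \<mu> \<longleftrightarrow> prob_space \<mu> \<and> sets \<mu> = sets borel"

lemma norm_integral_le:
  fixes f :: "'a \<Rightarrow> 'b::{banach, second_countable_topology}"
  assumes "integrable M f" "integrable M g" "\<And>x. norm (f x) \<le> g x"
  shows "norm (LINT x|M. f x) \<le> (LINT x|M. g x)"
  by (rule order_trans[OF integral_norm_bound integral_mono]) (use assms in auto)

lemma lipschitz_on_UNIV_measurable:
  fixes g :: "'a::metric_space \<Rightarrow> 'b::metric_space"
  assumes "L-lipschitz_on UNIV g"
  shows "g \<in> borel_measurable borel"
  by (intro borel_measurable_continuous_onI lipschitz_on_continuous_on[OF assms])

lemma borel_prob_integrable_bounded:
  fixes f :: "'a::topological_space \<Rightarrow> 'b::{banach, second_countable_topology}"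
  assumes "borel_prob \<mu>" "f \<in> borel_measurable borel" "bounded (range f)"
  shows "integrable \<mu> f"
proof -
  interpret prob_space \<mu> using assms(1) by (simp add: borel_prob_def)
  obtain B where "\<And>x. norm (f x) \<le> B"
    using assms(3) by (auto simp: bounded_iff)
  moreover have "f \<in> borel_measurable \<mu>"
    using assms(1,2) by (simp add: borel_prob_def cong: measurable_cong_sets)
  ultimately show ?thesis
    by (intro integrable_const_bound[of _ B]) auto
qed

lemma bounded_exp_mult:
  fixes g :: "'a \<Rightarrow> real"
  assumes "bounded (range g)"
  shows "bounded (range (\<lambda>x. exp (l * g x)))"
proof -
  obtain B where B: "\<And>x. \<bar>g x\<bar> \<le> B"
    using assms by (auto simp: bounded_iff)
  have "\<bar>l * g x\<bar> \<le> \<bar>l\<bar> * B" for x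
    using B[of x] by (simp add: abs_mult mult_left_mono)
  then have "norm (exp (l * g x)) \<le> exp (\<bar>l\<bar> * B)" for x
    by (simp add: abs_le_iff)
  then show ?thesis by (auto simp: bounded_iff)
qed

lemma add_conv_integral:
  fixes f :: "'a::{real_normed_vector, second_countable_topology} \<Rightarrow> 'b::{banach, second_countable_topology}"
  assumes "borel_prob \<mu>" "borel_prob \<nu>" "f \<in> borel_measurable borel" "bounded (range f)"
  shows "(LINT z|add_conv \<mu> \<nu>. f z) = (LINT x|\<mu>. LINT y|\<nu>. f (x + y))"
proof -
  interpret M: prob_space \<mu> using assms(1) by (simp add: borel_prob_def)
  interpret N: prob_space \<nu> using assms(2) by (simp add: borel_prob_def)
  interpret P: pair_prob_space \<mu> \<nu> ..
  have [measurable_cong]: "sets \<mu> = sets borel" "sets \<nu> = sets borel"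
    using assms by (auto simp: borel_prob_def)
  note [measurable] = assms(3)
  obtain B where B: "\<And>x. norm (f x) \<le> B"
    using assms(4) by (auto simp: bounded_iff)
  have "integrable (\<mu> \<Otimes>\<^sub>M \<nu>) (\<lambda>(x, y). f (x + y))"
    by (rule P.integrable_const_bound[of _ B]) (use B in auto)
  then have "(LINT x|\<mu>. LINT y|\<nu>. f (x + y)) = (LINT z|(\<mu> \<Otimes>\<^sub>M \<nu>). (case z of (x, y) \<Rightarrow> f (x + y)))"
    using P.integral_fst'[of "\<lambda>(x, y). f (x + y)"] by simp
  also have "\<dots> = (LINT z|add_conv \<mu> \<nu>. f z)"
    unfolding add_conv_def by (subst integral_distr) (auto simp: case_prod_unfold)
  finally show ?thesis by simp
qed

lemma borel_prob_add_conv: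
  fixes \<mu> \<nu> :: "'a::{real_normed_vector, second_countable_topology} measure"
  assumes "borel_prob \<mu>" "borel_prob \<nu>"
  shows "borel_prob (add_conv \<mu> \<nu>)"
proof -
  interpret M: prob_space \<mu> using assms(1) by (simp add: borel_prob_def)
  interpret N: prob_space \<nu> using assms(2) by (simp add: borel_prob_def)
  interpret P: pair_prob_space \<mu> \<nu> ..
  have [measurable_cong]: "sets \<mu> = sets borel" "sets \<nu> = sets borel"
    using assms by (auto simp: borel_prob_def)
  show ?thesis
    unfolding borel_prob_def add_conv_def by (auto intro!: P.prob_space_distr)
qed

text \<open>Serves twice: for the conditional mean given one summand of a convolution, and for the
  transition operators, which are such averages evaluated at \<open>T t x\<close>.\<close>

lemma translation_average:
  fixes f :: "'a::{real_normed_vector, second_countable_topology} \<Rightarrow> real"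
  assumes \<nu>: "borel_prob \<nu>" and f: "L-lipschitz_on UNIV f" and B: "\<And>x. \<bar>f x\<bar> \<le> B"
  shows "L-lipschitz_on UNIV (\<lambda>x. LINT y|\<nu>. f (x + y))" and "\<bar>LINT y|\<nu>. f (x + y)\<bar> \<le> B"
proof -
  note [measurable] = lipschitz_on_UNIV_measurable[OF f]
  interpret N: prob_space \<nu> using \<nu> by (simp add: borel_prob_def)
  have int: "integrable \<nu> (\<lambda>y. f (x + y))" for x
    using B by (intro borel_prob_integrable_bounded[OF \<nu>]) (auto simp: bounded_iff)
  show "L-lipschitz_on UNIV (\<lambda>x. LINT y|\<nu>. f (x + y))"
  proof (rule lipschitz_onI)
    fix x x' :: 'a
    have "\<bar>(LINT y|\<nu>. f (x + y)) - (LINT y|\<nu>. f (x' + y))\<bar> = \<bar>LINT y|\<nu>. f (x + y) - f (x' + y)\<bar>"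
      by (simp add: int)
    also have "\<dots> \<le> (LINT y|\<nu>. L * dist x x')"
    proof (rule norm_integral_le[where 'b = real, unfolded real_norm_def])
      show "integrable \<nu> (\<lambda>y. f (x + y) - f (x' + y))" using int by simp
      show "\<bar>f (x + y) - f (x' + y)\<bar> \<le> L * dist x x'" for y
        using lipschitz_onD[OF f, of "x + y" "x' + y"] by (simp add: dist_real_def)
    qed simp
    finally show "dist (LINT y|\<nu>. f (x + y)) (LINT y|\<nu>. f (x' + y)) \<le> L * dist x x'"
      by (simp add: dist_real_def N.prob_space)
  qed (rule lipschitz_on_nonneg[OF f])
  have "\<bar>LINT y|\<nu>. f (x + y)\<bar> \<le> (LINT y|\<nu>. B)"
    by (rule norm_integral_le[where 'b = real, unfolded real_norm_def]) (use int B in auto)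
  then show "\<bar>LINT y|\<nu>. f (x + y)\<bar> \<le> B" by (simp add: N.prob_space)
qed

text \<open>For fixed \<open>x\<close> the bound of \<open>\<nu>\<close> applies to
  \<open>y \<mapsto> g (x + y)\<close> and leaves \<open>exp (l * \<phi> x)\<close> times a
  constant. The conditional mean \<open>\<phi>\<close> is again bounded and 1-Lipschitz, so the
  bound of \<open>\<mu>\<close> applies to it; this closure property is what singles out Lipschitz
  functions.\<close>

lemma laplace_bounded_add_conv:
  fixes \<mu> \<nu> :: "'a::{real_normed_vector, second_countable_topology} measure"
  assumes \<mu>: "borel_prob \<mu>" and \<nu>: "borel_prob \<nu>"
    and C: "laplace_bounded l C \<mu>" and D: "laplace_bounded l D \<nu>"
  shows "laplace_bounded l (C + D) (add_conv \<mu> \<nu>)"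
  unfolding laplace_bounded_def
proof safe
  fix g :: "'a \<Rightarrow> real"
  assume g: "1-lipschitz_on UNIV g" and bdd: "bounded (range g)"
  note [measurable] = lipschitz_on_UNIV_measurable[OF g]
  interpret M: prob_space \<mu> using \<mu> by (simp add: borel_prob_def)
  interpret N: prob_space \<nu> using \<nu> by (simp add: borel_prob_def)
  have [measurable_cong]: "sets \<mu> = sets borel" "sets \<nu> = sets borel"
    using \<mu> \<nu> by (auto simp: borel_prob_def)
  obtain B where B: "\<And>x. \<bar>g x\<bar> \<le> B" using bdd by (auto simp: bounded_iff)
  have shift: "1-lipschitz_on UNIV (\<lambda>y. g (x + y))" "bounded (range (\<lambda>y. g (x + y)))" for x
    using B lipschitz_onD[OF g, of "x + _" "x + _"]
    by (auto intro!: lipschitz_onI simp: bounded_iff)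
  define \<phi> where "\<phi> = (\<lambda>x. LINT y|\<nu>. g (x + y))"
  have \<phi>_lip: "1-lipschitz_on UNIV \<phi>"
    unfolding \<phi>_def by (rule translation_average[OF \<nu> g B])
  have "\<bar>\<phi> x\<bar> \<le> B" for x
    unfolding \<phi>_def by (rule translation_average[OF \<nu> g B])
  then have \<phi>_bdd: "bounded (range \<phi>)" by (auto simp: bounded_iff)
  have [measurable]: "\<phi> \<in> borel_measurable borel"
    by (rule lipschitz_on_UNIV_measurable[OF \<phi>_lip])
  have "(LINT z|add_conv \<mu> \<nu>. exp (l * g z)) = (LINT x|\<mu>. LINT y|\<nu>. exp (l * g (x + y)))"
    by (rule add_conv_integral[OF \<mu> \<nu> _ bounded_exp_mult[OF bdd]]) simp
  also have "\<dots> \<le> (LINT x|\<mu>. exp (l * \<phi> x) * exp D)"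
  proof (rule integral_mono')
    show "integrable \<mu> (\<lambda>x. exp (l * \<phi> x) * exp D)"
      by (intro integrable_mult_left borel_prob_integrable_bounded[OF \<mu> _ bounded_exp_mult[OF \<phi>_bdd]])
         simp
    show "(LINT y|\<nu>. exp (l * g (x + y))) \<le> exp (l * \<phi> x) * exp D" for x
      using D shift[of x] unfolding laplace_bounded_def \<phi>_def by (simp add: exp_add)
  qed simp
  also have "\<dots> = exp D * (LINT x|\<mu>. exp (l * \<phi> x))" by simp
  also have "\<dots> \<le> exp D * exp (l * (LINT x|\<mu>. \<phi> x) + C)"
    using C \<phi>_lip \<phi>_bdd unfolding laplace_bounded_def by simp
  also have "\<dots> = exp (l * (LINT z|add_conv \<mu> \<nu>. g z) + (C + D))"
    by (subst add_conv_integral[OF \<mu> \<nu> _ bdd]) (simp_all add: \<phi>_def exp_add mult_ac)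
  finally show "(LINT x|add_conv \<mu> \<nu>. exp (l * g x)) \<le> exp (l * (LINT x|add_conv \<mu> \<nu>. g x) + (C + D))" .
qed

lemma borel_prob_return: "borel_prob (return borel c)"
  by (simp add: borel_prob_def prob_space_return)

lemma laplace_bounded_return: "laplace_bounded l 0 (return borel (c::'a::metric_space))"
  by (auto simp: laplace_bounded_def integral_return dest!: lipschitz_on_UNIV_measurable)

text \<open>For negative \<open>a = - x\<close> the claim is \<open>x \<le> sinh x\<close>, and the
  derivative of \<open>2 * (sinh x - x)\<close> is a perfect square.\<close>

lemma exp_minus_one_minus_le_abs: "exp a - 1 - a \<le> exp \<bar>a\<bar> - 1 - \<bar>a::real\<bar>"
proof (cases "a \<ge> 0")
  case False
  define x where "x = - a"
  have "x \<ge> 0" using False by (simp add: x_def)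
  have "(\<lambda>x. exp x - exp (-x) - 2 * x) 0 \<le> (\<lambda>x. exp x - exp (-x) - 2 * x) x"
  proof (rule DERIV_nonneg_imp_nondecreasing[OF \<open>x \<ge> 0\<close>])
    fix y :: real
    have "exp y + exp (- y) - 2 \<ge> 0"
    proof -
      have "0 \<le> (exp (y/2) - exp (-y/2))\<^sup>2" by simp
      also have "\<dots> = exp y + exp (- y) - 2"
        by (simp add: power2_diff flip: exp_double exp_add)
      finally show ?thesis .
    qed
    then show "\<exists>D. ((\<lambda>x. exp x - exp (-x) - 2 * x) has_real_derivative D) (at y) \<and> 0 \<le> D"
      by (intro exI[of _ "exp y + exp (- y) - 2"]) (auto intro!: derivative_eq_intros)
  qed
  then show ?thesis using False by (simp add: x_def)
qed simp

text \<open>Centring at \<open>g 0\<close> suffices because \<open>1 + x \<le> exp x\<close> absorbs the first-order term.\<close>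

lemma laplace_bounded_exp_moment:
  fixes \<rho> :: "'a::real_normed_vector measure"
  assumes \<rho>: "borel_prob \<rho>" and l: "0 \<le> l"
    and int: "integrable \<rho> (\<lambda>u. exp (l * norm u) - 1 - l * norm u)"
  shows "laplace_bounded l (LINT u|\<rho>. exp (l * norm u) - 1 - l * norm u) \<rho>"
  unfolding laplace_bounded_def
proof safe
  fix g :: "'a \<Rightarrow> real"
  assume g: "1-lipschitz_on UNIV g" and bdd: "bounded (range g)"
  note [measurable] = lipschitz_on_UNIV_measurable[OF g]
  interpret M: prob_space \<rho> using \<rho> by (simp add: borel_prob_def)
  have [measurable_cong]: "sets \<rho> = sets borel"
    using \<rho> by (auto simp: borel_prob_def)
  let ?K = "LINT u|\<rho>. exp (l * norm u) - 1 - l * norm u"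
  have ig: "integrable \<rho> g"
    by (rule borel_prob_integrable_bounded[OF \<rho> _ bdd]) simp
  have ie: "integrable \<rho> (\<lambda>u. exp (l * g u))"
    by (rule borel_prob_integrable_bounded[OF \<rho> _ bounded_exp_mult[OF bdd]]) simp
  \<comment> \<open>Only the remainder of the exponential is estimated, through
    \<open>|g u - g 0| \<le> norm u\<close>; the linear term is kept exact because it integrates to
    the mean of \<open>g\<close>.\<close>
  have pt: "exp (l * g u) \<le> exp (l * g 0) * (1 + l * (g u - g 0) + (exp (l * norm u) - 1 - l * norm u))" for u
  proof -
    have "\<bar>g u - g 0\<bar> \<le> norm u"
      using lipschitz_onD[OF g, of u 0] by (simp add: dist_real_def)
    then have le: "l * \<bar>g u - g 0\<bar> \<le> l * norm u" using l by (rule mult_left_mono)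
    have mono: "exp x - x \<le> exp y - y" if "0 \<le> x" "x \<le> y" for x y :: real
    proof (rule DERIV_nonneg_imp_nondecreasing[OF that(2)])
      fix z assume "x \<le> z"
      then show "\<exists>D. ((\<lambda>a. exp a - a) has_real_derivative D) (at z) \<and> 0 \<le> D"
        using that by (intro exI[of _ "exp z - 1"]) (auto intro!: derivative_eq_intros)
    qed
    have "exp (l * (g u - g 0)) - 1 - l * (g u - g 0) \<le> exp (l * \<bar>g u - g 0\<bar>) - 1 - l * \<bar>g u - g 0\<bar>"
      using exp_minus_one_minus_le_abs[of "l * (g u - g 0)"] l by (simp add: abs_mult)
    also have "\<dots> \<le> exp (l * norm u) - 1 - l * norm u"
      using mono[OF _ le] l by simp
    finally have "exp (l * (g u - g 0)) \<le> 1 + l * (g u - g 0) + (exp (l * norm u) - 1 - l * norm u)"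
      by simp
    then have "exp (l * g 0) * exp (l * (g u - g 0)) \<le> exp (l * g 0) * (1 + l * (g u - g 0) + (exp (l * norm u) - 1 - l * norm u))"
      by simp
    then show ?thesis by (simp flip: exp_add add: right_diff_distrib)
  qed
  have "(LINT u|\<rho>. exp (l * g u)) \<le>
      (LINT u|\<rho>. exp (l * g 0) * (1 + l * (g u - g 0) + (exp (l * norm u) - 1 - l * norm u)))"
    by (intro integral_mono ie integrable_mult_right Bochner_Integration.integrable_add
          Bochner_Integration.integrable_diff int ig pt) auto
  also have "\<dots> = exp (l * g 0) * (1 + l * ((LINT u|\<rho>. g u) - g 0) + ?K)"
  proof -
    have "(LINT u|\<rho>. 1 + l * (g u - g 0) + (exp (l * norm u) - 1 - l * norm u)) =
        (LINT u|\<rho>. 1 + l * (g u - g 0)) + ?K"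
      using int ig by (intro Bochner_Integration.integral_add) auto
    also have "(LINT u|\<rho>. 1 + l * (g u - g 0)) = 1 + l * ((LINT u|\<rho>. g u) - g 0)"
      using ig by (simp add: M.prob_space)
    finally show ?thesis by simp
  qed
  also have "\<dots> \<le> exp (l * g 0) * exp (l * ((LINT u|\<rho>. g u) - g 0) + ?K)"
    using exp_ge_add_one_self[of "l * ((LINT u|\<rho>. g u) - g 0) + ?K"] by (simp add: add_ac)
  also have "\<dots> = exp (l * (LINT u|\<rho>. g u) + ?K)"
    by (simp flip: exp_add add: algebra_simps)
  finally show "(LINT u|\<rho>. exp (l * g u)) \<le> exp (l * (LINT u|\<rho>. g u) + ?K)" .
qed

text \<open>The iteration starts from the point mass at \<open>c\<close>, so that one object carries
  both the \<open>n\<close> random jumps and the deterministic drift.\<close>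

definition conv_power :: "'a::real_normed_vector measure \<Rightarrow> 'a \<Rightarrow> nat \<Rightarrow> 'a measure" where
  "conv_power \<rho> c n = (add_conv \<rho> ^^ n) (return borel c)"

lemma conv_power_simps:
  "conv_power \<rho> c 0 = return borel c"
  "conv_power \<rho> c (Suc n) = add_conv \<rho> (conv_power \<rho> c n)"
  by (simp_all add: conv_power_def)

lemma borel_prob_conv_power:
  fixes \<rho> :: "'a::{real_normed_vector, second_countable_topology} measure"
  assumes "borel_prob \<rho>"
  shows "borel_prob (conv_power \<rho> c n)"
  by (induction n) (simp_all add: conv_power_simps borel_prob_return borel_prob_add_conv assms)

lemma laplace_bounded_conv_power:
  fixes \<rho> :: "'a::{real_normed_vector, second_countable_topology} measure"
  assumes "borel_prob \<rho>" "laplace_bounded l C \<rho>"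
  shows "laplace_bounded l (real n * C) (conv_power \<rho> c n)"
proof (induction n)
  case (Suc n)
  show ?case
    using laplace_bounded_add_conv[OF assms(1) borel_prob_conv_power[OF assms(1)] assms(2) Suc]
    by (simp add: conv_power_simps algebra_simps)
qed (simp add: conv_power_simps laplace_bounded_return)

section \<open>Characteristic functions of convolutions\<close>

lemma borel_measurable_char_integrand [measurable]:
  "(\<lambda>x. exp (\<i> * complex_of_real (x \<bullet> \<xi>))) \<in> borel_measurable borel"
  by (intro borel_measurable_continuous_onI continuous_intros)

lemma bounded_char_integrand:
  "bounded (range (\<lambda>x. exp (\<i> * complex_of_real (x \<bullet> \<xi>))))"
  by (auto simp: bounded_iff intro!: exI[of _ 1])

lemma char_fun_add_conv:
  fixes \<mu> \<nu> :: "'a::{real_inner, second_countable_topology} measure"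
  assumes "borel_prob \<mu>" "borel_prob \<nu>"
  shows "char_fun (add_conv \<mu> \<nu>) \<xi> = char_fun \<mu> \<xi> * char_fun \<nu> \<xi>"
  unfolding char_fun_def
  by (subst add_conv_integral[OF assms borel_measurable_char_integrand bounded_char_integrand])
     (simp add: inner_add_left algebra_simps exp_add)

lemma char_fun_conv_power:
  fixes \<rho> :: "'a::{real_inner, second_countable_topology} measure"
  assumes "borel_prob \<rho>"
  shows "char_fun (conv_power \<rho> c n) \<xi> = char_fun \<rho> \<xi> ^ n * exp (\<i> * complex_of_real (c \<bullet> \<xi>))"
proof (induction n)
  case 0
  then show ?case by (simp add: conv_power_simps char_fun_def integral_return)
next
  case (Suc n)
  then show ?case
    by (simp add: conv_power_simps char_fun_add_conv[OF assms borel_prob_conv_power[OF assms]])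
qed

lemma norm_char_fun_le_1:
  assumes "borel_prob \<mu>"
  shows "norm (char_fun \<mu> \<xi>) \<le> 1"
proof -
  interpret prob_space \<mu> using assms by (simp add: borel_prob_def)
  have "norm (char_fun \<mu> \<xi>) \<le> (LINT x|\<mu>. norm (exp (\<i> * complex_of_real (x \<bullet> \<xi>))))"
    unfolding char_fun_def by (rule integral_norm_bound)
  also have "\<dots> = 1" by (simp add: prob_space)
  finally show ?thesis .
qed

section \<open>Gaussian smoothing and convergence of characteristic functions\<close>

definition orthonormal :: "'a::real_inner set \<Rightarrow> bool" where
  "orthonormal I \<longleftrightarrow> pairwise orthogonal I \<and> (\<forall>e\<in>I. norm e = 1)"

definition ortho_proj :: "'a::real_inner set \<Rightarrow> 'a \<Rightarrow> 'a" where
  "ortho_proj I x = (\<Sum>e\<in>I. (x \<bullet> e) *\<^sub>R e)"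

text \<open>For orthonormal \<open>I\<close> this is the density, at coordinates \<open>z\<close>,
  of \<open>ortho_proj I x\<close> plus a centred Gaussian vector with standard deviation
  \<open>\<epsilon>\<close> in each direction. Points of the span are encoded by coordinate
  functions on \<open>I\<close>, so that product Lebesgue measure is at hand.\<close>

definition gauss_kernel :: "'a::real_inner set \<Rightarrow> real \<Rightarrow> 'a \<Rightarrow> ('a \<Rightarrow> real) \<Rightarrow> real" where
  "gauss_kernel I \<epsilon> x z = (\<Prod>e\<in>I. normal_density (x \<bullet> e) \<epsilon> (z e))"

text \<open>Up to scaling the Gaussian is its own Fourier transform.\<close>

lemma normal_density_eq_char:
  assumes "0 < \<epsilon>"
  shows "complex_of_real (normal_density a \<epsilon> y) =
    complex_of_real (1 / sqrt (2 * pi * \<epsilon>\<^sup>2)) *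
    (CLINT s|std_normal_distribution. iexp ((y - a) / \<epsilon> * s))"
proof -
  have "(CLINT s|std_normal_distribution. iexp ((y - a) / \<epsilon> * s)) = char std_normal_distribution ((y - a) / \<epsilon>)"
    by (simp add: char_def)
  also have "\<dots> = complex_of_real (exp (- ((y - a) / \<epsilon>)\<^sup>2 / 2))"
    by (simp add: char_std_normal_distribution)
  finally show ?thesis
    using assms by (simp add: normal_density_def power_divide flip: of_real_mult)
qed

text \<open>Separates the variables: \<open>x\<close> enters only through a character whose
  frequency lies in \<open>span I\<close>. Integrating over \<open>x\<close> therefore brings in the
  law only through its characteristic function on that span.\<close>

lemma gauss_kernel_eq_char:
  fixes I :: "'a::real_inner set"
  assumes "finite I" "0 < \<epsilon>"
  shows "complex_of_real (gauss_kernel I \<epsilon> x z) =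
    complex_of_real (1 / sqrt (2 * pi * \<epsilon>\<^sup>2)) ^ card I *
    (CLINT w|Pi\<^sub>M I (\<lambda>_. std_normal_distribution).
       iexp (\<Sum>e\<in>I. z e / \<epsilon> * w e) * iexp (x \<bullet> (\<Sum>e\<in>I. (- w e / \<epsilon>) *\<^sub>R e)))"
proof -
  interpret N: prob_space std_normal_distribution
    using prob_space_normal_density[of 1 0] by simp
  interpret P: product_prob_space "\<lambda>_. std_normal_distribution" I ..
  have "complex_of_real (gauss_kernel I \<epsilon> x z) =
      complex_of_real (1 / sqrt (2 * pi * \<epsilon>\<^sup>2)) ^ card I *
      (\<Prod>e\<in>I. CLINT s|std_normal_distribution. iexp ((z e - x \<bullet> e) / \<epsilon> * s))"
    unfolding gauss_kernel_def of_real_prod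
    by (simp only: normal_density_eq_char[OF assms(2)] prod.distrib prod_constant)
  also have "(\<Prod>e\<in>I. CLINT s|std_normal_distribution. iexp ((z e - x \<bullet> e) / \<epsilon> * s)) =
      (CLINT w|Pi\<^sub>M I (\<lambda>_. std_normal_distribution). \<Prod>e\<in>I. iexp ((z e - x \<bullet> e) / \<epsilon> * w e))"
    by (subst P.product_integral_prod[OF assms(1)])
       (auto intro!: N.integrable_const_bound[of _ 1] simp del: of_real_mult of_real_divide)
  also have "(\<lambda>w. \<Prod>e\<in>I. iexp ((z e - x \<bullet> e) / \<epsilon> * w e)) =
      (\<lambda>w. iexp (\<Sum>e\<in>I. z e / \<epsilon> * w e) * iexp (x \<bullet> (\<Sum>e\<in>I. (- w e / \<epsilon>) *\<^sub>R e)))"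
  proof
    fix w :: "'a \<Rightarrow> real"
    have "(\<Sum>e\<in>I. (z e - x \<bullet> e) / \<epsilon> * w e) =
        (\<Sum>e\<in>I. z e / \<epsilon> * w e) + x \<bullet> (\<Sum>e\<in>I. (- w e / \<epsilon>) *\<^sub>R e)"
      by (simp add: inner_sum_right flip: sum.distrib)
         (simp add: diff_divide_distrib algebra_simps)
    moreover have "(\<Prod>e\<in>I. iexp ((z e - x \<bullet> e) / \<epsilon> * w e)) =
        iexp (\<Sum>e\<in>I. (z e - x \<bullet> e) / \<epsilon> * w e)"
      using assms(1) by (simp add: exp_sum sum_distrib_left del: of_real_mult of_real_divide)
    ultimately show "(\<Prod>e\<in>I. iexp ((z e - x \<bullet> e) / \<epsilon> * w e)) =
        iexp (\<Sum>e\<in>I. z e / \<epsilon> * w e) * iexp (x \<bullet> (\<Sum>e\<in>I. (- w e / \<epsilon>) *\<^sub>R e))"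
      by (simp only: of_real_add distrib_left exp_add)
  qed
  finally show ?thesis .
qed

lemma gauss_kernel_nonneg: "0 \<le> gauss_kernel I \<epsilon> x z"
  by (simp add: gauss_kernel_def prod_nonneg)

text \<open>By Fubini the integral of the kernel is an average of the characteristic function over
  Gaussian frequencies. Characteristic functions are bounded by 1, so pointwise convergence on
  \<open>span I\<close> passes to the average.\<close>

lemma tendsto_integral_gauss_kernel:
  fixes I :: "'a::{real_inner, second_countable_topology} set"
  assumes I: "finite I" and \<epsilon>: "0 < \<epsilon>"
    and \<mu>: "\<And>k. borel_prob (\<mu> k)" and \<nu>: "borel_prob \<nu>"
    and lim: "\<And>\<xi>. \<xi> \<in> span I \<Longrightarrow> (\<lambda>k. char_fun (\<mu> k) \<xi>) \<longlonglongrightarrow> char_fun \<nu> \<xi>"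
  shows "(\<lambda>k. LINT x|\<mu> k. gauss_kernel I \<epsilon> x z) \<longlonglongrightarrow> (LINT x|\<nu>. gauss_kernel I \<epsilon> x z)"
proof -
  let ?W = "Pi\<^sub>M I (\<lambda>_. std_normal_distribution)"
  let ?\<xi> = "\<lambda>w. \<Sum>e\<in>I. (- w e / \<epsilon>) *\<^sub>R e"
  let ?z = "\<lambda>w. \<Sum>e\<in>I. z e / \<epsilon> * w e"
  interpret N: prob_space std_normal_distribution
    using prob_space_normal_density[of 1 0] by simp
  interpret P: product_prob_space "\<lambda>_. std_normal_distribution" I ..
  have [measurable]: "(\<lambda>w. w e) \<in> borel_measurable ?W" if "e \<in> I" for e
    using measurable_component_singleton[OF that, of "\<lambda>_. std_normal_distribution"]
    by (simp cong: measurable_cong_sets)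
  have m1 [measurable]: "?\<xi> \<in> borel_measurable ?W" "?z \<in> borel_measurable ?W"
    by measurable
  have rep: "complex_of_real (LINT x|m. gauss_kernel I \<epsilon> x z) =
      complex_of_real (1 / sqrt (2 * pi * \<epsilon>\<^sup>2)) ^ card I * (CLINT w|?W. iexp (?z w) * char_fun m (?\<xi> w))"
    and meas: "(\<lambda>w. char_fun m (?\<xi> w)) \<in> borel_measurable ?W"
    if m: "borel_prob m" for m
  proof -
    interpret M: prob_space m using m by (simp add: borel_prob_def)
    interpret Q: pair_prob_space m ?W ..
    have [measurable_cong]: "sets m = sets borel" using m by (simp add: borel_prob_def)
    have meas2: "(\<lambda>(x, w). iexp (x \<bullet> ?\<xi> w)) \<in> borel_measurable (m \<Otimes>\<^sub>M ?W)"
      by measurable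
    have meas2': "(\<lambda>(w, x). iexp (x \<bullet> ?\<xi> w)) \<in> borel_measurable (?W \<Otimes>\<^sub>M m)"
      by measurable
    have meas3: "(\<lambda>(x, w). iexp (?z w) * iexp (x \<bullet> ?\<xi> w)) \<in> borel_measurable (m \<Otimes>\<^sub>M ?W)"
      by measurable
    have int: "integrable (m \<Otimes>\<^sub>M ?W) (\<lambda>(x, w). iexp (?z w) * iexp (x \<bullet> ?\<xi> w))"
      by (rule Q.integrable_const_bound[of _ 1, OF _ meas3])
         (auto simp: norm_mult simp del: of_real_mult of_real_sum of_real_divide)
    show "(\<lambda>w. char_fun m (?\<xi> w)) \<in> borel_measurable ?W"
      unfolding char_fun_def
      by (rule M.borel_measurable_lebesgue_integral) (rule meas2')
    have "complex_of_real (LINT x|m. gauss_kernel I \<epsilon> x z) = (CLINT x|m. complex_of_real (gauss_kernel I \<epsilon> x z))"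
      by simp
    also have "\<dots> = complex_of_real (1 / sqrt (2 * pi * \<epsilon>\<^sup>2)) ^ card I *
        (CLINT x|m. CLINT w|?W. iexp (?z w) * iexp (x \<bullet> ?\<xi> w))"
      by (simp only: gauss_kernel_eq_char[OF I \<epsilon>] integral_mult_right_zero)
    also have "(CLINT x|m. CLINT w|?W. iexp (?z w) * iexp (x \<bullet> ?\<xi> w)) =
        (CLINT w|?W. CLINT x|m. iexp (?z w) * iexp (x \<bullet> ?\<xi> w))"
      using Q.Fubini_integral[OF int] by simp
    also have "\<dots> = (CLINT w|?W. iexp (?z w) * char_fun m (?\<xi> w))"
      by (simp only: char_fun_def integral_mult_right_zero)
    finally show "complex_of_real (LINT x|m. gauss_kernel I \<epsilon> x z) =
      complex_of_real (1 / sqrt (2 * pi * \<epsilon>\<^sup>2)) ^ card I * (CLINT w|?W. iexp (?z w) * char_fun m (?\<xi> w))" .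
  qed
  have span: "?\<xi> w \<in> span I" for w
    by (intro span_sum span_scale span_base)
  have "(\<lambda>k. CLINT w|?W. iexp (?z w) * char_fun (\<mu> k) (?\<xi> w)) \<longlonglongrightarrow>
      (CLINT w|?W. iexp (?z w) * char_fun \<nu> (?\<xi> w))"
  proof (rule integral_dominated_convergence[where w = "\<lambda>_. 1"])
    show "(\<lambda>w. iexp (?z w) * char_fun \<nu> (?\<xi> w)) \<in> borel_measurable ?W"
      using meas[OF \<nu>] by measurable
    show "(\<lambda>w. iexp (?z w) * char_fun (\<mu> k) (?\<xi> w)) \<in> borel_measurable ?W" for k
      using meas[OF \<mu>[of k]] by measurable
    show "AE w in ?W. (\<lambda>k. iexp (?z w) * char_fun (\<mu> k) (?\<xi> w)) \<longlonglongrightarrow> iexp (?z w) * char_fun \<nu> (?\<xi> w)"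
      by (intro AE_I2 tendsto_mult tendsto_const lim span)
    show "AE w in ?W. norm (iexp (?z w) * char_fun (\<mu> k) (?\<xi> w)) \<le> 1" for k
      using norm_char_fun_le_1[OF \<mu>[of k]]
      by (simp add: norm_mult del: of_real_sum of_real_mult of_real_divide)
  qed simp
  then have "(\<lambda>k. complex_of_real (LINT x|\<mu> k. gauss_kernel I \<epsilon> x z)) \<longlonglongrightarrow>
      complex_of_real (LINT x|\<nu>. gauss_kernel I \<epsilon> x z)"
    unfolding rep[OF \<mu>] rep[OF \<nu>] by (intro tendsto_mult tendsto_const)
  then show ?thesis by (simp only: tendsto_of_real_iff)
qed

lemma integral_gauss_kernel:
  fixes I :: "'a::real_inner set"
  assumes "finite I" "0 < \<epsilon>"
  shows "integrable (Pi\<^sub>M I (\<lambda>_. lborel)) (gauss_kernel I \<epsilon> x)"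
    and "(LINT z|Pi\<^sub>M I (\<lambda>_. lborel). gauss_kernel I \<epsilon> x z) = 1"
proof -
  interpret P: product_sigma_finite "\<lambda>_::'a. lborel :: real measure" ..
  show "integrable (Pi\<^sub>M I (\<lambda>_. lborel)) (gauss_kernel I \<epsilon> x)"
    unfolding gauss_kernel_def using assms by (intro P.product_integrable_prod) auto
  show "(LINT z|Pi\<^sub>M I (\<lambda>_. lborel). gauss_kernel I \<epsilon> x z) = 1"
    unfolding gauss_kernel_def using assms
    by (subst P.product_integral_prod) auto
qed

text \<open>The exact value is \<open>\<epsilon> * sqrt (2 / pi)\<close>, the first absolute moment
  of a centred normal variable; all other coordinates integrate to 1.\<close>

lemma integral_gauss_kernel_deviation:
  fixes I :: "'a::real_inner set"
  assumes I: "finite I" and \<epsilon>: "0 < \<epsilon>" and e: "e \<in> I"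
  shows "integrable (Pi\<^sub>M I (\<lambda>_. lborel)) (\<lambda>z. gauss_kernel I \<epsilon> x z * \<bar>z e - x \<bullet> e\<bar>)"
    and "(LINT z|Pi\<^sub>M I (\<lambda>_. lborel). gauss_kernel I \<epsilon> x z * \<bar>z e - x \<bullet> e\<bar>) \<le> \<epsilon>"
proof -
  interpret P: product_sigma_finite "\<lambda>_::'a. lborel :: real measure" ..
  define f where "f = (\<lambda>i y. normal_density (x \<bullet> i) \<epsilon> y * (if i = e then \<bar>y - x \<bullet> e\<bar> else 1))"
  have mom: "has_bochner_integral lborel (\<lambda>y. normal_density (x \<bullet> e) \<epsilon> y * \<bar>y - x \<bullet> e\<bar>) (\<epsilon> * sqrt (2 / pi))"
    using normal_moment_abs_odd[OF \<epsilon>, of "x \<bullet> e" 0] by simp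
  have eq: "gauss_kernel I \<epsilon> x z * \<bar>z e - x \<bullet> e\<bar> = (\<Prod>i\<in>I. f i (z i))" for z
    using I e by (simp add: gauss_kernel_def f_def prod.distrib prod.delta)
  have int: "integrable lborel (f i)" for i
    using mom \<epsilon> by (cases "i = e") (auto simp: f_def[abs_def] has_bochner_integral_iff)
  have val: "integral\<^sup>L lborel (f i) = (if i = e then \<epsilon> * sqrt (2 / pi) else 1)" for i
    using mom \<epsilon> by (cases "i = e") (auto simp: f_def[abs_def] has_bochner_integral_iff)
  show "integrable (Pi\<^sub>M I (\<lambda>_. lborel)) (\<lambda>z. gauss_kernel I \<epsilon> x z * \<bar>z e - x \<bullet> e\<bar>)"
    unfolding eq by (intro P.product_integrable_prod I int)
  have "(LINT z|Pi\<^sub>M I (\<lambda>_. lborel). gauss_kernel I \<epsilon> x z * \<bar>z e - x \<bullet> e\<bar>) = \<epsilon> * sqrt (2 / pi)"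
    unfolding eq by (subst P.product_integral_prod[OF I int]) (use I e in \<open>simp add: val prod.delta\<close>)
  also have "\<dots> \<le> \<epsilon>"
    using \<epsilon> pi_gt3 by (simp add: mult_left_le)
  finally show "(LINT z|Pi\<^sub>M I (\<lambda>_. lborel). gauss_kernel I \<epsilon> x z * \<bar>z e - x \<bullet> e\<bar>) \<le> \<epsilon>" .
qed

text \<open>Each of the \<open>card I\<close> coordinates moves by at most \<open>\<epsilon>\<close>
  on average. The bound does not depend on \<open>x\<close>, hence it is uniform over all
  laws.\<close>

lemma gauss_smoothing_error:
  fixes I :: "'a::{real_inner, second_countable_topology} set" and f :: "'a \<Rightarrow> real"
  assumes I: "finite I" and on: "\<forall>e\<in>I. norm e = 1" and \<epsilon>: "0 < \<epsilon>"
    and f: "L-lipschitz_on UNIV f" and bdd: "bounded (range f)"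
  shows "\<bar>(LINT z|Pi\<^sub>M I (\<lambda>_. lborel). f (\<Sum>e\<in>I. z e *\<^sub>R e) * gauss_kernel I \<epsilon> x z) - f (ortho_proj I x)\<bar>
    \<le> L * real (card I) * \<epsilon>"
proof -
  let ?Z = "Pi\<^sub>M I (\<lambda>_. lborel :: real measure)"
  have [measurable]: "f \<in> borel_measurable borel" by (rule lipschitz_on_UNIV_measurable[OF f])
  note [measurable] = borel_measurable_integrable[OF integral_gauss_kernel(1)[OF I \<epsilon>]]
  have L: "0 \<le> L" using f by (rule lipschitz_on_nonneg)
  have [measurable]: "(\<lambda>z. f (\<Sum>e\<in>I. z e *\<^sub>R e)) \<in> borel_measurable ?Z"
  proof -
    have [measurable]: "(\<lambda>z. z e) \<in> borel_measurable ?Z" if "e \<in> I" for e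
      using measurable_component_singleton[OF that, of "\<lambda>_. lborel"]
      by (simp cong: measurable_cong_sets)
    show ?thesis by measurable
  qed
  obtain B where B: "\<And>x. \<bar>f x\<bar> \<le> B" using bdd by (auto simp: bounded_iff)
  have int: "integrable ?Z (\<lambda>z. f (\<Sum>e\<in>I. z e *\<^sub>R e) * gauss_kernel I \<epsilon> x z)"
  proof (rule Bochner_Integration.integrable_bound[OF integrable_mult_right[OF integral_gauss_kernel(1)[OF I \<epsilon>], of B]])
    show "AE z in ?Z. norm (f (\<Sum>e\<in>I. z e *\<^sub>R e) * gauss_kernel I \<epsilon> x z) \<le> norm (B * gauss_kernel I \<epsilon> x z)"
    proof (rule AE_I2)
      fix z
      have "B = \<bar>B\<bar>" using B[of 0] by simp
      then have "\<bar>f (\<Sum>e\<in>I. z e *\<^sub>R e)\<bar> \<le> \<bar>B\<bar>" using B by metis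
      then show "norm (f (\<Sum>e\<in>I. z e *\<^sub>R e) * gauss_kernel I \<epsilon> x z) \<le> norm (B * gauss_kernel I \<epsilon> x z)"
        unfolding real_norm_def abs_mult by (rule mult_right_mono) simp
    qed
  qed measurable
  have pt: "\<bar>f (\<Sum>e\<in>I. z e *\<^sub>R e) - f (ortho_proj I x)\<bar> \<le> L * (\<Sum>e\<in>I. \<bar>z e - x \<bullet> e\<bar>)" for z
  proof -
    have "dist (\<Sum>e\<in>I. z e *\<^sub>R e) (ortho_proj I x) = norm (\<Sum>e\<in>I. (z e - x \<bullet> e) *\<^sub>R e)"
      by (simp add: dist_norm ortho_proj_def scaleR_left_diff_distrib sum_subtractf)
    also have "\<dots> \<le> (\<Sum>e\<in>I. \<bar>z e - x \<bullet> e\<bar>)"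
      by (rule order_trans[OF norm_sum]) (use on in \<open>simp add: sum_mono\<close>)
    finally have "L * dist (\<Sum>e\<in>I. z e *\<^sub>R e) (ortho_proj I x) \<le> L * (\<Sum>e\<in>I. \<bar>z e - x \<bullet> e\<bar>)"
      using L by (rule mult_left_mono)
    with lipschitz_onD[OF f, of "\<Sum>e\<in>I. z e *\<^sub>R e" "ortho_proj I x"] show ?thesis
      by (simp add: dist_real_def)
  qed
  have "(LINT z|?Z. f (\<Sum>e\<in>I. z e *\<^sub>R e) * gauss_kernel I \<epsilon> x z) - f (ortho_proj I x) =
      (LINT z|?Z. f (\<Sum>e\<in>I. z e *\<^sub>R e) * gauss_kernel I \<epsilon> x z - f (ortho_proj I x) * gauss_kernel I \<epsilon> x z)"
    using int integral_gauss_kernel[OF I \<epsilon>, of x] by (subst Bochner_Integration.integral_diff) auto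
  also have "\<bar>\<dots>\<bar> \<le> (LINT z|?Z. L * (\<Sum>e\<in>I. gauss_kernel I \<epsilon> x z * \<bar>z e - x \<bullet> e\<bar>))"
  proof (rule norm_integral_le[where 'b = real, unfolded real_norm_def])
    show "integrable ?Z (\<lambda>z. f (\<Sum>e\<in>I. z e *\<^sub>R e) * gauss_kernel I \<epsilon> x z - f (ortho_proj I x) * gauss_kernel I \<epsilon> x z)"
      using int integral_gauss_kernel[OF I \<epsilon>, of x] by auto
    show "integrable ?Z (\<lambda>z. L * (\<Sum>e\<in>I. gauss_kernel I \<epsilon> x z * \<bar>z e - x \<bullet> e\<bar>))"
      by (intro integrable_mult_right Bochner_Integration.integrable_sum integral_gauss_kernel_deviation I \<epsilon>)
    fix z
    have "\<bar>f (\<Sum>e\<in>I. z e *\<^sub>R e) * gauss_kernel I \<epsilon> x z - f (ortho_proj I x) * gauss_kernel I \<epsilon> x z\<bar> =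
        \<bar>f (\<Sum>e\<in>I. z e *\<^sub>R e) - f (ortho_proj I x)\<bar> * gauss_kernel I \<epsilon> x z"
      using gauss_kernel_nonneg[of I \<epsilon> x z] by (simp add: abs_mult flip: left_diff_distrib)
    also have "\<dots> \<le> (L * (\<Sum>e\<in>I. \<bar>z e - x \<bullet> e\<bar>)) * gauss_kernel I \<epsilon> x z"
      by (intro mult_right_mono pt gauss_kernel_nonneg)
    also have "\<dots> = L * (\<Sum>e\<in>I. gauss_kernel I \<epsilon> x z * \<bar>z e - x \<bullet> e\<bar>)"
      by (simp add: sum_distrib_left sum_distrib_right mult_ac)
    finally show "\<bar>f (\<Sum>e\<in>I. z e *\<^sub>R e) * gauss_kernel I \<epsilon> x z - f (ortho_proj I x) * gauss_kernel I \<epsilon> x z\<bar>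
      \<le> L * (\<Sum>e\<in>I. gauss_kernel I \<epsilon> x z * \<bar>z e - x \<bullet> e\<bar>)" .
  qed
  also have "\<dots> = L * (\<Sum>e\<in>I. LINT z|?Z. gauss_kernel I \<epsilon> x z * \<bar>z e - x \<bullet> e\<bar>)"
    by (simp add: Bochner_Integration.integral_sum integral_gauss_kernel_deviation(1)[OF I \<epsilon>])
  also have "\<dots> \<le> L * (\<Sum>e\<in>I. \<epsilon>)"
    by (intro mult_left_mono sum_mono integral_gauss_kernel_deviation I \<epsilon> L)
  finally show ?thesis by simp
qed

text \<open>\<open>D\<close> is the Lebesgue density of the projected and smoothed law. The third
  fact turns the mean of the smoothed \<open>f\<close> into an integral against this density, which
  is the form in which densities of different laws can be compared.\<close>

lemma gauss_kernel_joint: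
  fixes I :: "'a::{real_inner, second_countable_topology} set" and f :: "'a \<Rightarrow> real"
  assumes I: "finite I" and \<epsilon>: "0 < \<epsilon>" and m: "borel_prob m"
    and f: "f \<in> borel_measurable borel" and bdd: "bounded (range f)"
  defines "Z \<equiv> Pi\<^sub>M I (\<lambda>_. lborel :: real measure)"
  defines "D \<equiv> \<lambda>z. LINT x|m. gauss_kernel I \<epsilon> x z"
  shows "integrable Z D" and "(LINT z|Z. D z) = 1"
    and "(LINT x|m. LINT z|Z. f (\<Sum>e\<in>I. z e *\<^sub>R e) * gauss_kernel I \<epsilon> x z) =
         (LINT z|Z. f (\<Sum>e\<in>I. z e *\<^sub>R e) * D z)"
    and "integrable m (\<lambda>x. LINT z|Z. f (\<Sum>e\<in>I. z e *\<^sub>R e) * gauss_kernel I \<epsilon> x z)"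
    and "(\<lambda>z. f (\<Sum>e\<in>I. z e *\<^sub>R e)) \<in> borel_measurable Z"
proof -
  interpret P: product_sigma_finite "\<lambda>_::'a. lborel :: real measure" ..
  interpret S: sigma_finite_measure Z unfolding Z_def by (rule P.sigma_finite[OF I])
  interpret M: prob_space m using m by (simp add: borel_prob_def)
  interpret Q: pair_sigma_finite m Z ..
  have [measurable_cong]: "sets m = sets borel" using m by (simp add: borel_prob_def)
  note [measurable] = f
  have [measurable]: "(\<lambda>z. z e) \<in> borel_measurable Z" if "e \<in> I" for e
    using measurable_component_singleton[OF that, of "\<lambda>_. lborel"]
    unfolding Z_def by (simp cong: measurable_cong_sets)
  have G [measurable]: "(\<lambda>(x, z). gauss_kernel I \<epsilon> x z) \<in> borel_measurable (m \<Otimes>\<^sub>M Z)"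
    unfolding gauss_kernel_def normal_density_def by measurable
  show f\<iota> [measurable]: "(\<lambda>z. f (\<Sum>e\<in>I. z e *\<^sub>R e)) \<in> borel_measurable Z"
    by measurable
  note K = integral_gauss_kernel[OF I \<epsilon>, folded Z_def]
  have intG: "integrable (m \<Otimes>\<^sub>M Z) (\<lambda>(x, z). gauss_kernel I \<epsilon> x z)"
  proof (rule Q.Fubini_integrable[OF G])
    show "integrable m (\<lambda>x. LINT z|Z. norm (case (x, z) of (x, z) \<Rightarrow> gauss_kernel I \<epsilon> x z))"
      using K by (simp add: gauss_kernel_nonneg)
    show "AE x in m. integrable Z (\<lambda>z. case (x, z) of (x, z) \<Rightarrow> gauss_kernel I \<epsilon> x z)"
      using K by (simp add: gauss_kernel_nonneg)
  qed
  obtain B where B: "\<And>x. \<bar>f x\<bar> \<le> B" using bdd by (auto simp: bounded_iff)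
  have intfG: "integrable (m \<Otimes>\<^sub>M Z) (\<lambda>(x, z). f (\<Sum>e\<in>I. z e *\<^sub>R e) * gauss_kernel I \<epsilon> x z)"
  proof (rule Bochner_Integration.integrable_bound[OF integrable_mult_right[OF intG, of B]])
    show "AE p in m \<Otimes>\<^sub>M Z. norm (case p of (x, z) \<Rightarrow> f (\<Sum>e\<in>I. z e *\<^sub>R e) * gauss_kernel I \<epsilon> x z)
        \<le> norm (B * (case p of (x, z) \<Rightarrow> gauss_kernel I \<epsilon> x z))"
    proof (rule AE_I2, clarify)
      fix x z
      have "B = \<bar>B\<bar>" using B[of 0] by simp
      then have "\<bar>f (\<Sum>e\<in>I. z e *\<^sub>R e)\<bar> \<le> \<bar>B\<bar>" using B by metis
      then show "norm (f (\<Sum>e\<in>I. z e *\<^sub>R e) * gauss_kernel I \<epsilon> x z) \<le> norm (B * gauss_kernel I \<epsilon> x z)"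
        unfolding real_norm_def abs_mult by (rule mult_right_mono) simp
    qed
  qed measurable
  show "integrable Z D"
    using Q.integrable_snd[OF intG] by (simp add: D_def)
  have "(LINT z|Z. D z) = (LINT x|m. LINT z|Z. gauss_kernel I \<epsilon> x z)"
    using Q.Fubini_integral[OF intG] by (simp add: D_def)
  then show "(LINT z|Z. D z) = 1" using K by (simp add: M.prob_space)
  show "integrable m (\<lambda>x. LINT z|Z. f (\<Sum>e\<in>I. z e *\<^sub>R e) * gauss_kernel I \<epsilon> x z)"
    using Q.integrable_fst[OF intfG] by simp
  show "(LINT x|m. LINT z|Z. f (\<Sum>e\<in>I. z e *\<^sub>R e) * gauss_kernel I \<epsilon> x z) =
         (LINT z|Z. f (\<Sum>e\<in>I. z e *\<^sub>R e) * D z)"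
    using Q.Fubini_integral[OF intfG] by (simp add: D_def)
qed

lemma ortho_proj_measurable:
  fixes I :: "'a::{real_inner, second_countable_topology} set"
  shows "ortho_proj I \<in> borel_measurable borel"
  unfolding ortho_proj_def by measurable

text \<open>Smoothing turns convergence of characteristic functions into pointwise convergence of
  densities. All of them have mass 1, so Scheffe's lemma upgrades this to convergence in mean. The
  smoothing error is uniform in \<open>k\<close> because \<open>f\<close> is Lipschitz.\<close>

proposition levy_continuity_ortho_proj:
  fixes I :: "'a::{real_inner, second_countable_topology} set" and f :: "'a \<Rightarrow> real"
  assumes I: "finite I" and on: "\<forall>e\<in>I. norm e = 1"
    and \<mu>: "\<And>k. borel_prob (\<mu> k)" and \<nu>: "borel_prob \<nu>"
    and lim: "\<And>\<xi>. \<xi> \<in> span I \<Longrightarrow> (\<lambda>k. char_fun (\<mu> k) \<xi>) \<longlonglongrightarrow> char_fun \<nu> \<xi>"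
    and f: "L-lipschitz_on UNIV f" and bdd: "bounded (range f)"
  shows "(\<lambda>k. LINT x|\<mu> k. f (ortho_proj I x)) \<longlonglongrightarrow> (LINT x|\<nu>. f (ortho_proj I x))"
proof (rule LIMSEQ_I)
  fix r :: real assume r: "0 < r"
  let ?Z = "Pi\<^sub>M I (\<lambda>_. lborel :: real measure)"
  let ?\<iota> = "\<lambda>z. \<Sum>e\<in>I. z e *\<^sub>R e"
  have L: "0 \<le> L" using f by (rule lipschitz_on_nonneg)
  have fm [measurable]: "f \<in> borel_measurable borel" by (rule lipschitz_on_UNIV_measurable[OF f])
  obtain B where B: "\<And>x. \<bar>f x\<bar> \<le> B" using bdd by (auto simp: bounded_iff)
  \<comment> \<open>Smoothing is used for \<open>\<mu> k\<close> and for \<open>\<nu>\<close>, each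
    time with error at most \<open>r / 4\<close>; with \<open>r / 4\<close> for the densities the
    total stays below \<open>r\<close>. The \<open>+ 1\<close> covers the case
    \<open>L * card I = 0\<close>.\<close>
  define \<epsilon> where "\<epsilon> = r / (4 * (L * real (card I) + 1))"
  have pos: "0 < L * real (card I) + 1" using L by (simp add: add_nonneg_pos)
  then have \<epsilon>: "0 < \<epsilon>" using r by (simp add: \<epsilon>_def)
  have "L * real (card I) * \<epsilon> \<le> (L * real (card I) + 1) * \<epsilon>" using \<epsilon> by simp
  also have "\<dots> = r / 4"
    using nonzero_mult_div_cancel_left[of "L * real (card I) + 1" "r / 4"] pos by (simp add: \<epsilon>_def)
  finally have err: "L * real (card I) * \<epsilon> \<le> r / 4" .
  define D where "D = (\<lambda>m z. LINT x|m. gauss_kernel I \<epsilon> x z)"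
  define F where "F = (\<lambda>m. LINT z|?Z. f (?\<iota> z) * D m z)"
  have near: "\<bar>F m - (LINT x|m. f (ortho_proj I x))\<bar> \<le> r / 4" if m: "borel_prob m" for m
  proof -
    interpret M: prob_space m using m by (simp add: borel_prob_def)
    have ip: "integrable m (\<lambda>x. f (ortho_proj I x))"
      using ortho_proj_measurable[of I] B
      by (intro borel_prob_integrable_bounded[OF m]) (auto simp: bounded_iff)
    note J = gauss_kernel_joint[OF I \<epsilon> m fm bdd]
    have "F m - (LINT x|m. f (ortho_proj I x)) =
        (LINT x|m. (LINT z|?Z. f (?\<iota> z) * gauss_kernel I \<epsilon> x z) - f (ortho_proj I x))"
      using J(3,4) ip by (simp add: F_def D_def)
    also have "\<bar>\<dots>\<bar> \<le> (LINT x|m. r / 4)"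
    proof (rule norm_integral_le[where 'b = real, unfolded real_norm_def])
      show "integrable m (\<lambda>x. (LINT z|?Z. f (?\<iota> z) * gauss_kernel I \<epsilon> x z) - f (ortho_proj I x))"
        using J(4) ip by simp
      show "\<bar>(LINT z|?Z. f (?\<iota> z) * gauss_kernel I \<epsilon> x z) - f (ortho_proj I x)\<bar> \<le> r / 4" for x
        using gauss_smoothing_error[OF I on \<epsilon> f bdd, of x] err by simp
    qed simp
    finally show ?thesis by (simp add: M.prob_space)
  qed
  have J: "integrable ?Z (D m)" "(LINT z|?Z. D m z) = 1" if "borel_prob m" for m
    using gauss_kernel_joint(1,2)[OF I \<epsilon> that fm bdd] by (simp_all add: D_def)
  have nn: "0 \<le> D m z" for m z
    unfolding D_def by (simp add: gauss_kernel_nonneg)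
  have one: "(\<integral>\<^sup>+z. norm (D m z) \<partial>?Z) = 1" if "borel_prob m" for m
    using nn_integral_eq_integral[OF J(1)[OF that]] J(2)[OF that] nn by simp
  have "(\<lambda>k. \<integral>\<^sup>+z. norm (D (\<mu> k) z - D \<nu> z) \<partial>?Z) \<longlonglongrightarrow> 0"
  proof (rule Scheffe_lemma2)
    show "D (\<mu> k) \<in> borel_measurable ?Z" for k using J(1)[OF \<mu>] by simp
    show "AE z in ?Z. (\<lambda>k. D (\<mu> k) z) \<longlonglongrightarrow> D \<nu> z"
      unfolding D_def by (intro AE_I2 tendsto_integral_gauss_kernel[OF I \<epsilon> \<mu> \<nu> lim])
    show "(\<integral>\<^sup>+z. norm (D (\<mu> k) z) \<partial>?Z) \<le> (\<integral>\<^sup>+z. norm (D \<nu> z) \<partial>?Z)" for k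
      by (simp only: one[OF \<mu>] one[OF \<nu>] order_refl)
  qed (rule J(1)[OF \<nu>])
  then have "(\<lambda>k. ennreal (LINT z|?Z. norm (D (\<mu> k) z - D \<nu> z))) \<longlonglongrightarrow> ennreal 0"
    by (subst (asm) nn_integral_eq_integral) (use J \<mu> \<nu> in auto)
  then have L1: "(\<lambda>k. LINT z|?Z. norm (D (\<mu> k) z - D \<nu> z)) \<longlonglongrightarrow> 0"
    by (subst (asm) tendsto_ennreal_iff) auto
  have "(\<lambda>k. F (\<mu> k) - F \<nu>) \<longlonglongrightarrow> 0"
  proof (rule tendsto_0_le[OF L1, of _ B], rule always_eventually, rule allI)
    fix k
    have m: "(\<lambda>z. f (?\<iota> z)) \<in> borel_measurable ?Z"
      using gauss_kernel_joint(5)[OF I \<epsilon> \<nu> fm bdd] .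
    have iD: "integrable ?Z (\<lambda>z. f (?\<iota> z) * h z)" if h: "integrable ?Z h" for h
    proof (rule Bochner_Integration.integrable_bound[OF integrable_mult_right[OF h, of B]])
      show "AE z in ?Z. norm (f (?\<iota> z) * h z) \<le> norm (B * h z)"
      proof (rule AE_I2)
        fix z
        have "B = \<bar>B\<bar>" using B[of 0] by simp
        then have "\<bar>f (?\<iota> z)\<bar> \<le> \<bar>B\<bar>" using B by metis
        then show "norm (f (?\<iota> z) * h z) \<le> norm (B * h z)"
          unfolding real_norm_def abs_mult by (rule mult_right_mono) simp
      qed
    qed (use m h in measurable)
    have "F (\<mu> k) - F \<nu> = (LINT z|?Z. f (?\<iota> z) * (D (\<mu> k) z - D \<nu> z))"
      using iD[OF J(1)[OF \<mu>[of k]]] iD[OF J(1)[OF \<nu>]] by (simp add: F_def right_diff_distrib)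
    also have "\<bar>\<dots>\<bar> \<le> (LINT z|?Z. B * norm (D (\<mu> k) z - D \<nu> z))"
      using J \<mu> \<nu> B
      by (intro norm_integral_le[where 'b = real, unfolded real_norm_def] iD integrable_mult_right integrable_norm
          Bochner_Integration.integrable_diff) (auto simp: abs_mult intro!: mult_right_mono)
    finally show "norm (F (\<mu> k) - F \<nu>) \<le> norm (LINT z|?Z. norm (D (\<mu> k) z - D \<nu> z)) * B"
      by (simp add: mult.commute)
  qed
  then obtain N where N: "\<And>k. k \<ge> N \<Longrightarrow> \<bar>F (\<mu> k) - F \<nu>\<bar> < r / 4"
    using LIMSEQ_D[of _ 0 "r / 4"] r by force
  show "\<exists>N. \<forall>k\<ge>N. norm ((LINT x|\<mu> k. f (ortho_proj I x)) - (LINT x|\<nu>. f (ortho_proj I x))) < r"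
  proof (intro exI[of _ N] allI impI)
    fix k assume "N \<le> k"
    from N[OF this] near[OF \<mu>[of k]] near[OF \<nu>] r
    show "norm ((LINT x|\<mu> k. f (ortho_proj I x)) - (LINT x|\<nu>. f (ortho_proj I x))) < r"
      unfolding real_norm_def by linarith
  qed
qed

section \<open>Infinitely divisible laws without Gaussian part\<close>

text \<open>
  The law \<open>(1 - m / n) \<delta>\<^sub>0 + (1 / n) N\<^sub>A \<circ> Y\<^sup>-\<^sup>1\<close>, where \<open>N\<^sub>A\<close> is \<open>N\<close> restricted to \<open>A\<close> and \<open>m = N A\<close>.
\<close>

definition jump_law :: "'w measure \<Rightarrow> ('w \<Rightarrow> 'a::real_normed_vector) \<Rightarrow> 'w set \<Rightarrow> real \<Rightarrow> 'a measure" where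
  "jump_law N Y A n = (if measure N A = 0 then return borel 0 else
     distr (measure_pmf (bernoulli_pmf (measure N A / n)) \<Otimes>\<^sub>M
            density N (\<lambda>w. ennreal (indicator A w / measure N A)))
       borel (\<lambda>(b, w). if b then Y w else 0))"

context
  fixes N :: "'w measure" and Y :: "'w \<Rightarrow> 'a::real_normed_vector" and A :: "'w set" and n :: real
  assumes Y [measurable]: "Y \<in> borel_measurable N" and A [measurable]: "A \<in> sets N"
    and fin: "emeasure N A < \<infinity>" and n: "0 < n" "measure N A \<le> n"
begin

lemma prob_space_jump_density:
  assumes "measure N A \<noteq> 0"
  shows "prob_space (density N (\<lambda>w. ennreal (indicator A w / measure N A)))"
proof (rule prob_spaceI)
  have "(\<integral>\<^sup>+w. ennreal (indicator A w / measure N A) \<partial>N) = (\<integral>\<^sup>+w. ennreal (1 / measure N A) * indicator A w \<partial>N)"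
    by (intro nn_integral_cong) (auto split: split_indicator)
  also have "\<dots> = ennreal (1 / measure N A) * emeasure N A"
    by (rule nn_integral_cmult_indicator[OF A])
  also have "\<dots> = 1"
    using fin assms by (subst emeasure_eq_ennreal_measure) (auto simp flip: ennreal_mult)
  finally show "emeasure (density N (\<lambda>w. ennreal (indicator A w / measure N A)))
      (space (density N (\<lambda>w. ennreal (indicator A w / measure N A)))) = 1"
    by (simp add: emeasure_density cong: nn_integral_cong)
qed

lemma borel_prob_jump_law: "borel_prob (jump_law N Y A n)"
proof (cases "measure N A = 0")
  case False
  interpret K: prob_space "density N (\<lambda>w. ennreal (indicator A w / measure N A))"
    by (rule prob_space_jump_density[OF False])
  interpret Q: pair_prob_space "measure_pmf (bernoulli_pmf (measure N A / n))"
    "density N (\<lambda>w. ennreal (indicator A w / measure N A))" ..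
  show ?thesis
    using False by (auto simp: borel_prob_def jump_law_def intro!: Q.prob_space_distr)
qed (simp add: jump_law_def borel_prob_return)

text \<open>The normalisation of the jump distribution cancels against the jump probability
  \<open>measure N A / n\<close>, so the formula in terms of increments \<open>f (Y w) - f 0\<close>
  also covers a null set \<open>A\<close>. It is applied to characters and to the exponential
  remainder.\<close>

lemma jump_law_integral:
  fixes f :: "'a \<Rightarrow> 'b::{banach, second_countable_topology}"
  assumes f [measurable]: "f \<in> borel_measurable borel"
    and int: "integrable N (\<lambda>w. indicator A w *\<^sub>R (f (Y w) - f 0))"
  shows "integrable (jump_law N Y A n) f"
    and "(LINT x|jump_law N Y A n. f x) = f 0 + (1 / n) *\<^sub>R (LINT w|N. indicator A w *\<^sub>R (f (Y w) - f 0))"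
proof -
  let ?m = "measure N A"
  have "integrable (jump_law N Y A n) f \<and>
     (LINT x|jump_law N Y A n. f x) = f 0 + (1 / n) *\<^sub>R (LINT w|N. indicator A w *\<^sub>R (f (Y w) - f 0))"
  proof (cases "?m = 0")
    case True
    then have "emeasure N A = 0"
      using fin by (simp add: emeasure_eq_ennreal_measure)
    then have "AE w in N. w \<notin> A"
      using A by (intro AE_not_in) (simp add: null_sets_def)
    then have "(LINT w|N. indicator A w *\<^sub>R (f (Y w) - f 0)) = 0"
      by (intro integral_eq_zero_AE) (auto elim!: eventually_mono)
    then show ?thesis
      using True by (simp add: jump_law_def integral_return integrable_iff_bounded nn_integral_return)
  next
    case False
    let ?K = "density N (\<lambda>w. ennreal (indicator A w / measure N A))"
    let ?P = "bernoulli_pmf (?m / n)"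
    let ?F = "\<lambda>(b, w). f (if b then Y w else 0)"
    interpret K: prob_space ?K by (rule prob_space_jump_density[OF False])
    interpret Q: pair_prob_space "measure_pmf ?P" ?K ..
    have c: "integrable N (\<lambda>w. indicator A w *\<^sub>R f 0)"
      using fin by (intro integrable_indicator A) auto
    have ind: "integrable N (\<lambda>w. indicator A w *\<^sub>R f (Y w))"
      using Bochner_Integration.integrable_add[OF int c] by (simp add: scaleR_diff_right)
    have iK: "integrable ?K (\<lambda>w. f (Y w))"
      using integrable_scaleR_right[OF ind, of "1 / ?m"]
      by (subst integrable_density) (auto simp: mult.commute)
    have "(LINT w|?K. f (Y w)) = (1 / ?m) *\<^sub>R (LINT w|N. indicator A w *\<^sub>R f (Y w))"
      by (subst integral_density) (auto simp flip: integral_scaleR_right)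
    also have "(LINT w|N. indicator A w *\<^sub>R f (Y w)) =
        (LINT w|N. indicator A w *\<^sub>R (f (Y w) - f 0)) + ?m *\<^sub>R f 0"
    proof -
      have "(LINT w|N. indicator A w *\<^sub>R f (Y w)) =
          (LINT w|N. indicator A w *\<^sub>R (f (Y w) - f 0) + indicator A w *\<^sub>R f 0)"
        by (simp add: scaleR_diff_right)
      also have "\<dots> = (LINT w|N. indicator A w *\<^sub>R (f (Y w) - f 0)) + (LINT w|N. indicator A w *\<^sub>R f 0)"
        by (rule Bochner_Integration.integral_add[OF int c])
      also have "(LINT w|N. indicator A w *\<^sub>R f 0) = ?m *\<^sub>R f 0"
        using fin by (subst integral_scaleR_left) auto
      finally show ?thesis .
    qed
    finally have EK: "(LINT w|?K. f (Y w)) =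
      (1 / ?m) *\<^sub>R ((LINT w|N. indicator A w *\<^sub>R (f (Y w) - f 0)) + ?m *\<^sub>R f 0)" .
    have meas: "?F \<in> borel_measurable (measure_pmf ?P \<Otimes>\<^sub>M ?K)"
      by measurable
    have iF: "integrable ?K (\<lambda>w. ?F (b, w))" for b
      using iK by (cases b) auto
    have int2: "integrable (measure_pmf ?P \<Otimes>\<^sub>M ?K) ?F"
    proof (rule Q.Fubini_integrable[OF meas])
      show "integrable (measure_pmf ?P) (\<lambda>b. LINT w|?K. norm (?F (b, w)))"
        by (rule integrable_measure_pmf_finite) (rule finite)
      show "AE b in measure_pmf ?P. integrable ?K (\<lambda>w. ?F (b, w))"
        by (intro AE_I2 iF)
    qed
    have sp: "measure ?K (space N) = 1" using K.prob_space by simp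
    have p: "0 \<le> ?m / n" "?m / n \<le> 1" using n by simp_all
    have "(LINT z|(measure_pmf ?P \<Otimes>\<^sub>M ?K). ?F z) = (LINT b|measure_pmf ?P. LINT w|?K. ?F (b, w))"
      using Q.integral_fst'[OF int2] by simp
    also have "\<dots> = (?m / n) *\<^sub>R (LINT w|?K. f (Y w)) + (1 - ?m / n) *\<^sub>R f 0"
      by (subst integral_measure_pmf[of UNIV]) (auto simp: UNIV_bool p sp)
    also have "\<dots> = f 0 + (1 / n) *\<^sub>R (LINT w|N. indicator A w *\<^sub>R (f (Y w) - f 0))"
      using False n by (simp add: EK scaleR_add_right scaleR_diff_left)
    finally have val: "(LINT z|(measure_pmf ?P \<Otimes>\<^sub>M ?K). ?F z) = \<dots>" .
    have "integrable (jump_law N Y A n) f"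
      using False int2 by (simp add: jump_law_def integrable_distr_eq case_prod_unfold)
    moreover have "(LINT x|jump_law N Y A n. f x) = (LINT z|(measure_pmf ?P \<Otimes>\<^sub>M ?K). ?F z)"
      using False by (simp add: jump_law_def integral_distr case_prod_unfold)
    ultimately show ?thesis using val by simp
  qed
  then show "integrable (jump_law N Y A n) f"
    and "(LINT x|jump_law N Y A n. f x) = f 0 + (1 / n) *\<^sub>R (LINT w|N. indicator A w *\<^sub>R (f (Y w) - f 0))"
    by blast+
qed

end

section \<open>Estimates for exponentials and for finite-dimensional projections\<close>

lemma norm_exp_minus_one_minus_le:
  fixes z :: complex
  assumes "norm z \<le> 1"
  shows "norm (exp z - 1 - z) \<le> 3 * (norm z)\<^sup>2"
proof -
  have "norm (exp z - 1 - z) \<le> exp (norm z) * (norm z)\<^sup>2"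
    using Taylor_exp_field[of z 1] by (simp add: power2_eq_square diff_diff_eq)
  also have "exp (norm z) \<le> 3"
    using assms exp_le order_trans[of "exp (norm z)" "exp 1" 3] by simp
  finally show ?thesis by (simp add: mult_right_mono)
qed

lemma norm_iexp_minus_one_minus_le:
  "norm (iexp a - 1 - \<i> * complex_of_real a) \<le> a\<^sup>2 / 2"
  using iexp_approx1[of a 1] by (simp add: power2_eq_square diff_diff_eq)

lemma inner_ortho_proj:
  assumes "finite I" "orthonormal I" "e \<in> I"
  shows "ortho_proj I x \<bullet> e = x \<bullet> e"
proof -
  have "e' \<bullet> e = (if e' = e then 1 else 0)" if "e' \<in> I" for e'
    using assms that
    by (auto simp: orthonormal_def pairwise_def orthogonal_def norm_eq_1)
  then show ?thesis
    using assms by (simp add: ortho_proj_def inner_sum_left if_distrib[of "times _"] sum.delta cong: sum.cong if_cong)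
qed

lemma norm_ortho_proj_le:
  assumes "finite I" "orthonormal I"
  shows "norm (ortho_proj I x) \<le> norm x"
proof -
  have "(norm (ortho_proj I x))\<^sup>2 = (\<Sum>e\<in>I. (x \<bullet> e) * (ortho_proj I x \<bullet> e))"
    unfolding power2_norm_eq_inner
    by (subst (2) ortho_proj_def) (simp add: inner_sum_right)
  also have "\<dots> = x \<bullet> ortho_proj I x"
    using inner_ortho_proj[OF assms] by (simp add: ortho_proj_def inner_sum_right cong: sum.cong)
  also have "\<dots> \<le> norm x * norm (ortho_proj I x)" by (rule norm_cauchy_schwarz)
  finally show ?thesis
    using mult_right_le_imp_le[of "norm (ortho_proj I x)" "norm (ortho_proj I x)" "norm x"]
    by (cases "ortho_proj I x = 0") (simp_all add: power2_eq_square)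
qed

lemma ortho_proj_diff: "ortho_proj I (x - y) = ortho_proj I x - ortho_proj I y"
  by (simp add: ortho_proj_def inner_diff_left scaleR_left_diff_distrib sum_subtractf)

lemma lipschitz_comp_ortho_proj:
  assumes "finite I" "orthonormal I" "1-lipschitz_on UNIV g"
  shows "1-lipschitz_on UNIV (\<lambda>x. g (ortho_proj I x))"
proof (rule lipschitz_onI)
  fix x y
  have "dist (g (ortho_proj I x)) (g (ortho_proj I y)) \<le> dist (ortho_proj I x) (ortho_proj I y)"
    using lipschitz_onD[OF assms(3), of "ortho_proj I x" "ortho_proj I y"] by simp
  also have "\<dots> \<le> dist x y"
    using norm_ortho_proj_le[OF assms(1,2), of "x - y"] by (simp add: dist_norm ortho_proj_diff)
  finally show "dist (g (ortho_proj I x)) (g (ortho_proj I y)) \<le> 1 * dist x y" by simp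
qed simp

text \<open>The convergence results take Lipschitz test functions; boundedness of \<open>g\<close>
  confines the exponential to a half-line on which it is Lipschitz.\<close>

lemma lipschitz_exp_bounded:
  fixes g :: "'a::metric_space \<Rightarrow> real"
  assumes g: "1-lipschitz_on UNIV g" and bdd: "bounded (range g)"
  shows "\<exists>L. L-lipschitz_on UNIV (\<lambda>x. exp (l * g x))"
proof -
  obtain B where B: "\<And>x. \<bar>g x\<bar> \<le> B" using bdd by (auto simp: bounded_iff)
  have le: "l * g x \<le> \<bar>l\<bar> * B" for x
  proof -
    have "l * g x \<le> \<bar>l\<bar> * \<bar>g x\<bar>" by (metis abs_ge_self abs_mult)
    also have "\<dots> \<le> \<bar>l\<bar> * B" using B[of x] by (intro mult_left_mono) auto
    finally show ?thesis .
  qed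
  have exp_lip: "\<bar>exp a - exp b\<bar> \<le> exp K * \<bar>a - b\<bar>" if "a \<le> K" "b \<le> K" for a b K :: real
  proof -
    have *: "exp a - exp b \<le> exp K * (a - b)" if "b \<le> a" "a \<le> K" for a b :: real
    proof -
      have "exp a - exp b = exp a * (1 - exp (b - a))"
        by (simp add: right_diff_distrib flip: exp_add)
      also have "\<dots> \<le> exp a * (a - b)"
      proof (rule mult_left_mono)
        show "1 - exp (b - a) \<le> a - b"
          using exp_ge_add_one_self[of "b - a"] by linarith
      qed simp
      also have "\<dots> \<le> exp K * (a - b)" using that by (intro mult_right_mono) auto
      finally show ?thesis .
    qed
    show ?thesis using *[of a b] *[of b a] that by (cases "b \<le> a") auto
  qed
  have "(exp (\<bar>l\<bar> * B) * \<bar>l\<bar>)-lipschitz_on UNIV (\<lambda>x. exp (l * g x))"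
  proof (rule lipschitz_onI)
    fix x y
    have "dist (exp (l * g x)) (exp (l * g y)) \<le> exp (\<bar>l\<bar> * B) * \<bar>l * g x - l * g y\<bar>"
      unfolding dist_real_def by (rule exp_lip) (use le in auto)
    also have "\<bar>l * g x - l * g y\<bar> = \<bar>l\<bar> * dist (g x) (g y)"
      by (simp add: dist_real_def abs_mult flip: right_diff_distrib)
    also have "exp (\<bar>l\<bar> * B) * (\<bar>l\<bar> * dist (g x) (g y)) \<le> exp (\<bar>l\<bar> * B) * (\<bar>l\<bar> * dist x y)"
      using lipschitz_onD[OF g, of x y] by (intro mult_left_mono) auto
    finally show "dist (exp (l * g x)) (exp (l * g y)) \<le> exp (\<bar>l\<bar> * B) * \<bar>l\<bar> * dist x y" by (simp add: mult_ac)
  qed simp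
  then show ?thesis by blast
qed

text \<open>The compound Poisson law itself is never built: a law whose characteristic function is
  within \<open>\<delta>\<close> of the right one, uniformly in \<open>\<xi>\<close>, is enough for
  a limit. Each of the \<open>n\<close> factors has an \<open>n\<close>-th of the Laplace bound, so
  the power has the bound of \<open>N\<close>, independently of \<open>A\<close>, \<open>c\<close>
  and \<open>\<delta>\<close>.\<close>

lemma exists_compound_poisson_approx:
  fixes N :: "'w measure" and Y :: "'w \<Rightarrow> 'a::{real_inner, second_countable_topology}"
  assumes Y [measurable]: "Y \<in> borel_measurable N" and A [measurable]: "A \<in> sets N"
    and fin: "emeasure N A < \<infinity>" and l: "0 \<le> l" and \<delta>: "0 < \<delta>"
    and int: "integrable N (\<lambda>w. exp (l * norm (Y w)) - 1 - l * norm (Y w))"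
  shows "\<exists>\<rho>. borel_prob \<rho> \<and>
    laplace_bounded l (LINT w|N. exp (l * norm (Y w)) - 1 - l * norm (Y w)) \<rho> \<and>
    (\<forall>\<xi>. norm (char_fun \<rho> \<xi> - exp ((CLINT w|N. indicator A w *\<^sub>R (iexp (Y w \<bullet> \<xi>) - 1)) + \<i> * complex_of_real (c \<bullet> \<xi>))) \<le> \<delta>)"
proof -
  let ?m = "measure N A"
  let ?e = "\<lambda>u::'a. exp (l * norm u) - 1 - l * norm u"
  let ?z = "\<lambda>\<xi>. CLINT w|N. indicator A w *\<^sub>R (iexp (Y w \<bullet> \<xi>) - 1)"
  \<comment> \<open>\<open>2 * ?m \<le> n\<close> puts \<open>u\<close> into the unit disc, where
    the second-order estimate of the exponential holds;
    \<open>12 * ?m\<^sup>2 / \<delta> \<le> n\<close> makes the final error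
    \<open>n * 3 * (2 * ?m / n)\<^sup>2\<close> at most \<open>\<delta>\<close>.\<close>
  define n :: nat where "n = nat \<lceil>12 * ?m\<^sup>2 / \<delta> + 2 * ?m + 1\<rceil>"
  have n0: "12 * ?m\<^sup>2 / \<delta> + 2 * ?m + 1 \<le> real n"
    unfolding n_def by linarith
  have "0 \<le> 12 * ?m\<^sup>2 / \<delta>" using \<delta> by simp
  with n0 have n: "0 < real n" "?m \<le> real n" "2 * ?m \<le> real n" "12 * ?m\<^sup>2 / \<delta> \<le> real n"
    using measure_nonneg[of N A] by linarith+
  define \<rho>1 where "\<rho>1 = jump_law N Y A (real n)"
  have \<rho>1: "borel_prob \<rho>1"
    unfolding \<rho>1_def by (rule borel_prob_jump_law[OF Y A fin n(1,2)])
  note J = jump_law_integral[OF Y A fin n(1,2), folded \<rho>1_def]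
  have e_nn: "0 \<le> ?e u" for u
    using exp_ge_add_one_self[of "l * norm u"] by linarith
  have em: "?e \<in> borel_measurable borel" by measurable
  have ie: "integrable N (\<lambda>w. indicator A w *\<^sub>R (?e (Y w) - ?e 0))"
    using integrable_mult_indicator[OF A int] by simp
  have Elam: "(LINT u|\<rho>1. ?e u) \<le> (1 / real n) * (LINT w|N. ?e (Y w))"
  proof -
    have "(LINT w|N. indicator A w *\<^sub>R (?e (Y w) - ?e 0)) \<le> (LINT w|N. ?e (Y w))"
      by (rule integral_mono[OF ie int]) (use e_nn in \<open>auto split: split_indicator\<close>)
    then show ?thesis
      using n(1) by (subst J(2)[OF em ie]) (simp add: divide_right_mono)
  qed
  have lb1: "laplace_bounded l (LINT u|\<rho>1. ?e u) \<rho>1"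
    by (rule laplace_bounded_exp_moment[OF \<rho>1 l J(1)[OF em ie]])
  let ?\<rho> = "conv_power \<rho>1 c n"
  have "laplace_bounded l (real n * (LINT u|\<rho>1. ?e u)) ?\<rho>"
    by (rule laplace_bounded_conv_power[OF \<rho>1 lb1])
  moreover have "real n * (LINT u|\<rho>1. ?e u) \<le> (LINT w|N. ?e (Y w))"
    using mult_left_mono[OF Elam, of "real n"] n(1) by simp
  ultimately have lb: "laplace_bounded l (LINT w|N. ?e (Y w)) ?\<rho>"
    by (rule laplace_bounded_mono)
  have "norm (char_fun ?\<rho> \<xi> - exp (?z \<xi> + \<i> * complex_of_real (c \<bullet> \<xi>))) \<le> \<delta>" for \<xi>
  proof -
    let ?f = "\<lambda>x::'a. iexp (x \<bullet> \<xi>)"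
    have bd: "norm (iexp a - 1) \<le> 2" for a
      using norm_triangle_ineq4[of "iexp a" 1] by simp
    have ind: "integrable N (\<lambda>w. 2 * indicator A w :: real)"
      using fin by (intro integrable_mult_right integrable_real_indicator) auto
    have iz: "integrable N (\<lambda>w. indicator A w *\<^sub>R (iexp (Y w \<bullet> \<xi>) - 1))"
      by (rule Bochner_Integration.integrable_bound[OF ind])
         (use bd in \<open>auto split: split_indicator\<close>)
    have ch: "char_fun \<rho>1 \<xi> = 1 + ?z \<xi> / of_nat n"
      unfolding char_fun_def using J(2)[of ?f] iz by (simp add: scaleR_conv_of_real)
    have zn: "norm (?z \<xi>) \<le> 2 * ?m"
    proof -
      have "norm (?z \<xi>) \<le> (LINT w|N. 2 * indicator A w)"
        by (rule norm_integral_le[OF iz ind]) (use bd in \<open>auto split: split_indicator\<close>)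
      then show ?thesis using fin by simp
    qed
    \<comment> \<open>A nonpositive real part gives \<open>exp u\<close> modulus at most 1;
      \<open>1 + u\<close> has it as a value of a characteristic function. Then the difference of
      \<open>n\<close>-th powers is at most \<open>n\<close> times the difference of the
      bases.\<close>
    have "Re (?z \<xi>) = (LINT w|N. indicator A w * (cos (Y w \<bullet> \<xi>) - 1))"
      by (subst integral_Re[OF iz, symmetric]) (simp add: Re_exp)
    also have "\<dots> \<le> (LINT w|N. 0)"
      by (rule integral_mono') (auto split: split_indicator)
    finally have re: "Re (?z \<xi>) \<le> 0" by simp
    define u where "u = ?z \<xi> / of_nat n"
    have nu: "norm u \<le> 2 * ?m / real n"
      using zn n(1) by (simp add: u_def norm_divide divide_right_mono)
    then have nu1: "norm u \<le> 1"
      using n(1,3) by (simp add: divide_le_eq_1 order_trans[OF nu])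
    have "norm ((1 + u) ^ n - exp u ^ n) \<le> real n * norm (1 + u - exp u)"
    proof (rule norm_power_diff)
      show "norm (1 + u) \<le> 1" using norm_char_fun_le_1[OF \<rho>1, of \<xi>] by (simp add: ch u_def)
      show "norm (exp u) \<le> 1" using re n(1) by (simp add: u_def divide_nonpos_pos)
    qed
    also have "norm (1 + u - exp u) = norm (exp u - 1 - u)"
      by (metis diff_diff_eq norm_minus_commute)
    also have "real n * \<dots> \<le> real n * (3 * (norm u)\<^sup>2)"
      by (intro mult_left_mono norm_exp_minus_one_minus_le nu1) simp
    also have "\<dots> \<le> real n * (3 * (2 * ?m / real n)\<^sup>2)"
      by (intro mult_left_mono power_mono nu) auto
    also have "\<dots> = 12 * ?m\<^sup>2 / real n"
      using n(1) by (simp add: power2_eq_square field_simps)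
    also have "\<dots> \<le> \<delta>"
      using n(1,4) \<delta> by (simp add: field_simps)
    finally have main: "norm ((1 + u) ^ n - exp u ^ n) \<le> \<delta>" .
    have "exp u ^ n = exp (?z \<xi>)"
      using n(1) by (simp add: u_def flip: exp_of_nat_mult)
    then have "char_fun ?\<rho> \<xi> - exp (?z \<xi> + \<i> * complex_of_real (c \<bullet> \<xi>)) =
        ((1 + u) ^ n - exp u ^ n) * iexp (c \<bullet> \<xi>)"
      by (simp add: char_fun_conv_power[OF \<rho>1] ch u_def exp_add left_diff_distrib)
    then show ?thesis using main by (simp add: norm_mult)
  qed
  then show ?thesis
    using lb borel_prob_conv_power[OF \<rho>1] by blast
qed

text \<open>On each \<open>A k\<close> the jumps have finite intensity and the compensator can be
  moved into the shift \<open>c k\<close>. All approximants obey one and the same bound, that of the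
  full \<open>N\<close>, so the limit inherits it.\<close>

proposition laplace_bound_infinitely_divisible_ortho_proj:
  fixes N :: "'w measure" and Y :: "'w \<Rightarrow> 'a::{real_inner, banach, second_countable_topology}"
  assumes Y [measurable]: "Y \<in> borel_measurable N"
    and A [measurable]: "\<And>k. A k \<in> sets N" and fin: "\<And>k::nat. emeasure N (A k) < \<infinity>"
    and inc: "incseq A" and cover: "(\<Union>k. A k) = space N"
    and int2: "integrable N (\<lambda>w. (norm (Y w))\<^sup>2)"
    and l: "0 \<le> l" and int: "integrable N (\<lambda>w. exp (l * norm (Y w)) - 1 - l * norm (Y w))"
    and I: "finite I" "orthonormal I" and m: "borel_prob m" and lin: "linear \<beta>"
    and char: "\<And>\<xi>. \<xi> \<in> span I \<Longrightarrow> char_fun m \<xi> = exp (\<i> * complex_of_real (\<beta> \<xi>) +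
        (CLINT w|N. iexp (Y w \<bullet> \<xi>) - 1 - \<i> * complex_of_real (Y w \<bullet> \<xi>)))"
    and g: "1-lipschitz_on UNIV g" and bdd: "bounded (range g)"
  shows "(LINT x|m. exp (l * g (ortho_proj I x))) \<le>
    exp (l * (LINT x|m. g (ortho_proj I x)) + (LINT w|N. exp (l * norm (Y w)) - 1 - l * norm (Y w)))"
proof -
  let ?C = "LINT w|N. exp (l * norm (Y w)) - 1 - l * norm (Y w)"
  have intA: "integrable N (\<lambda>w. indicator (A k) w *\<^sub>R Y w)" for k
  proof (rule Bochner_Integration.integrable_bound)
    show "integrable N (\<lambda>w. indicator (A k) w + (norm (Y w))\<^sup>2)"
      using fin[of k] by (intro Bochner_Integration.integrable_add int2 integrable_real_indicator A) auto
    have "r \<le> 1 + r\<^sup>2" for r :: real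
      using zero_le_power2[of "r - 1/2"] by (simp add: power2_diff field_simps)
    then show "AE w in N. norm (indicator (A k) w *\<^sub>R Y w) \<le> norm (indicator (A k) w + (norm (Y w))\<^sup>2)"
      by (auto split: split_indicator)
  qed measurable
  have intA\<xi>: "integrable N (\<lambda>w. indicator (A k) w * (Y w \<bullet> \<xi>))" for k \<xi>
    using integrable_inner_left[OF intA[of k], of \<xi>] by simp
  \<comment> \<open>The drift left after taking out the compensator of the jumps in
    \<open>A k\<close>. It need not converge in \<open>k\<close>; only its sum with the
    uncompensated jump integral does.\<close>
  define \<beta>k where "\<beta>k = (\<lambda>k \<xi>. \<beta> \<xi> - (LINT w|N. indicator (A k) w * (Y w \<bullet> \<xi>)))"
  have lin\<beta>k: "linear (\<beta>k k)" for k
    using intA\<xi> lin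
    by (intro linearI) (simp_all add: \<beta>k_def linear_add linear_scale inner_add_right algebra_simps)
  \<comment> \<open>On the span of a finite orthonormal set a linear functional is the inner product
    with the vector of its values on that set.\<close>
  define c where "c = (\<lambda>k. \<Sum>e\<in>I. \<beta>k k e *\<^sub>R e)"
  have c: "c k \<bullet> \<xi> = \<beta>k k \<xi>" if "\<xi> \<in> span I" for k \<xi>
  proof (rule linear_eq_on_span[OF _ lin\<beta>k _ that])
    show "linear ((\<bullet>) (c k))" by (simp add: bounded_linear.linear bounded_linear_inner_right)
    fix e assume e: "e \<in> I"
    have "e' \<bullet> e = (if e' = e then 1 else 0)" if "e' \<in> I" for e'
      using I e that by (auto simp: orthonormal_def pairwise_def orthogonal_def norm_eq_1)
    then show "c k \<bullet> e = \<beta>k k e"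
      using I e by (simp add: c_def inner_sum_left if_distrib[of "times _"] sum.delta cong: sum.cong if_cong)
  qed
  have "\<forall>k. \<exists>\<rho>. borel_prob \<rho> \<and> laplace_bounded l ?C \<rho> \<and>
    (\<forall>\<xi>. norm (char_fun \<rho> \<xi> - exp ((CLINT w|N. indicator (A k) w *\<^sub>R (iexp (Y w \<bullet> \<xi>) - 1)) + \<i> * complex_of_real (c k \<bullet> \<xi>))) \<le> 1 / real (Suc k))"
    by (rule allI, rule exists_compound_poisson_approx[OF Y A fin l _ int]) simp
  from choice[OF this] obtain \<rho> where \<rho>: "\<And>k. borel_prob (\<rho> k)" and lb: "\<And>k. laplace_bounded l ?C (\<rho> k)"
    and app: "\<And>k \<xi>. norm (char_fun (\<rho> k) \<xi> - exp ((CLINT w|N. indicator (A k) w *\<^sub>R (iexp (Y w \<bullet> \<xi>) - 1)) + \<i> * complex_of_real (c k \<bullet> \<xi>))) \<le> 1 / real (Suc k)"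
    by blast
  have lim: "(\<lambda>k. char_fun (\<rho> k) \<xi>) \<longlonglongrightarrow> char_fun m \<xi>" if \<xi>: "\<xi> \<in> span I" for \<xi>
  proof -
    let ?h = "\<lambda>w. iexp (Y w \<bullet> \<xi>) - 1 - \<i> * complex_of_real (Y w \<bullet> \<xi>)"
    let ?w = "\<lambda>w. (norm (Y w))\<^sup>2 * ((norm \<xi>)\<^sup>2 / 2)"
    have iw: "integrable N ?w" using int2 by (rule integrable_mult_left)
    have hb: "norm (?h w) \<le> ?w w" for w
    proof -
      have "norm (?h w) \<le> (Y w \<bullet> \<xi>)\<^sup>2 / 2" by (rule norm_iexp_minus_one_minus_le)
      also have "(Y w \<bullet> \<xi>)\<^sup>2 \<le> (norm (Y w) * norm \<xi>)\<^sup>2"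
        using Cauchy_Schwarz_ineq2[of "Y w" \<xi>] by (metis abs_ge_zero power2_abs power_mono)
      finally show ?thesis by (simp add: power_mult_distrib)
    qed
    have ih: "integrable N ?h"
      by (rule Bochner_Integration.integrable_bound[OF iw]) (use hb in auto)
    \<comment> \<open>The limit in \<open>k\<close> is taken in compensated form: \<open>?h\<close>
      is dominated by a multiple of \<open>(norm (Y w))\<^sup>2\<close>, integrable over all of
      \<open>N\<close>, while \<open>iexp (Y w \<bullet> \<xi>) - 1\<close> need not be
      integrable.\<close>
    have "(\<lambda>k. CLINT w|N. indicator (A k) w *\<^sub>R ?h w) \<longlonglongrightarrow> (CLINT w|N. ?h w)"
    proof (rule integral_dominated_convergence[OF _ _ iw])
      show "AE w in N. (\<lambda>k. indicator (A k) w *\<^sub>R ?h w) \<longlonglongrightarrow> ?h w"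
      proof (rule AE_I2)
        fix w assume "w \<in> space N"
        then obtain k0 where "w \<in> A k0" using cover by blast
        then have "\<And>k. k \<ge> k0 \<Longrightarrow> w \<in> A k" using inc by (auto simp: incseq_def)
        then have "eventually (\<lambda>k. indicator (A k) w *\<^sub>R ?h w = ?h w) sequentially"
          by (auto simp: eventually_sequentially intro!: exI[of _ k0])
        then show "(\<lambda>k. indicator (A k) w *\<^sub>R ?h w) \<longlonglongrightarrow> ?h w"
          by (rule tendsto_eventually)
      qed
      show "AE w in N. norm (indicator (A k) w *\<^sub>R ?h w) \<le> ?w w" for k
        using hb by (auto split: split_indicator)
    qed measurable
    then have "(\<lambda>k. exp (\<i> * complex_of_real (\<beta> \<xi>) + (CLINT w|N. indicator (A k) w *\<^sub>R ?h w))) \<longlonglongrightarrow> char_fun m \<xi>"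
      unfolding char[OF \<xi>] by (intro tendsto_intros)
    moreover have "\<i> * complex_of_real (\<beta> \<xi>) + (CLINT w|N. indicator (A k) w *\<^sub>R ?h w) =
        (CLINT w|N. indicator (A k) w *\<^sub>R (iexp (Y w \<bullet> \<xi>) - 1)) + \<i> * complex_of_real (c k \<bullet> \<xi>)" for k
    proof -
      have i2: "integrable N (\<lambda>w. \<i> * complex_of_real (indicator (A k) w * (Y w \<bullet> \<xi>)))"
        using intA\<xi> by (intro integrable_mult_right integrable_of_real)
      have "(CLINT w|N. indicator (A k) w *\<^sub>R (iexp (Y w \<bullet> \<xi>) - 1)) =
          (CLINT w|N. indicator (A k) w *\<^sub>R ?h w + \<i> * complex_of_real (indicator (A k) w * (Y w \<bullet> \<xi>)))"
        by (intro Bochner_Integration.integral_cong) (auto split: split_indicator)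
      also have "\<dots> = (CLINT w|N. indicator (A k) w *\<^sub>R ?h w) + (CLINT w|N. \<i> * complex_of_real (indicator (A k) w * (Y w \<bullet> \<xi>)))"
        by (rule Bochner_Integration.integral_add[OF integrable_mult_indicator[OF A ih] i2])
      also have "(CLINT w|N. \<i> * complex_of_real (indicator (A k) w * (Y w \<bullet> \<xi>))) =
          \<i> * complex_of_real (LINT w|N. indicator (A k) w * (Y w \<bullet> \<xi>))"
        by (simp only: integral_mult_right_zero integral_complex_of_real)
      finally show ?thesis
        unfolding c[OF \<xi>] \<beta>k_def by (simp add: algebra_simps)
    qed
    ultimately have main: "(\<lambda>k. exp ((CLINT w|N. indicator (A k) w *\<^sub>R (iexp (Y w \<bullet> \<xi>) - 1)) + \<i> * complex_of_real (c k \<bullet> \<xi>))) \<longlonglongrightarrow> char_fun m \<xi>"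
      by simp
    have "(\<lambda>k. char_fun (\<rho> k) \<xi> - exp ((CLINT w|N. indicator (A k) w *\<^sub>R (iexp (Y w \<bullet> \<xi>) - 1)) + \<i> * complex_of_real (c k \<bullet> \<xi>))) \<longlonglongrightarrow> 0"
      by (rule Lim_null_comparison[OF _ LIMSEQ_Suc[OF lim_1_over_n]])
         (intro always_eventually allI app)
    from tendsto_add[OF this main] show ?thesis by simp
  qed
  have on: "\<forall>e\<in>I. norm e = 1" using I by (simp add: orthonormal_def)
  obtain L where L: "L-lipschitz_on UNIV (\<lambda>x. exp (l * g x))"
    using lipschitz_exp_bounded[OF g bdd] by blast
  have L1: "(\<lambda>k. LINT x|\<rho> k. exp (l * g (ortho_proj I x))) \<longlonglongrightarrow> (LINT x|m. exp (l * g (ortho_proj I x)))"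
    by (rule levy_continuity_ortho_proj[OF I(1) on \<rho> m lim L bounded_exp_mult[OF bdd]])
  have L2: "(\<lambda>k. LINT x|\<rho> k. g (ortho_proj I x)) \<longlonglongrightarrow> (LINT x|m. g (ortho_proj I x))"
    by (rule levy_continuity_ortho_proj[OF I(1) on \<rho> m lim g bdd])
  show ?thesis
  proof (rule LIMSEQ_le[OF L1])
    show "(\<lambda>k. exp (l * (LINT x|\<rho> k. g (ortho_proj I x)) + ?C)) \<longlonglongrightarrow> exp (l * (LINT x|m. g (ortho_proj I x)) + ?C)"
      by (intro tendsto_intros L2)
    have "bounded (range (\<lambda>x. g (ortho_proj I x)))"
      by (rule bounded_subset[OF bdd]) auto
    then have "(LINT x|\<rho> k. exp (l * g (ortho_proj I x))) \<le> exp (l * (LINT x|\<rho> k. g (ortho_proj I x)) + ?C)" for k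
      by (rule lb[unfolded laplace_bounded_def, rule_format, OF lipschitz_comp_ortho_proj[OF I g]])
    then show "\<exists>N. \<forall>k\<ge>N. (LINT x|\<rho> k. exp (l * g (ortho_proj I x))) \<le> exp (l * (LINT x|\<rho> k. g (ortho_proj I x)) + ?C)"
      by blast
  qed
qed

section \<open>Operators and semigroups on Hilbert spaces\<close>

text \<open>The representing vector is the minimiser of
  \<open>q x = (norm x)\<^sup>2 - 2 * \<phi> x\<close>. By the parallelogram law a minimising
  sequence is Cauchy, and the vanishing first variation at the minimiser is the claim.\<close>

proposition riesz_representation:
  fixes \<phi> :: "'a::{real_inner, banach} \<Rightarrow> real"
  assumes "bounded_linear \<phi>"
  shows "\<exists>z. \<forall>x. \<phi> x = x \<bullet> z"
proof -
  interpret \<phi>: bounded_linear \<phi> by fact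
  obtain K where K: "\<And>x. \<bar>\<phi> x\<bar> \<le> norm x * K" using \<phi>.bounded by auto
  define q where "q = (\<lambda>x. (norm x)\<^sup>2 - 2 * \<phi> x)"
  have lower: "- K\<^sup>2 \<le> q x" for x
  proof -
    have "2 * \<phi> x \<le> 2 * (norm x * K)" using K[of x] by simp
    also have "\<dots> \<le> (norm x)\<^sup>2 + K\<^sup>2"
      using sum_squares_bound[of "norm x" K] by simp
    finally show ?thesis by (simp add: q_def)
  qed
  define d where "d = (INF x. q x)"
  have bdd: "bdd_below (range q)" using lower by (auto simp: bdd_below_def)
  have d_le: "d \<le> q x" for x unfolding d_def by (rule cINF_lower[OF bdd]) simp
  have "\<exists>x. q x < d + 1 / real (Suc n)" for n
    using cINF_less_iff[OF _ bdd, of "d + 1 / real (Suc n)"] by (auto simp: d_def[symmetric])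
  then obtain X where X: "\<And>n. q (X n) < d + 1 / real (Suc n)" by metis
  have par: "(norm (x - y))\<^sup>2 \<le> 2 * (q x - d) + 2 * (q y - d)" for x y
  proof -
    define w where "w = (1/2) *\<^sub>R (x + y)"
    have "2 * q x + 2 * q y = (norm (x - y))\<^sup>2 + 4 * q w"
      by (simp add: q_def w_def \<phi>.scaleR \<phi>.add power2_norm_eq_inner inner_diff_left inner_diff_right
          inner_add_left inner_add_right inner_commute algebra_simps)
    moreover have "4 * d \<le> 4 * q w" using d_le[of w] by simp
    ultimately have "(norm (x - y))\<^sup>2 \<le> 2 * q x + 2 * q y - 4 * d" by argo
    then show ?thesis by (simp add: algebra_simps)
  qed
  have "Cauchy X"
  proof (rule CauchyI)
    fix e :: real assume "0 < e"
    then obtain n0 where n0: "4 / e\<^sup>2 < real n0" using reals_Archimedean2 by blast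
    show "\<exists>n0. \<forall>m\<ge>n0. \<forall>n\<ge>n0. norm (X m - X n) < e"
    proof (intro exI[of _ n0] allI impI)
      fix m n assume mn: "n0 \<le> m" "n0 \<le> n"
      have "0 < 4 / e\<^sup>2" using \<open>0 < e\<close> by simp
      then have pos: "0 < real n0" using n0 by linarith
      have "q (X k) - d \<le> 1 / real n0" if "n0 \<le> k" for k
      proof -
        have "1 / real (Suc k) \<le> 1 / real n0" using that pos by (simp add: frac_le)
        then show ?thesis using X[of k] by linarith
      qed
      from par[of "X m" "X n"] this[OF mn(1)] this[OF mn(2)]
      have "(norm (X m - X n))\<^sup>2 \<le> 4 / real n0" by (simp add: field_simps)
      also have "\<dots> < e\<^sup>2" using n0 pos \<open>0 < e\<close> by (simp add: field_simps)
      finally show "norm (X m - X n) < e" using \<open>0 < e\<close> by (simp add: power2_less_imp_less)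
    qed
  qed
  then obtain z where z: "X \<longlonglongrightarrow> z" using Cauchy_convergent convergent_def by blast
  have "(\<lambda>n. q (X n)) \<longlonglongrightarrow> q z"
    unfolding q_def by (intro tendsto_intros z \<phi>.tendsto)
  moreover have "(\<lambda>n. d + 1 / real (Suc n)) \<longlonglongrightarrow> d + 0"
    by (intro tendsto_intros LIMSEQ_Suc[OF lim_1_over_n])
  ultimately have "q z \<le> d + 0"
    by (rule LIMSEQ_le) (use X less_imp_le in blast)
  then have min: "q z \<le> q x" for x using d_le[of x] by simp
  have "\<phi> v = v \<bullet> z" for v
  proof -
    define a where "a = v \<bullet> z - \<phi> v"
    \<comment> \<open>The increment of \<open>q\<close> along \<open>- c *\<^sub>R v\<close> is
      quadratic in \<open>c\<close> and strictly negative at \<open>c = s * a\<close> unless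
      \<open>a = 0\<close>. The \<open>+ 1\<close> covers \<open>v = 0\<close>.\<close>
    define s where "s = 1 / ((norm v)\<^sup>2 + 1)"
    have s: "0 < s" "s * (norm v)\<^sup>2 < 1"
      by (auto simp: s_def divide_less_eq add_nonneg_pos)
    have "q (z - c *\<^sub>R v) - q z = c\<^sup>2 * (norm v)\<^sup>2 - 2 * c * a" for c
      unfolding q_def a_def power2_norm_eq_inner
      by (simp add: \<phi>.diff \<phi>.scaleR inner_diff_left inner_diff_right
          inner_commute[of v z] power2_eq_square algebra_simps)
    from this[of "s * a"] have "q (z - (s * a) *\<^sub>R v) - q z = s * a\<^sup>2 * (s * (norm v)\<^sup>2 - 2)"
      by (simp add: power2_eq_square algebra_simps)
    with min[of "z - (s * a) *\<^sub>R v"] have "0 \<le> s * a\<^sup>2 * (s * (norm v)\<^sup>2 - 2)" by simp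
    moreover have "s * (norm v)\<^sup>2 - 2 < 0" using s by simp
    ultimately have "s * a\<^sup>2 \<le> 0" by (simp add: zero_le_mult_iff)
    then show ?thesis using s by (simp add: a_def mult_le_0_iff)
  qed
  then show ?thesis by blast
qed

text \<open>\<open>adjoint\<close> is a choice operator: it has its characteristic property once
  some adjoint is known to exist, and Riesz representation supplies one.\<close>

lemma inner_adjoint_blinfun:
  fixes S :: "'a::{real_inner, banach} \<Rightarrow>\<^sub>L 'a"
  shows "x \<bullet> adjoint (blinfun_apply S) y = S x \<bullet> y"
proof -
  have "\<exists>z. \<forall>x. S x \<bullet> y = x \<bullet> z" for y
    by (rule riesz_representation)
       (intro bounded_linear_compose[OF bounded_linear_inner_left] blinfun.bounded_linear_right)
  then obtain g where g: "\<And>x y. S x \<bullet> y = x \<bullet> g y" by metis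
  then have "adjoint (blinfun_apply S) = g" by (intro adjoint_unique) simp
  then show ?thesis by (simp add: g)
qed

section \<open>Uniform boundedness and strongly continuous semigroups\<close>

proposition uniform_boundedness:
  fixes S :: "nat \<Rightarrow> 'a::banach \<Rightarrow>\<^sub>L 'b::real_normed_vector"
  assumes "\<And>x. bounded (range (\<lambda>n. S n x))"
  shows "bounded (range S)"
proof -
  define F where "F = (\<lambda>k::nat. {x. \<forall>n. norm (S n x) \<le> real k})"
  have "closed (F k)" for k
    unfolding F_def
    by (intro closed_Collect_all closed_Collect_le continuous_intros)
  moreover have "\<Union>(range F) = UNIV"
  proof -
    have "\<exists>k. x \<in> F k" for x
    proof -
      obtain B where "\<And>n. norm (S n x) \<le> B" using assms[of x] by (auto simp: bounded_iff)
      moreover obtain k :: nat where "B \<le> real k" using real_arch_simple by blast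
      ultimately have "x \<in> F k" by (auto simp: F_def intro: order_trans)
      then show ?thesis by blast
    qed
    then show ?thesis by blast
  qed
  moreover have "Met_TC.mtopology interior_of (\<Union>(range F)) = {}" if "\<And>k. interior (F k) = {}"
    by (rule Met_TC.metric_Baire_category_alt)
       (use that \<open>\<And>k. closed (F k)\<close> in \<open>auto simp: complete_UNIV\<close>)
  ultimately obtain k where "interior (F k) \<noteq> {}" by auto
  then obtain x0 where "x0 \<in> interior (F k)" by blast
  then obtain r where r: "0 < r" "cball x0 r \<subseteq> F k"
    by (meson interior_subset mem_interior_cball)
  have "norm (S n) \<le> 2 * real k / r" for n
  proof (rule norm_blinfun_bound)
    fix x
    show "norm (S n x) \<le> 2 * real k / r * norm x"
    proof (cases "x = 0")
      case False
      define y where "y = (r / norm x) *\<^sub>R x"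
      have "x0 + y \<in> F k" "x0 \<in> F k"
        using r False by (auto simp: y_def dist_norm subset_iff)
      then have "norm (S n (x0 + y)) \<le> real k" "norm (S n x0) \<le> real k" by (auto simp: F_def)
      then have "norm (S n y) \<le> 2 * real k"
        using norm_triangle_ineq4[of "S n (x0 + y)" "S n x0"] by (simp add: blinfun.add_right)
      then show ?thesis
        using r False by (simp add: y_def blinfun.scaleR_right field_simps)
    qed simp
  qed (use r in simp)
  then show ?thesis by (auto simp: bounded_iff)
qed

text \<open>If the norms were unbounded near 0, there would be times decreasing to 0 along which the
  operators converge pointwise but have unbounded norms, against uniform boundedness. The semigroup
  law then spreads the bound from \<open>{0..\<eta>}\<close> to any bounded interval.\<close>

lemma C0_semigroup_locally_bounded:
  fixes T :: "real \<Rightarrow> 'a::banach \<Rightarrow>\<^sub>L 'a"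
  assumes T: "C0_semigroup T"
  shows "\<exists>K. \<forall>s\<in>{0..t}. norm (T s) \<le> K"
proof -
  have T0: "T 0 = id_blinfun" and add: "\<And>s t. 0 \<le> s \<Longrightarrow> 0 \<le> t \<Longrightarrow> T (s + t) = T s o\<^sub>L T t"
    and lim: "\<And>x. ((\<lambda>t. T t x) \<longlongrightarrow> x) (at_right 0)"
    using T by (auto simp: C0_semigroup_def)
  have "\<exists>\<eta>>0. \<exists>K. \<forall>s\<in>{0<..\<eta>}. norm (T s) \<le> K"
  proof (rule ccontr)
    assume "\<not> ?thesis"
    then have "\<forall>n. \<exists>s. s \<in> {0<..1 / real (Suc n)} \<and> real n < norm (T s)"
      by (metis not_le of_nat_0_less_iff zero_less_Suc zero_less_divide_1_iff)
    from choice[OF this] obtain s where s: "\<And>n. s n \<in> {0<..1 / real (Suc n)}"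
      and big: "\<And>n. real n < norm (T (s n))" by blast
    have "s \<longlonglongrightarrow> 0"
      by (rule tendsto_sandwich[OF _ _ tendsto_const LIMSEQ_Suc[OF lim_1_over_n]])
         (use s in \<open>auto intro!: always_eventually less_imp_le\<close>)
    then have "filterlim s (at_right 0) sequentially"
      unfolding filterlim_at using s by (auto intro!: always_eventually simp: less_imp_neq[THEN not_sym])
    then have "(\<lambda>n. T (s n) x) \<longlonglongrightarrow> x" for x
      using filterlim_compose[OF lim] by blast
    then have "bounded (range (\<lambda>n. T (s n) x))" for x
      using convergent_imp_bounded by blast
    then obtain B where "\<And>n. norm (T (s n)) \<le> B"
      using uniform_boundedness[of "\<lambda>n. T (s n)"] by (auto simp: bounded_iff)
    moreover obtain n :: nat where "B \<le> real n" using real_arch_simple by blast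
    ultimately show False using big[of n] by (meson not_le order_trans)
  qed
  then obtain \<eta> K0 where \<eta>: "0 < \<eta>" and K0: "\<And>s. s \<in> {0<..\<eta>} \<Longrightarrow> norm (T s) \<le> K0" by blast
  define K where "K = max 1 K0"
  have K: "norm (T s) \<le> K" if "s \<in> {0..\<eta>}" for s
  proof (cases "s = 0")
    case True
    have "norm (id_blinfun :: 'a \<Rightarrow>\<^sub>L 'a) \<le> 1" by (rule norm_blinfun_bound) auto
    then show ?thesis using True by (simp add: T0 K_def)
  next
    case False
    then show ?thesis using that K0[of s] by (simp add: K_def)
  qed
  have ind: "\<forall>s\<in>{0..real n * \<eta>}. norm (T s) \<le> K ^ Suc n" for n
  proof (induction n)
    case 0
    then show ?case using K[of 0] \<eta> by simp
  next
    case (Suc n)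
    show ?case
    proof
      fix s assume s: "s \<in> {0..real (Suc n) * \<eta>}"
      show "norm (T s) \<le> K ^ Suc (Suc n)"
      proof (cases "s \<le> \<eta>")
        case True
        have "K * 1 \<le> K * K ^ Suc n"
          by (intro mult_left_mono one_le_power) (simp_all add: K_def)
        then show ?thesis using K[of s] s True by simp
      next
        case False
        have "T s = T \<eta> o\<^sub>L T (s - \<eta>)" using add[of \<eta> "s - \<eta>"] \<eta> False by simp
        then have "norm (T s) \<le> norm (T \<eta>) * norm (T (s - \<eta>))" by (simp add: norm_blinfun_compose)
        also have "\<dots> \<le> K * K ^ Suc n"
          using Suc s False K[of \<eta>] \<eta> by (intro mult_mono) (auto simp: K_def algebra_simps)
        finally show ?thesis by simp
      qed
    qed
  qed
  obtain n :: nat where "t / \<eta> \<le> real n" using real_arch_simple by blast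
  then have "t \<le> real n * \<eta>" using \<eta> by (simp add: field_simps)
  then show ?thesis using ind[of n] by (intro exI[of _ "K ^ Suc n"]) auto
qed

lemma C0_semigroup_right_continuous:
  fixes T :: "real \<Rightarrow> 'a::real_normed_vector \<Rightarrow>\<^sub>L 'a"
  assumes T: "C0_semigroup T" and s: "0 \<le> s"
  shows "((\<lambda>r. T r x) \<longlongrightarrow> T s x) (at_right s)"
proof -
  have "((\<lambda>u. T u (T s x)) \<longlongrightarrow> T s x) (at_right 0)"
    using T by (simp add: C0_semigroup_def)
  moreover have "eventually (\<lambda>u. T u (T s x) = T (u + s) x) (at_right 0)"
    unfolding eventually_at_right_field
    using T s by (auto simp: C0_semigroup_def intro!: exI[of _ 1])
  ultimately have "((\<lambda>u. T (u + s) x) \<longlongrightarrow> T s x) (at_right 0)"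
    by (rule Lim_transform_eventually)
  then show ?thesis
    by (subst at_right_to_0) (simp add: filterlim_filtermap)
qed

lemma blinfun_borel_measurable [measurable]:
  "blinfun_apply S \<in> borel_measurable borel"
  by (intro borel_measurable_continuous_onI continuous_intros)

text \<open>Times are rounded up to a grid of mesh \<open>1 / Suc n\<close>. For each of the
  countably many grid times the map is continuous in \<open>x\<close>, and right continuity of the
  orbits gives the limit.\<close>

lemma C0_semigroup_joint_measurable:
  fixes T :: "real \<Rightarrow> 'a::{real_normed_vector, second_countable_topology} \<Rightarrow>\<^sub>L 'a"
  assumes T: "C0_semigroup T" and L: "sets L = sets (restrict_space lborel {0<..t})"
    and M: "sets M = sets borel"
  shows "(\<lambda>(s, x). T s x) \<in> borel_measurable (L \<Otimes>\<^sub>M M)"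
proof -
  have [measurable_cong]: "sets L = sets (restrict_space borel {0<..t})" "sets M = sets borel"
    using L M by (auto cong: sets_restrict_space_cong)
  have sp: "space L = {0<..t}" using sets_eq_imp_space_eq[OF L] by (simp add: space_restrict_space)
  \<comment> \<open>Floor plus one rather than ceiling: \<open>a n s\<close> exceeds
    \<open>s\<close> strictly, also at grid points, as convergence along \<open>at_right s\<close>
    demands.\<close>
  define a where "a = (\<lambda>n s. (real (nat \<lfloor>real (Suc n) * s\<rfloor>) + 1) / real (Suc n))"
  have [measurable]: "(\<lambda>s::real. s) \<in> borel_measurable L"
    by (subst measurable_cong_sets[OF L refl]) (simp add: measurable_restrict_space1)
  show ?thesis
  proof (rule borel_measurable_LIMSEQ_metric[where f = "\<lambda>n p. T (a n (fst p)) (snd p)"])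
    fix n
    have "(\<lambda>p. T ((real (nat \<lfloor>real (Suc n) * fst p\<rfloor>) + 1) / real (Suc n)) (snd p)) \<in> borel_measurable (L \<Otimes>\<^sub>M M)"
    proof (rule measurable_compose_countable[where f = "\<lambda>i p. T ((real i + 1) / real (Suc n)) (snd p)"])
      show "(\<lambda>p. nat \<lfloor>real (Suc n) * fst p\<rfloor>) \<in> measurable (L \<Otimes>\<^sub>M M) (count_space UNIV)"
        by measurable
      fix i :: nat
      show "(\<lambda>p. T ((real i + 1) / real (Suc n)) (snd p)) \<in> borel_measurable (L \<Otimes>\<^sub>M M)"
        by measurable
    qed
    then show "(\<lambda>p. T (a n (fst p)) (snd p)) \<in> borel_measurable (L \<Otimes>\<^sub>M M)" by (simp add: a_def)
  next
    fix p assume p: "p \<in> space (L \<Otimes>\<^sub>M M)"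
    obtain s x where sx: "p = (s, x)" by (cases p)
    have s: "0 < s" using p sx sp by (auto simp: space_pair_measure)
    have a_gt: "s < a n s" and a_le: "a n s \<le> s + 1 / real (Suc n)" for n
    proof -
      define k where "k = real (nat \<lfloor>real (Suc n) * s\<rfloor>)"
      define r where "r = real (Suc n)"
      have "k = of_int \<lfloor>r * s\<rfloor>" using s by (simp add: k_def r_def)
      then have k: "r * s < k + 1" "k \<le> r * s" by linarith+
      have r: "0 < r" by (simp add: r_def)
      have an: "a n s = (k + 1) / r" by (simp add: a_def k_def r_def)
      from k r show "s < a n s" "a n s \<le> s + 1 / real (Suc n)"
        unfolding an r_def[symmetric] by (simp_all add: field_simps)
    qed
    have "(\<lambda>n. s + 1 / real (Suc n)) \<longlonglongrightarrow> s + 0"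
      by (intro tendsto_intros LIMSEQ_Suc[OF lim_1_over_n])
    then have up: "(\<lambda>n. s + 1 / real (Suc n)) \<longlonglongrightarrow> s" by simp
    have "(\<lambda>n. a n s) \<longlonglongrightarrow> s"
    proof (rule tendsto_sandwich[OF _ _ tendsto_const up])
      show "eventually (\<lambda>n. s \<le> a n s) sequentially" using a_gt by (simp add: less_imp_le)
      show "eventually (\<lambda>n. a n s \<le> s + 1 / real (Suc n)) sequentially" using a_le by (intro always_eventually allI)
    qed
    then have "filterlim (\<lambda>n. a n s) (at_right s) sequentially"
      unfolding filterlim_at using a_gt by (simp add: less_imp_neq[THEN not_sym])
    from filterlim_compose[OF C0_semigroup_right_continuous[OF T] this, of x]
    show "(\<lambda>n. T (a n (fst p)) (snd p)) \<longlonglongrightarrow> (case p of (s, x) \<Rightarrow> T s x)"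
      using s sx by simp
  qed
qed

text \<open>Orthonormal vectors have mutual distance \<open>sqrt 2\<close>, so no point of a
  countable dense set can lie within \<open>1 / 2\<close> of two of them.\<close>

lemma orthonormal_countable:
  fixes H :: "'a::{real_inner, second_countable_topology} set"
  assumes "orthonormal H"
  shows "countable H"
proof -
  obtain D :: "'a set" where D: "countable D" and dense: "\<And>X. open X \<Longrightarrow> X \<noteq> {} \<Longrightarrow> \<exists>d\<in>D. d \<in> X"
    using countable_dense_exists by blast
  have "\<exists>d\<in>D. dist h d < 1 / 2" for h
    using dense[of "ball h (1/2)"] by (auto simp: dist_commute)
  then obtain d where d: "\<And>h. d h \<in> D" "\<And>h. dist h (d h) < 1 / 2" by metis
  have "inj_on d H"
  proof (rule inj_onI, rule ccontr)
    fix h k assume hk: "h \<in> H" "k \<in> H" "d h = d k" "h \<noteq> k"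
    have "orthogonal h k" "norm h = 1" "norm k = 1"
      using assms hk by (auto simp: orthonormal_def pairwise_def)
    then have "(norm (h - k))\<^sup>2 = 2"
      by (simp add: power2_norm_eq_inner inner_diff_left inner_diff_right orthogonal_def inner_commute norm_eq_1)
    moreover have "norm (h - k) < 1"
      using d(2)[of h] d(2)[of k] hk(3) dist_triangle2[of h k "d h"] by (simp add: dist_norm)
    then have "(norm (h - k))\<^sup>2 < 1" by (simp add: power_less_one_iff)
    ultimately show False by simp
  qed
  then show ?thesis
    by (rule countable_image_inj_on[rotated]) (rule countable_subset[OF _ D], use d(1) in auto)
qed

text \<open>The projections are contractions that eventually fix every element of the dense span.
  Enumerating the basis treats all dimensions alike: for a finite basis the sets \<open>J n\<close>
  just stop growing.\<close>

lemma ortho_proj_tendsto: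
  fixes H :: "'a::{real_inner, second_countable_topology} set"
  assumes H: "orthonormal_basis H"
  shows "\<exists>J::nat \<Rightarrow> 'a set. (\<forall>n. finite (J n) \<and> orthonormal (J n)) \<and> (\<forall>x. (\<lambda>n. ortho_proj (J n) x) \<longlonglongrightarrow> x)"
proof -
  have on: "orthonormal H" and dense: "closure (span H) = UNIV"
    using H by (auto simp: orthonormal_basis_def orthonormal_def)
  define J where "J = (\<lambda>n::nat. {h \<in> H. to_nat_on H h \<le> n})"
  have fin: "finite (J n)" for n
  proof (rule finite_imageD[of "to_nat_on H"])
    show "finite (to_nat_on H ` J n)" by (rule finite_subset[of _ "{..n}"]) (auto simp: J_def)
    show "inj_on (to_nat_on H) (J n)"
      by (rule inj_on_subset[OF inj_on_to_nat_on[OF orthonormal_countable[OF on]]]) (auto simp: J_def)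
  qed
  have onJ: "orthonormal (J n)" for n
    using on by (auto simp: orthonormal_def J_def pairwise_def)
  have fix_span: "ortho_proj (J n) y = y" if "y \<in> span (J n)" for n y
  proof (rule linear_eq_on_span[OF _ _ _ that])
    show "linear (ortho_proj (J n))"
      by (rule linearI) (simp_all add: ortho_proj_def inner_add_left scaleR_add_left sum.distrib scaleR_sum_right)
    show "linear (\<lambda>x::'a. x)" by (simp add: linear_id[unfolded id_def])
    fix e assume e: "e \<in> J n"
    have "e \<bullet> e' = (if e' = e then 1 else 0)" if "e' \<in> J n" for e'
      using onJ[of n] e that by (auto simp: orthonormal_def pairwise_def orthogonal_def norm_eq_1)
    then show "ortho_proj (J n) e = e"
      using e fin[of n] by (simp add: ortho_proj_def if_distrib[of "\<lambda>a. a *\<^sub>R _"] sum.delta cong: sum.cong if_cong)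
  qed
  have "(\<lambda>n. ortho_proj (J n) x) \<longlonglongrightarrow> x" for x
  proof (rule LIMSEQ_I)
    fix r :: real assume r: "0 < r"
    have "x \<in> closure (span H)" using dense by simp
    then obtain y where y: "y \<in> span H" "dist y x < r / 2"
      using r closure_approachable half_gt_zero by metis
    then obtain S where S: "finite S" "S \<subseteq> H" "y \<in> span S"
      using span_explicit[of H] by (auto intro!: span_sum span_scale span_base) (metis (mono_tags, lifting) span_base span_scale span_sum)
    define n0 where "n0 = Max (insert 0 (to_nat_on H ` S))"
    have "ortho_proj (J n) y = y" if "n0 \<le> n" for n
    proof (rule fix_span)
      have "S \<subseteq> J n"
        using S that by (auto simp: J_def n0_def)
      then show "y \<in> span (J n)" using S(3) span_mono by blast
    qed
    then have "norm (ortho_proj (J n) x - x) < r" if "n0 \<le> n" for n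
    proof -
      have "ortho_proj (J n) x - x = ortho_proj (J n) (x - y) - (x - y)"
        using \<open>n0 \<le> n \<Longrightarrow> ortho_proj (J n) y = y\<close>[OF that] by (simp add: ortho_proj_diff)
      also have "norm \<dots> \<le> norm (ortho_proj (J n) (x - y)) + norm (x - y)"
        by (rule norm_triangle_ineq4)
      also have "\<dots> \<le> 2 * norm (x - y)" using norm_ortho_proj_le[OF fin onJ, of n "x - y"] by simp
      also have "\<dots> < r" using y(2) by (simp add: dist_norm norm_minus_commute)
      finally show ?thesis .
    qed
    then show "\<exists>n0. \<forall>n\<ge>n0. norm (ortho_proj (J n) x - x) < r" by blast
  qed
  then show ?thesis using fin onJ by blast
qed

section \<open>Laplace bounds for Mehler measures\<close>

lemma emeasure_levy_measure_tail:
  assumes M: "levy_measure M" and a: "0 < a"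
  shows "emeasure M {x. a \<le> norm x} < \<infinity>"
proof -
  have [measurable_cong]: "sets M = sets borel" using M by (simp add: levy_measure_def)
  let ?c = "min 1 (a\<^sup>2)"
  have c: "0 < ?c" using a by simp
  have m: "{x. a \<le> norm x} \<in> sets M" by measurable
  have "emeasure M {x. a \<le> norm x} = (\<integral>\<^sup>+x. indicator {x. a \<le> norm x} x \<partial>M)"
    using m by simp
  also have "\<dots> \<le> (\<integral>\<^sup>+x. ennreal (1 / ?c) * ennreal (min 1 ((norm x)\<^sup>2)) \<partial>M)"
  proof (rule nn_integral_mono)
    fix x
    have "1 \<le> 1 / ?c * min 1 ((norm x)\<^sup>2)" if "a \<le> norm x"
    proof -
      have "?c \<le> min 1 ((norm x)\<^sup>2)" using that a by (intro min.mono power_mono) auto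
      then show ?thesis using c by (simp add: field_simps)
    qed
    then show "indicator {x. a \<le> norm x} x \<le> ennreal (1 / ?c) * ennreal (min 1 ((norm x)\<^sup>2))"
      using c by (auto simp flip: ennreal_mult ennreal_1 split: split_indicator simp del: ennreal_1)
  qed
  also have "\<dots> = ennreal (1 / ?c) * (\<integral>\<^sup>+x. ennreal (min 1 ((norm x)\<^sup>2)) \<partial>M)"
    by (rule nn_integral_cmult) measurable
  also have "\<dots> < \<infinity>" using M by (simp add: levy_measure_def ennreal_mult_less_top)
  finally show ?thesis .
qed

text \<open>The origin is added so that the sets cover the whole space; it costs nothing, since a
  Levy measure has no mass there.\<close>

definition levy_exhaustion :: "nat \<Rightarrow> 'a::real_normed_vector set" where
  "levy_exhaustion k = {0} \<union> {x. 1 / real (Suc k) \<le> norm x}"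

lemma levy_exhaustion:
  fixes M :: "'a::real_normed_vector measure"
  assumes M: "levy_measure M"
  shows "(levy_exhaustion k :: 'a set) \<in> sets M" "emeasure M (levy_exhaustion k) < \<infinity>"
    and "incseq (levy_exhaustion :: nat \<Rightarrow> 'a set)" "(\<Union>k. levy_exhaustion k :: 'a set) = UNIV"
proof -
  have [measurable_cong]: "sets M = sets borel" using M by (simp add: levy_measure_def)
  show "(levy_exhaustion k :: 'a set) \<in> sets M"
    unfolding levy_exhaustion_def by measurable
  have "emeasure M (levy_exhaustion k) \<le> emeasure M {0} + emeasure M {x. 1 / real (Suc k) \<le> norm x}"
    unfolding levy_exhaustion_def by (rule emeasure_subadditive) measurable
  also have "\<dots> < \<infinity>"
    using emeasure_levy_measure_tail[OF M, of "1 / real (Suc k)"] M by (simp add: levy_measure_def)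
  finally show "emeasure M (levy_exhaustion k) < \<infinity>" .
  show "incseq (levy_exhaustion :: nat \<Rightarrow> 'a set)"
  proof (rule incseq_SucI)
    fix k
    have "1 / real (Suc (Suc k)) \<le> 1 / real (Suc k)" by (simp add: frac_le)
    then show "levy_exhaustion k \<subseteq> (levy_exhaustion (Suc k) :: 'a set)"
      by (auto simp: levy_exhaustion_def)
  qed
  show "(\<Union>k. levy_exhaustion k :: 'a set) = UNIV"
  proof -
    have "\<exists>k. x \<in> levy_exhaustion k" for x :: 'a
    proof (cases "x = 0")
      case False
      then obtain n where "1 / real (Suc n) < norm x"
        using reals_Archimedean[of "norm x"] by (auto simp: inverse_eq_divide)
      then show ?thesis by (auto simp: levy_exhaustion_def intro!: exI[of _ n])
    qed (simp add: levy_exhaustion_def)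
    then show ?thesis by blast
  qed
qed

lemma levy_measure_sigma_finite:
  fixes M :: "'a::real_normed_vector measure"
  assumes M: "levy_measure M"
  shows "sigma_finite_measure M"
proof
  have sp: "space M = UNIV"
    using M sets_eq_imp_space_eq[of M borel] by (simp add: levy_measure_def)
  show "\<exists>A. countable A \<and> A \<subseteq> sets M \<and> \<Union> A = space M \<and> (\<forall>a\<in>A. emeasure M a \<noteq> \<infinity>)"
    using levy_exhaustion[OF M] sp
    by (intro exI[of _ "range (levy_exhaustion :: nat \<Rightarrow> 'a set)"]) (auto simp: less_top)
qed

lemma nn_integral_blinfun_le:
  fixes M :: "'a::real_normed_vector measure" and S :: "'a \<Rightarrow>\<^sub>L 'a"
  assumes M: "sets M = sets borel"
    and dom: "\<And>B. B \<in> sets borel \<Longrightarrow> emeasure (distr M borel (blinfun_apply S)) B \<le> ennreal c * emeasure M B"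
    and f: "f \<in> borel_measurable borel"
  shows "(\<integral>\<^sup>+x. f (S x) \<partial>M) \<le> ennreal c * (\<integral>\<^sup>+x. f x \<partial>M)"
proof -
  note [measurable_cong] = M
  have "(\<integral>\<^sup>+x. f (S x) \<partial>M) = (\<integral>\<^sup>+x. f x \<partial>distr M borel (blinfun_apply S))"
    using f by (subst nn_integral_distr) auto
  also have "\<dots> \<le> (\<integral>\<^sup>+x. f x \<partial>scale_measure (ennreal c) M)"
  proof (rule nn_integral_mono_measure)
    show "distr M borel (blinfun_apply S) \<le> scale_measure (ennreal c) M"
      using dom M by (subst le_measure) (auto simp: emeasure_scale_measure)
  qed (simp add: M)
  also have "\<dots> = ennreal c * (\<integral>\<^sup>+x. f x \<partial>M)"
    using f M by (subst nn_integral_scale_measure) (auto cong: measurable_cong_sets)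
  finally show ?thesis .
qed

lemma exp_remainder_nonneg: "0 \<le> exp r - 1 - (r::real)"
  using exp_ge_add_one_self[of r] by linarith

lemma exp_remainder_le:
  fixes r :: real
  assumes "0 \<le> r"
  shows "exp r - 1 - r \<le> r\<^sup>2 * exp r"
proof -
  have "norm (exp r - (\<Sum>i\<le>1. r ^ i / fact i)) \<le> exp (norm r) * (norm r ^ Suc 1) / fact 1"
    by (rule Taylor_exp_field)
  then show ?thesis using assms by (simp add: power2_eq_square mult_ac)
qed

lemma integrable_exp_remainder:
  fixes M :: "'a::real_normed_vector measure"
  assumes M: "sets M = sets borel" and l: "0 \<le> l"
    and mom: "\<And>s. 0 < s \<Longrightarrow> (\<integral>\<^sup>+y. ennreal ((norm y)\<^sup>2 * exp (s * norm y)) \<partial>M) < \<infinity>"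
  shows "integrable M (\<lambda>x. exp (l * norm x) - 1 - l * norm x)"
proof (cases "l = 0")
  case False
  note [measurable_cong] = M
  have "integrable M (\<lambda>y. (norm y)\<^sup>2 * exp (l * norm y))"
    using mom[of l] l False by (intro integrableI_nonneg) auto
  then have "integrable M (\<lambda>y. l\<^sup>2 * ((norm y)\<^sup>2 * exp (l * norm y)))" by (rule integrable_mult_right)
  then show ?thesis
  proof (rule Bochner_Integration.integrable_bound)
    show "AE x in M. norm (exp (l * norm x) - 1 - l * norm x) \<le> norm (l\<^sup>2 * ((norm x)\<^sup>2 * exp (l * norm x)))"
    proof (rule AE_I2)
      fix x :: 'a
      have "exp (l * norm x) - 1 - l * norm x \<le> (l * norm x)\<^sup>2 * exp (l * norm x)"
        using l by (intro exp_remainder_le) simp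
      then show "norm (exp (l * norm x) - 1 - l * norm x) \<le> norm (l\<^sup>2 * ((norm x)\<^sup>2 * exp (l * norm x)))"
        using exp_remainder_nonneg[of "l * norm x"] by (simp add: power_mult_distrib)
    qed
  qed measurable
qed simp

text \<open>Integrating the domination over time gives a constant independent of \<open>t\<close>,
  and this uniformity is what allows \<open>t\<close> to tend to infinity later.\<close>

lemma nn_integral_semigroup_orbit_le:
  fixes T :: "real \<Rightarrow> 'a::{real_normed_vector, second_countable_topology} \<Rightarrow>\<^sub>L 'a"
  assumes T: "C0_semigroup T" and M: "levy_measure M"
    and h_pos: "\<And>t. 0 < t \<Longrightarrow> 0 < h t" and h_int: "set_integrable lborel {0<..} h"
    and h_dom: "\<And>t B. 0 < t \<Longrightarrow> B \<in> sets borel \<Longrightarrow>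
          emeasure (distr M borel (blinfun_apply (T t))) B \<le> ennreal (h t) * emeasure M B"
    and f [measurable]: "f \<in> borel_measurable borel"
  shows "(\<integral>\<^sup>+(s, x). f (T s x) \<partial>(restrict_space lborel {0<..t} \<Otimes>\<^sub>M M))
    \<le> ennreal (LINT s:{0<..}|lborel. h s) * (\<integral>\<^sup>+x. f x \<partial>M)"
proof -
  let ?L = "restrict_space lborel {0<..t::real}"
  interpret M: sigma_finite_measure M by (rule levy_measure_sigma_finite[OF M])
  have Mb: "sets M = sets borel" using M by (simp add: levy_measure_def)
  have [measurable]: "(\<lambda>(s, x). T s x) \<in> borel_measurable (?L \<Otimes>\<^sub>M M)"
    by (rule C0_semigroup_joint_measurable[OF T refl Mb])
  have "(\<lambda>p. f ((\<lambda>(s, x). T s x) p)) \<in> borel_measurable (?L \<Otimes>\<^sub>M M)"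
    by measurable
  then have meas: "(\<lambda>(s, x). f (T s x)) \<in> borel_measurable (?L \<Otimes>\<^sub>M M)"
    by (simp add: case_prod_unfold)
  have "(\<integral>\<^sup>+(s, x). f (T s x) \<partial>(?L \<Otimes>\<^sub>M M)) = (\<integral>\<^sup>+s. \<integral>\<^sup>+x. f (T s x) \<partial>M \<partial>?L)"
    using M.nn_integral_fst[OF meas] by simp
  also have "\<dots> = (\<integral>\<^sup>+s. (\<integral>\<^sup>+x. f (T s x) \<partial>M) * indicator {0<..t} s \<partial>lborel)"
    by (rule nn_integral_restrict_space) simp
  also have "\<dots> \<le> (\<integral>\<^sup>+s. ennreal (indicator {0<..} s *\<^sub>R h s) * (\<integral>\<^sup>+x. f x \<partial>M) \<partial>lborel)"
  proof (rule nn_integral_mono)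
    fix s :: real
    show "(\<integral>\<^sup>+x. f (T s x) \<partial>M) * indicator {0<..t} s \<le> ennreal (indicator {0<..} s *\<^sub>R h s) * (\<integral>\<^sup>+x. f x \<partial>M)"
    proof (cases "s \<in> {0<..t}")
      case True
      then have s: "0 < s" by simp
      have "(\<integral>\<^sup>+x. f (T s x) \<partial>M) \<le> ennreal (h s) * (\<integral>\<^sup>+x. f x \<partial>M)"
        by (rule nn_integral_blinfun_le[OF Mb h_dom[OF s] f])
      then show ?thesis using True by simp
    qed simp
  qed
  also have "\<dots> = (\<integral>\<^sup>+s. ennreal (indicator {0<..} s *\<^sub>R h s) \<partial>lborel) * (\<integral>\<^sup>+x. f x \<partial>M)"
    using h_int unfolding set_integrable_def by (intro nn_integral_multc) auto
  also have "(\<integral>\<^sup>+s. ennreal (indicator {0<..} s *\<^sub>R h s) \<partial>lborel) = ennreal (LINT s:{0<..}|lborel. h s)"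
    unfolding set_lebesgue_integral_def
  proof (rule nn_integral_eq_integral)
    show "integrable lborel (\<lambda>s. indicator {0<..} s *\<^sub>R h s)" using h_int by (simp add: set_integrable_def)
    show "AE s in lborel. 0 \<le> indicator {0<..} s *\<^sub>R h s"
      using h_pos by (intro AE_I2) (simp add: indicator_def less_imp_le)
  qed
  finally show ?thesis .
qed

text \<open>The projections converge pointwise to the identity, and bounded test functions are
  integrated against the single law \<open>m\<close>, so dominated convergence removes the
  projections from both sides.\<close>

proposition laplace_bounded_infinitely_divisible:
  fixes N :: "'w measure" and Y :: "'w \<Rightarrow> 'a::{real_inner, banach, second_countable_topology}"
  assumes Y: "Y \<in> borel_measurable N"
    and A: "\<And>k. A k \<in> sets N" and fin: "\<And>k::nat. emeasure N (A k) < \<infinity>"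
    and inc: "incseq A" and cover: "(\<Union>k. A k) = space N"
    and int2: "integrable N (\<lambda>w. (norm (Y w))\<^sup>2)"
    and l: "0 \<le> l" and int: "integrable N (\<lambda>w. exp (l * norm (Y w)) - 1 - l * norm (Y w))"
    and H: "orthonormal_basis (H :: 'a set)" and m: "borel_prob m" and lin: "linear \<beta>"
    and char: "\<And>\<xi>. char_fun m \<xi> = exp (\<i> * complex_of_real (\<beta> \<xi>) +
        (CLINT w|N. iexp (Y w \<bullet> \<xi>) - 1 - \<i> * complex_of_real (Y w \<bullet> \<xi>)))"
  shows "laplace_bounded l (LINT w|N. exp (l * norm (Y w)) - 1 - l * norm (Y w)) m"
  unfolding laplace_bounded_def
proof safe
  fix g :: "'a \<Rightarrow> real"
  assume g: "1-lipschitz_on UNIV g" and bdd: "bounded (range g)"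
  let ?C = "LINT w|N. exp (l * norm (Y w)) - 1 - l * norm (Y w)"
  interpret prob_space m using m by (simp add: borel_prob_def)
  have [measurable_cong]: "sets m = sets borel" using m by (simp add: borel_prob_def)
  note [measurable] = lipschitz_on_UNIV_measurable[OF g] ortho_proj_measurable
  obtain J :: "nat \<Rightarrow> 'a set" where J: "\<And>n. finite (J n)" "\<And>n. orthonormal (J n)"
    and J_lim: "\<And>x. (\<lambda>n. ortho_proj (J n) x) \<longlonglongrightarrow> x"
    using ortho_proj_tendsto[OF H] by blast
  have g_lim: "(\<lambda>n. g (ortho_proj (J n) x)) \<longlonglongrightarrow> g x" for x
    by (rule continuous_on_tendsto_compose[OF lipschitz_on_continuous_on[OF g] J_lim]) auto
  have conv: "(\<lambda>n. LINT x|m. f (g (ortho_proj (J n) x))) \<longlonglongrightarrow> (LINT x|m. f (g x))"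
    if f: "continuous_on UNIV f" and fb: "bounded (range (\<lambda>x. f (g x)))" for f :: "real \<Rightarrow> real"
  proof -
    obtain B where B: "\<And>x. \<bar>f (g x)\<bar> \<le> B" using fb by (auto simp: bounded_iff)
    have [measurable]: "f \<in> borel_measurable borel" using f by (rule borel_measurable_continuous_onI)
    show ?thesis
    proof (rule integral_dominated_convergence[where w = "\<lambda>_. B"])
      show "AE x in m. (\<lambda>n. f (g (ortho_proj (J n) x))) \<longlonglongrightarrow> f (g x)"
        by (intro AE_I2 continuous_on_tendsto_compose[OF f g_lim]) auto
      show "AE x in m. norm (f (g (ortho_proj (J n) x))) \<le> B" for n using B by simp
    qed simp_all
  qed
  have L1: "(\<lambda>n. LINT x|m. exp (l * g (ortho_proj (J n) x))) \<longlonglongrightarrow> (LINT x|m. exp (l * g x))"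
    by (rule conv[of "\<lambda>y. exp (l * y)", OF _ bounded_exp_mult[OF bdd]]) (intro continuous_intros)
  have L2: "(\<lambda>n. LINT x|m. g (ortho_proj (J n) x)) \<longlonglongrightarrow> (LINT x|m. g x)"
    by (rule conv[of "\<lambda>y. y", OF _ bdd]) (intro continuous_intros)
  have "(LINT x|m. exp (l * g (ortho_proj (J n) x))) \<le> exp (l * (LINT x|m. g (ortho_proj (J n) x)) + ?C)" for n
    by (rule laplace_bound_infinitely_divisible_ortho_proj[OF Y A fin inc cover int2 l int J m lin char g bdd])
  moreover have "(\<lambda>n. exp (l * (LINT x|m. g (ortho_proj (J n) x)) + ?C)) \<longlonglongrightarrow> exp (l * (LINT x|m. g x) + ?C)"
    by (intro tendsto_intros L2)
  ultimately show "(LINT x|m. exp (l * g x)) \<le> exp (l * (LINT x|m. g x) + ?C)"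
    using LIMSEQ_le[OF L1] by blast
qed

text \<open>Time 0 is a null set; it is dropped because the domination hypothesis speaks of positive
  times only.\<close>

lemma integral_Icc_eq_restrict_space:
  fixes f :: "real \<Rightarrow> 'b::{banach, second_countable_topology}"
  shows "(LINT s:{0..t}|lborel. f s) = (LINT s|restrict_space lborel {0<..t}. f s)"
proof -
  have "(LINT s:{0..t}|lborel. f s) = (LINT s:{0<..t}|lborel. f s)"
    unfolding set_lebesgue_integral_def
    by (rule integral_discrete_difference[of "{0}"]) (auto split: split_indicator)
  also have "\<dots> = (LINT s|restrict_space lborel {0<..t}. f s)"
    unfolding set_lebesgue_integral_def by (rule integral_restrict_space[symmetric]) simp
  finally show ?thesis .
qed

text \<open>\<open>\<mu> t\<close> is the law of compensated jumps \<open>T s x\<close> with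
  intensity \<open>ds M(dx)\<close>, plus a drift. The work lies in rewriting its characteristic
  function, in which only jumps with \<open>x\<close> in the unit ball are compensated, in the fully
  compensated form required above.\<close>

proposition mehler_laplace_bounded:
  fixes T :: "real \<Rightarrow> 'a::{real_inner, banach, polish_space} \<Rightarrow>\<^sub>L 'a"
  assumes T: "C0_semigroup T" and M: "levy_measure M" and mehler: "mehler_measures T b M \<mu>"
    and H: "orthonormal_basis (H :: 'a set)"
    and h_pos: "\<And>t. 0 < t \<Longrightarrow> 0 < h t" and h_int: "set_integrable lborel {0<..} h"
    and h_dom: "\<And>t B. 0 < t \<Longrightarrow> B \<in> sets borel \<Longrightarrow>
          emeasure (distr M borel (blinfun_apply (T t))) B \<le> ennreal (h t) * emeasure M B"
    and exp_moment: "\<And>s. 0 < s \<Longrightarrow>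
          (\<integral>\<^sup>+y. ennreal ((norm y)\<^sup>2 * exp (s * norm y)) \<partial>M) < \<infinity>"
    and t: "0 < t" and l: "0 \<le> l"
  shows "laplace_bounded l ((LINT s:{0<..}|lborel. h s) * (LINT x|M. exp (l * norm x) - 1 - l * norm x)) (\<mu> t)"
proof -
  define L where "L = restrict_space lborel {0<..t}"
  define N where "N = L \<Otimes>\<^sub>M M"
  define Y where "Y = (\<lambda>p. T (fst p) (snd p))"
  define H1 where "H1 = (LINT s:{0<..}|lborel. h s)"
  have H1: "0 \<le> H1"
    unfolding H1_def set_lebesgue_integral_def using h_pos
    by (intro integral_nonneg_AE AE_I2) (simp add: indicator_def less_imp_le)
  have Mb [measurable_cong]: "sets M = sets borel" using M by (simp add: levy_measure_def)
  have spM: "space M = UNIV" using sets_eq_imp_space_eq[OF Mb] by simp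
  have spL: "space L = {0<..t}" by (simp add: L_def space_restrict_space)
  have spN: "space N = {0<..t} \<times> UNIV" by (simp add: N_def space_pair_measure spL spM)
  interpret M: sigma_finite_measure M by (rule levy_measure_sigma_finite[OF M])
  have emL: "emeasure L {0<..t} = ennreal t" using t by (simp add: L_def emeasure_restrict_space)
  interpret L: finite_measure L
    by (rule finite_measureI) (simp add: spL emL)
  interpret Q: pair_sigma_finite L M ..
  have "(\<lambda>(s, x). T s x) \<in> borel_measurable (L \<Otimes>\<^sub>M M)"
    by (rule C0_semigroup_joint_measurable[OF T _ Mb]) (simp add: L_def)
  then have Ym [measurable]: "Y \<in> borel_measurable N" by (simp add: Y_def N_def case_prod_unfold)
  have orbit: "(\<integral>\<^sup>+p. f (Y p) \<partial>N) \<le> ennreal H1 * (\<integral>\<^sup>+x. f x \<partial>M)" if "f \<in> borel_measurable borel" for f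
  proof -
    have "(\<integral>\<^sup>+(s, x). f (T s x) \<partial>(restrict_space lborel {0<..t} \<Otimes>\<^sub>M M))
        \<le> ennreal (LINT s:{0<..}|lborel. h s) * (\<integral>\<^sup>+x. f x \<partial>M)"
      by (rule nn_integral_semigroup_orbit_le[where h = h]) (fact T M h_pos h_int h_dom that)+
    then show ?thesis unfolding N_def L_def Y_def H1_def case_prod_unfold .
  qed
  have push: "(\<integral>\<^sup>+x. f (T s x) \<partial>M) \<le> ennreal (h s) * (\<integral>\<^sup>+x. f x \<partial>M)"
    if "0 < s" "f \<in> borel_measurable borel" for s f
    by (rule nn_integral_blinfun_le[OF Mb h_dom[OF that(1)] that(2)])
  have fin2: "(\<integral>\<^sup>+x. ennreal ((norm x)\<^sup>2) \<partial>M) < \<infinity>"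
  proof -
    have "(\<integral>\<^sup>+x. ennreal ((norm x)\<^sup>2) \<partial>M) \<le> (\<integral>\<^sup>+x. ennreal ((norm x)\<^sup>2 * exp (1 * norm x)) \<partial>M)"
    proof (intro nn_integral_mono ennreal_leI)
      fix x :: 'a
      show "(norm x)\<^sup>2 \<le> (norm x)\<^sup>2 * exp (1 * norm x)"
        using mult_left_mono[of 1 "exp (norm x)" "(norm x)\<^sup>2"] by simp
    qed
    also have "\<dots> < \<infinity>" by (rule exp_moment) simp
    finally show ?thesis .
  qed
  have int2: "integrable N (\<lambda>p. (norm (Y p))\<^sup>2)"
  proof (rule integrableI_nonneg)
    have "(\<integral>\<^sup>+p. ennreal ((norm (Y p))\<^sup>2) \<partial>N) \<le> ennreal H1 * (\<integral>\<^sup>+x. ennreal ((norm x)\<^sup>2) \<partial>M)"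
      by (rule orbit) measurable
    also have "\<dots> < \<infinity>" using fin2 by (simp add: ennreal_mult_less_top)
    finally show "(\<integral>\<^sup>+p. ennreal ((norm (Y p))\<^sup>2) \<partial>N) < \<infinity>" .
  qed auto
  have int2s: "integrable M (\<lambda>x. (norm (T s x))\<^sup>2)" if s: "0 < s" for s
  proof (rule integrableI_nonneg)
    have "(\<integral>\<^sup>+x. ennreal ((norm (T s x))\<^sup>2) \<partial>M) \<le> ennreal (h s) * (\<integral>\<^sup>+x. ennreal ((norm x)\<^sup>2) \<partial>M)"
      by (rule push[OF s]) measurable
    also have "\<dots> < \<infinity>" using fin2 by (simp add: ennreal_mult_less_top)
    finally show "(\<integral>\<^sup>+x. ennreal ((norm (T s x))\<^sup>2) \<partial>M) < \<infinity>" .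
  qed auto
  let ?e = "\<lambda>x::'a. exp (l * norm x) - 1 - l * norm x"
  have e_nn: "0 \<le> ?e x" for x by (rule exp_remainder_nonneg)
  have ieM: "integrable M ?e" by (rule integrable_exp_remainder[OF Mb l exp_moment])
  have nn_e: "(\<integral>\<^sup>+p. ennreal (?e (Y p)) \<partial>N) \<le> ennreal (H1 * (LINT x|M. ?e x))"
  proof -
    have "(\<integral>\<^sup>+p. ennreal (?e (Y p)) \<partial>N) \<le> ennreal H1 * (\<integral>\<^sup>+x. ennreal (?e x) \<partial>M)"
      by (rule orbit) measurable
    also have "(\<integral>\<^sup>+x. ennreal (?e x) \<partial>M) = ennreal (LINT x|M. ?e x)"
      by (rule nn_integral_eq_integral[OF ieM]) (use e_nn in simp)
    finally show ?thesis using H1 by (simp add: ennreal_mult')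
  qed
  have ieN: "integrable N (\<lambda>p. ?e (Y p))"
  proof (rule integrableI_nonneg)
    show "(\<integral>\<^sup>+p. ennreal (?e (Y p)) \<partial>N) < \<infinity>"
      by (rule order.strict_trans1[OF nn_e]) simp
  qed (use e_nn in auto)
  have CN: "(LINT p|N. ?e (Y p)) \<le> H1 * (LINT x|M. ?e x)"
  proof -
    have "ennreal (LINT p|N. ?e (Y p)) \<le> ennreal (H1 * (LINT x|M. ?e x))"
      using nn_e e_nn by (subst nn_integral_eq_integral[OF ieN, symmetric]) auto
    moreover have "0 \<le> H1 * (LINT x|M. ?e x)"
      using H1 e_nn by (intro mult_nonneg_nonneg integral_nonneg_AE) auto
    ultimately show ?thesis by (simp add: ennreal_le_iff)
  qed
  define A where "A = (\<lambda>k. {0<..t} \<times> (levy_exhaustion k :: 'a set))"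
  have L0: "{0<..t} \<in> sets L" using sets.top[of L] by (simp add: spL)
  have A: "A k \<in> sets N" for k
    unfolding A_def N_def by (rule pair_measureI[OF L0 levy_exhaustion(1)[OF M]])
  have Afin: "emeasure N (A k) < \<infinity>" for k
    unfolding A_def N_def
    by (subst M.emeasure_pair_measure_Times[OF L0 levy_exhaustion(1)[OF M]])
       (use levy_exhaustion(2)[OF M, of k] in \<open>simp add: emL ennreal_mult_less_top\<close>)
  have Ainc: "incseq A" using levy_exhaustion(3)[OF M] by (auto simp: A_def incseq_def)
  have Acov: "(\<Union>k. A k) = space N" using levy_exhaustion(4)[OF M] by (auto simp: A_def spN)
  have \<mu>: "borel_prob (\<mu> t)" using mehler t by (simp add: mehler_measures_def borel_prob_def)
  \<comment> \<open>The compensator that \<open>levy_exponent\<close> omits. The ball constrains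
    \<open>x\<close> and not \<open>T s x\<close>, because the exponent is evaluated at the adjoint
    applied to \<open>\<xi>\<close>.\<close>
  let ?tail = "\<lambda>\<xi> p. indicator (- ball 0 1) (snd p) * (Y p \<bullet> \<xi>) :: real"
  have ball_fin: "emeasure M (- ball 0 1) < \<infinity>"
  proof -
    have "- ball (0::'a) 1 = {x. 1 \<le> norm x}" by auto
    then show ?thesis using emeasure_levy_measure_tail[OF M, of 1] by simp
  qed
  \<comment> \<open>Outside the ball \<open>M\<close> is finite, and
    \<open>r \<le> 1 + r\<^sup>2\<close> reduces first moments to second ones.\<close>
  have tail_bound: "norm (indicator (- ball 0 1) x * (y \<bullet> \<xi>) :: real) \<le> norm \<xi> * (indicator (- ball 0 1) x + (norm y)\<^sup>2)"
    for x y \<xi> :: 'a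
  proof -
    have "norm y \<le> 1 + (norm y)\<^sup>2"
      using zero_le_power2[of "norm y - 1/2"] by (simp add: power2_diff field_simps)
    then have "norm \<xi> * norm y \<le> norm \<xi> * (1 + (norm y)\<^sup>2)" by (rule mult_left_mono) simp
    then have "\<bar>y \<bullet> \<xi>\<bar> \<le> norm \<xi> * (1 + (norm y)\<^sup>2)"
      using Cauchy_Schwarz_ineq2[of y \<xi>] by (simp add: mult.commute)
    then show ?thesis by (simp add: indicator_def)
  qed
  have tailN: "integrable N (?tail \<xi>)" for \<xi>
  proof (rule Bochner_Integration.integrable_bound)
    have "integrable N (indicator ({0<..t} \<times> - ball 0 1) :: _ \<Rightarrow> real)"
    proof (rule integrable_real_indicator)
      show "{0<..t} \<times> - ball 0 1 \<in> sets N" unfolding N_def by (rule pair_measureI[OF L0]) measurable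
      have "emeasure N ({0<..t} \<times> - ball 0 1) = emeasure L {0<..t} * emeasure M (- ball 0 1)"
        unfolding N_def by (rule M.emeasure_pair_measure_Times[OF L0]) measurable
      then show "emeasure N ({0<..t} \<times> - ball 0 1) < \<infinity>"
        using ball_fin by (simp add: emL ennreal_mult_less_top)
    qed
    then show "integrable N (\<lambda>p. norm \<xi> * (indicator ({0<..t} \<times> - ball 0 1) p + (norm (Y p))\<^sup>2))"
      by (intro integrable_mult_right Bochner_Integration.integrable_add int2)
    show "AE p in N. norm (?tail \<xi> p) \<le> norm (norm \<xi> * (indicator ({0<..t} \<times> - ball 0 1) p + (norm (Y p))\<^sup>2))"
    proof (rule AE_I2)
      fix p assume "p \<in> space N"
      then have "indicator ({0<..t} \<times> - ball 0 1) p = (indicator (- ball 0 1) (snd p) :: real)"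
        by (auto simp: spN split: split_indicator)
      then show "norm (?tail \<xi> p) \<le> norm (norm \<xi> * (indicator ({0<..t} \<times> - ball 0 1) p + (norm (Y p))\<^sup>2))"
        using tail_bound[of "snd p" "Y p" \<xi>] by simp
    qed
    have sndm: "snd \<in> measurable N M" by (simp add: N_def)
    have "(\<lambda>x. indicator (- ball 0 1) x :: real) \<in> borel_measurable M" by measurable
    from measurable_compose[OF sndm this]
    show "?tail \<xi> \<in> borel_measurable N" by measurable
  qed
  have tails: "integrable M (\<lambda>x. indicator (- ball 0 1) x * (T s x \<bullet> \<xi>) :: real)" if s: "0 < s" for s \<xi>
  proof (rule Bochner_Integration.integrable_bound)
    show "integrable M (\<lambda>x. norm \<xi> * (indicator (- ball 0 1) x + (norm (T s x))\<^sup>2))"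
      using ball_fin by (intro integrable_mult_right Bochner_Integration.integrable_add int2s[OF s]
          integrable_real_indicator) auto
    show "AE x in M. norm (indicator (- ball 0 1) x * (T s x \<bullet> \<xi>) :: real) \<le>
        norm (norm \<xi> * (indicator (- ball 0 1) x + (norm (T s x))\<^sup>2))"
    proof (rule AE_I2)
      fix x
      show "norm (indicator (- ball 0 1) x * (T s x \<bullet> \<xi>) :: real) \<le>
        norm (norm \<xi> * (indicator (- ball 0 1) x + (norm (T s x))\<^sup>2))"
        using tail_bound[of x "T s x" \<xi>] by simp
    qed
  qed measurable
  let ?h = "\<lambda>\<xi> y. iexp (y \<bullet> \<xi>) - 1 - \<i> * complex_of_real (y \<bullet> \<xi>)"
  have h_bound: "norm (?h \<xi> y) \<le> norm ((norm y)\<^sup>2 * ((norm \<xi>)\<^sup>2 / 2))" for \<xi> y :: 'a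
  proof -
    have "norm (?h \<xi> y) \<le> (y \<bullet> \<xi>)\<^sup>2 / 2" by (rule norm_iexp_minus_one_minus_le)
    also have "(y \<bullet> \<xi>)\<^sup>2 \<le> (norm y * norm \<xi>)\<^sup>2"
      using Cauchy_Schwarz_ineq2[of y \<xi>] by (metis abs_ge_zero power2_abs power_mono)
    finally show ?thesis by (simp add: power_mult_distrib)
  qed
  have hN: "integrable N (\<lambda>p. ?h \<xi> (Y p))" for \<xi>
    by (rule Bochner_Integration.integrable_bound[OF integrable_mult_left[OF int2, of "(norm \<xi>)\<^sup>2 / 2"]])
       (measurable, intro AE_I2 h_bound)
  have hs: "integrable M (\<lambda>x. ?h \<xi> (T s x))" if s: "0 < s" for s \<xi>
    by (rule Bochner_Integration.integrable_bound[OF integrable_mult_left[OF int2s[OF s], of "(norm \<xi>)\<^sup>2 / 2"]])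
       (measurable, intro AE_I2 h_bound)
  \<comment> \<open>The compensator of the large jumps is added inside the integral and taken out
    again as drift; for \<open>s > 0\<close> the domination makes \<open>T s x\<close> square
    integrable, so both parts are integrable separately.\<close>
  have exponent: "levy_exponent b M (adjoint (blinfun_apply (T s)) \<xi>) =
      - \<i> * complex_of_real (T s b \<bullet> \<xi> + (LINT x|M. indicator (- ball 0 1) x * (T s x \<bullet> \<xi>))) - (CLINT x|M. ?h \<xi> (T s x))"
    if s: "0 < s" for s \<xi>
  proof -
    have it: "integrable M (\<lambda>x. \<i> * complex_of_real (indicator (- ball 0 1) x * (T s x \<bullet> \<xi>)))"
      by (intro integrable_mult_right integrable_of_real tails[OF s])
    have "(CLINT x|M. iexp (x \<bullet> adjoint (blinfun_apply (T s)) \<xi>) - 1 -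
          \<i> * complex_of_real (x \<bullet> adjoint (blinfun_apply (T s)) \<xi>) * indicator (ball 0 1) x) =
        (CLINT x|M. ?h \<xi> (T s x) + \<i> * complex_of_real (indicator (- ball 0 1) x * (T s x \<bullet> \<xi>)))"
      by (intro Bochner_Integration.integral_cong)
         (auto simp: inner_adjoint_blinfun split: split_indicator)
    also have "\<dots> = (CLINT x|M. ?h \<xi> (T s x)) +
        (CLINT x|M. \<i> * complex_of_real (indicator (- ball 0 1) x * (T s x \<bullet> \<xi>)))"
      by (rule Bochner_Integration.integral_add[OF hs[OF s] it])
    also have "(CLINT x|M. \<i> * complex_of_real (indicator (- ball 0 1) x * (T s x \<bullet> \<xi>))) =
        \<i> * complex_of_real (LINT x|M. indicator (- ball 0 1) x * (T s x \<bullet> \<xi>))"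
      by (simp only: integral_mult_right_zero integral_complex_of_real)
    finally show ?thesis
      by (simp add: levy_exponent_def inner_commute[of _ b] inner_adjoint_blinfun algebra_simps)
  qed
  obtain K where K: "\<And>s. s \<in> {0..t} \<Longrightarrow> norm (T s) \<le> K"
    using C0_semigroup_locally_bounded[OF T, of t] by blast
  have driftL: "integrable L (\<lambda>s. T s b \<bullet> \<xi>)" for \<xi>
  proof (rule L.integrable_const_bound[of _ "K * norm b * norm \<xi>"])
    have "(\<lambda>s. Y (s, b)) \<in> borel_measurable L"
      using measurable_compose[OF measurable_Pair2'[of b M L] Ym[unfolded N_def]] by (simp add: spM)
    then show "(\<lambda>s. T s b \<bullet> \<xi>) \<in> borel_measurable L" by (simp add: Y_def)
    show "AE s in L. norm (T s b \<bullet> \<xi>) \<le> K * norm b * norm \<xi>"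
    proof (rule AE_I2)
      fix s assume "s \<in> space L"
      then have "norm (T s) \<le> K" by (intro K) (simp add: spL)
      then have "norm (T s b) \<le> K * norm b"
        by (rule order_trans[OF norm_blinfun mult_right_mono[OF _ norm_ge_zero]])
      then have "norm (T s b) * norm \<xi> \<le> K * norm b * norm \<xi>" by (rule mult_right_mono) simp
      then show "norm (T s b \<bullet> \<xi>) \<le> K * norm b * norm \<xi>"
        using Cauchy_Schwarz_ineq2[of "T s b" \<xi>] by simp
    qed
  qed
  \<comment> \<open>Time drift and mean of the large jumps, both taken weakly as functionals of
    \<open>\<xi>\<close>, so that all integrals are scalar.\<close>
  define \<beta> where "\<beta> = (\<lambda>\<xi>. (LINT s|L. T s b \<bullet> \<xi>) + (LINT p|N. ?tail \<xi> p))"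
  have lin: "linear \<beta>"
  proof (rule linearI)
    fix \<xi> \<eta> :: 'a and r :: real
    show "\<beta> (\<xi> + \<eta>) = \<beta> \<xi> + \<beta> \<eta>"
      using driftL tailN by (simp add: \<beta>_def inner_add_right distrib_left)
    have "(LINT p|N. ?tail (r *\<^sub>R \<xi>) p) = (LINT p|N. r * ?tail \<xi> p)"
      by (simp add: mult.left_commute)
    then show "\<beta> (r *\<^sub>R \<xi>) = r *\<^sub>R \<beta> \<xi>"
      by (simp add: \<beta>_def distrib_left)
  qed
  have char: "char_fun (\<mu> t) \<xi> = exp (\<i> * complex_of_real (\<beta> \<xi>) + (CLINT p|N. ?h \<xi> (Y p)))" for \<xi>
  proof -
    let ?b = "\<lambda>s. T s b \<bullet> \<xi> + (LINT x|M. indicator (- ball 0 1) x * (T s x \<bullet> \<xi>))"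
    have tL: "integrable L (\<lambda>s. LINT x|M. indicator (- ball 0 1) x * (T s x \<bullet> \<xi>))"
      and tI: "(LINT s|L. LINT x|M. indicator (- ball 0 1) x * (T s x \<bullet> \<xi>)) = (LINT p|N. ?tail \<xi> p)"
      using Q.integrable_fst'[OF tailN[of \<xi>, unfolded N_def]] Q.integral_fst'[OF tailN[of \<xi>, unfolded N_def]]
      by (simp_all add: Y_def N_def)
    have kL: "integrable L (\<lambda>s. CLINT x|M. ?h \<xi> (T s x))"
      and kI: "(CLINT s|L. CLINT x|M. ?h \<xi> (T s x)) = (CLINT p|N. ?h \<xi> (Y p))"
      using Q.integrable_fst'[OF hN[of \<xi>, unfolded N_def]] Q.integral_fst'[OF hN[of \<xi>, unfolded N_def]]
      by (simp_all add: Y_def N_def)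
    have ib: "integrable L (\<lambda>s. - \<i> * complex_of_real (?b s))"
      by (intro integrable_mult_right integrable_of_real Bochner_Integration.integrable_add driftL tL)
    have "(CLINT s:{0..t}|lborel. levy_exponent b M (adjoint (blinfun_apply (T s)) \<xi>)) =
        (CLINT s|L. levy_exponent b M (adjoint (blinfun_apply (T s)) \<xi>))"
      unfolding L_def by (rule integral_Icc_eq_restrict_space)
    also have "\<dots> = (CLINT s|L. - \<i> * complex_of_real (?b s) - (CLINT x|M. ?h \<xi> (T s x)))"
      by (rule Bochner_Integration.integral_cong[OF refl]) (rule exponent, simp add: spL)
    also have "\<dots> = (CLINT s|L. - \<i> * complex_of_real (?b s)) - (CLINT s|L. CLINT x|M. ?h \<xi> (T s x))"
      by (rule Bochner_Integration.integral_diff[OF ib kL])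
    also have "(CLINT s|L. - \<i> * complex_of_real (?b s)) = - \<i> * complex_of_real (LINT s|L. ?b s)"
      by (simp only: integral_mult_right_zero integral_complex_of_real)
    also have "(LINT s|L. ?b s) = \<beta> \<xi>"
      using driftL tL tI by (simp add: \<beta>_def)
    finally show ?thesis
      using mehler t by (simp add: mehler_measures_def kI add.commute)
  qed
  have "laplace_bounded l (LINT p|N. ?e (Y p)) (\<mu> t)"
    by (rule laplace_bounded_infinitely_divisible[OF Ym A Afin Ainc Acov int2 l ieN H \<mu> lin char])
  then show ?thesis
    using CN unfolding H1_def[symmetric] by (rule laplace_bounded_mono)
qed

section \<open>The invariant measure\<close>

text \<open>By invariance the integral of \<open>f\<close> under \<open>\<sigma>\<close> is the
  \<open>\<sigma>\<close>-mean of \<open>\<phi> n (T n x)\<close>, while its integral under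
  \<open>\<mu> n\<close> is \<open>\<phi> n 0\<close>. Every \<open>\<phi> n\<close> has the
  Lipschitz constant of \<open>f\<close>, so the two differ by at most the mean of a bounded
  quantity not exceeding \<open>L * norm (T n x)\<close>, which stability sends to 0.\<close>

lemma invariant_measure_limit:
  fixes T :: "real \<Rightarrow> 'a::{real_inner, banach, polish_space} \<Rightarrow>\<^sub>L 'a"
  assumes mehler: "mehler_measures T b M \<mu>" and inv: "invariant_measure (mehler T \<mu>) \<sigma>"
    and stable: "\<And>x. ((\<lambda>t. T t x) \<longlongrightarrow> 0) at_top"
    and f: "L-lipschitz_on UNIV f" and bdd: "bounded (range (f :: 'a \<Rightarrow> real))"
  shows "(\<lambda>n. LINT x|\<mu> (real n). f x) \<longlonglongrightarrow> (LINT x|\<sigma>. f x)"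
proof -
  obtain B where B: "\<And>x. \<bar>f x\<bar> \<le> B" using bdd by (auto simp: bounded_iff)
  have \<sigma>: "borel_prob \<sigma>" using inv by (simp add: invariant_measure_def borel_prob_def)
  interpret \<sigma>: prob_space \<sigma> using \<sigma> by (simp add: borel_prob_def)
  have [measurable_cong]: "sets \<sigma> = sets borel" using \<sigma> by (simp add: borel_prob_def)
  have \<mu>: "borel_prob (\<mu> (real n))" for n using mehler by (simp add: mehler_measures_def borel_prob_def)
  have fm [measurable]: "f \<in> borel_measurable borel" by (rule lipschitz_on_UNIV_measurable[OF f])
  define \<phi> where "\<phi> = (\<lambda>n z. LINT y|\<mu> (real n). f (z + y))"
  have \<phi>_lip: "L-lipschitz_on UNIV (\<phi> n)" and \<phi>_B: "\<bar>\<phi> n z\<bar> \<le> B" for n z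
    unfolding \<phi>_def by (rule translation_average[OF \<mu> f B])+
  have [measurable]: "\<phi> n \<in> borel_measurable borel" for n by (rule lipschitz_on_UNIV_measurable[OF \<phi>_lip])
  have inv': "(LINT x|\<sigma>. \<phi> n (T (real n) x)) = (LINT x|\<sigma>. f x)" for n
    using inv fm bdd unfolding invariant_measure_def mehler_def \<phi>_def by simp
  have int: "integrable \<sigma> (\<lambda>x. \<phi> n (T (real n) x))" for n
    using \<phi>_B by (intro borel_prob_integrable_bounded[OF \<sigma>]) (auto simp: bounded_iff)
  have "(\<lambda>n. LINT x|\<sigma>. \<phi> n (T (real n) x) - \<phi> n 0) \<longlonglongrightarrow> (LINT x|\<sigma>. 0)"
  proof (rule integral_dominated_convergence[where w = "\<lambda>_. 2 * B"])
    show "AE x in \<sigma>. (\<lambda>n. \<phi> n (T (real n) x) - \<phi> n 0) \<longlonglongrightarrow> 0"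
    proof (rule AE_I2)
      fix x
      have "(\<lambda>n. T (real n) x) \<longlonglongrightarrow> 0"
        by (rule filterlim_compose[OF stable filterlim_real_sequentially])
      then have "(\<lambda>n. L * norm (T (real n) x)) \<longlonglongrightarrow> L * norm (0::'a)" by (intro tendsto_intros)
      then have "(\<lambda>n. L * norm (T (real n) x)) \<longlonglongrightarrow> 0" by simp
      then show "(\<lambda>n. \<phi> n (T (real n) x) - \<phi> n 0) \<longlonglongrightarrow> 0"
      proof (rule Lim_null_comparison[rotated])
        show "eventually (\<lambda>n. norm (\<phi> n (T (real n) x) - \<phi> n 0) \<le> L * norm (T (real n) x)) sequentially"
        proof (intro always_eventually allI)
          fix n
          show "norm (\<phi> n (T (real n) x) - \<phi> n 0) \<le> L * norm (T (real n) x)"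
            using lipschitz_onD[OF \<phi>_lip[of n], of "T (real n) x" 0] by (simp add: dist_real_def)
        qed
      qed
    qed
    show "AE x in \<sigma>. norm (\<phi> n (T (real n) x) - \<phi> n 0) \<le> 2 * B" for n
    proof (rule AE_I2)
      fix x
      show "norm (\<phi> n (T (real n) x) - \<phi> n 0) \<le> 2 * B"
        using \<phi>_B[of n "T (real n) x"] \<phi>_B[of n 0] unfolding real_norm_def by linarith
    qed
  qed simp_all
  moreover have "(LINT x|\<sigma>. \<phi> n (T (real n) x) - \<phi> n 0) = (LINT x|\<sigma>. f x) - (LINT x|\<mu> (real n). f x)" for n
    using int[of n] inv'[of n] by (simp add: \<sigma>.prob_space \<phi>_def)
  ultimately have "(\<lambda>n. (LINT x|\<sigma>. f x) - (LINT x|\<mu> (real n). f x)) \<longlonglongrightarrow> 0" by simp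
  from tendsto_diff[OF tendsto_const[of "LINT x|\<sigma>. f x"] this] show ?thesis by simp
qed

lemma invariant_measure_laplace_bounded:
  fixes T :: "real \<Rightarrow> 'a::{real_inner, banach, polish_space} \<Rightarrow>\<^sub>L 'a"
  assumes mehler: "mehler_measures T b M \<mu>" and inv: "invariant_measure (mehler T \<mu>) \<sigma>"
    and stable: "\<And>x. ((\<lambda>t. T t x) \<longlongrightarrow> 0) at_top"
    and lb: "\<And>t. 0 < t \<Longrightarrow> laplace_bounded l C (\<mu> t)"
  shows "laplace_bounded l C \<sigma>"
  unfolding laplace_bounded_def
proof safe
  fix g :: "'a \<Rightarrow> real"
  assume g: "1-lipschitz_on UNIV g" and bdd: "bounded (range g)"
  obtain L where L: "L-lipschitz_on UNIV (\<lambda>x. exp (l * g x))"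
    using lipschitz_exp_bounded[OF g bdd] by blast
  note lim = invariant_measure_limit[OF mehler inv stable]
  show "(LINT x|\<sigma>. exp (l * g x)) \<le> exp (l * (LINT x|\<sigma>. g x) + C)"
  proof (rule LIMSEQ_le[OF lim[OF L bounded_exp_mult[OF bdd]]])
    show "(\<lambda>n. exp (l * (LINT x|\<mu> (real n). g x) + C)) \<longlonglongrightarrow> exp (l * (LINT x|\<sigma>. g x) + C)"
      by (intro tendsto_intros lim[OF g bdd])
    have "(LINT x|\<mu> (real n). exp (l * g x)) \<le> exp (l * (LINT x|\<mu> (real n). g x) + C)" if "1 \<le> n" for n
      using lb[of "real n"] that g bdd by (simp add: laplace_bounded_def)
    then show "\<exists>N. \<forall>n\<ge>N. (LINT x|\<mu> (real n). exp (l * g x)) \<le> exp (l * (LINT x|\<mu> (real n). g x) + C)"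
      by blast
  qed
qed

section \<open>From bounded to unbounded Lipschitz functions\<close>

lemma lipschitz_clamp:
  fixes g :: "'a::metric_space \<Rightarrow> real"
  assumes g: "1-lipschitz_on UNIV g"
  shows "1-lipschitz_on UNIV (\<lambda>x. max (- k) (min k (g x)))"
    and "1-lipschitz_on UNIV (\<lambda>x. min k \<bar>g x\<bar>)"
    and "1-lipschitz_on UNIV (\<lambda>x. - min k \<bar>g x\<bar>)"
proof -
  have d: "\<bar>g x - g y\<bar> \<le> dist x y" for x y
    using lipschitz_onD[OF g, of x y] by (simp add: dist_real_def)
  have "dist (max (- k) (min k (g x))) (max (- k) (min k (g y))) \<le> 1 * dist x y"
    "dist (min k \<bar>g x\<bar>) (min k \<bar>g y\<bar>) \<le> 1 * dist x y"
    "dist (- min k \<bar>g x\<bar>) (- min k \<bar>g y\<bar>) \<le> 1 * dist x y" for x y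
    using d[of x y] zero_le_dist[of x y] unfolding dist_real_def by linarith+
  then show "1-lipschitz_on UNIV (\<lambda>x. max (- k) (min k (g x)))"
    and "1-lipschitz_on UNIV (\<lambda>x. min k \<bar>g x\<bar>)"
    and "1-lipschitz_on UNIV (\<lambda>x. - min k \<bar>g x\<bar>)"
    by (auto intro!: lipschitz_onI)
qed

text \<open>
  The bounds for \<open>min k |g|\<close> and for \<open>- min k |g|\<close> together control the mean of \<open>min k |g|\<close>
  uniformly in \<open>k\<close>, which gives integrability of \<open>exp (l * |g|)\<close>.
\<close>

lemma laplace_bounded_integrable_exp_abs:
  fixes \<sigma> :: "'a::metric_space measure"
  assumes \<sigma>: "borel_prob \<sigma>" and l: "0 \<le> l" and lb: "laplace_bounded l C \<sigma>"
    and g: "1-lipschitz_on UNIV g"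
  shows "integrable \<sigma> (\<lambda>x. exp (l * \<bar>g x\<bar>))"
proof -
  interpret \<sigma>: prob_space \<sigma> using \<sigma> by (simp add: borel_prob_def)
  have [measurable_cong]: "sets \<sigma> = sets borel" using \<sigma> by (simp add: borel_prob_def)
  have [measurable]: "g \<in> borel_measurable borel" by (rule lipschitz_on_UNIV_measurable[OF g])
  define u where "u = (\<lambda>k x. min (real k) \<bar>g x\<bar>)"
  have u_bdd: "bounded (range (u k))" "bounded (range (\<lambda>x. - u k x))" for k
    by (auto simp: u_def bounded_iff intro!: exI[of _ "real k"])
  have [measurable]: "u k \<in> borel_measurable borel" for k unfolding u_def by measurable
  \<comment> \<open>A positive lower bound, the same for all \<open>k\<close>, for the integral of
    \<open>exp (- l * u k x)\<close>. The Laplace bound for \<open>- u k\<close> then yields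
    \<open>exp (l * ?m) \<le> exp C / \<delta>\<close>, so the means of \<open>u k\<close> cannot
    escape to infinity.\<close>
  define \<delta> where "\<delta> = (LINT x|\<sigma>. exp (- l * \<bar>g x\<bar>))"
  have i\<delta>: "integrable \<sigma> (\<lambda>x. exp (- l * \<bar>g x\<bar>))"
    using l by (intro \<sigma>.integrable_const_bound[of _ 1]) auto
  have "\<delta> \<noteq> 0"
  proof
    assume "\<delta> = 0"
    then have "AE x in \<sigma>. exp (- l * \<bar>g x\<bar>) = 0"
      using integral_nonneg_eq_0_iff_AE[OF i\<delta>] by (simp add: \<delta>_def)
    then have "AE x in \<sigma>. False" by simp
    then show False by simp
  qed
  moreover have "0 \<le> \<delta>" unfolding \<delta>_def by simp
  ultimately have \<delta>: "0 < \<delta>" by simp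
  have bound: "(LINT x|\<sigma>. exp (l * u k x)) \<le> exp (2 * C) / \<delta>" for k
  proof -
    let ?m = "LINT x|\<sigma>. u k x"
    have 1: "(LINT x|\<sigma>. exp (l * u k x)) \<le> exp (l * ?m + C)"
      using lb lipschitz_clamp(2)[OF g] u_bdd(1)[of k] by (simp add: laplace_bounded_def u_def)
    have "\<delta> \<le> (LINT x|\<sigma>. exp (l * - u k x))"
      unfolding \<delta>_def
    proof (rule integral_mono[OF i\<delta>])
      show "integrable \<sigma> (\<lambda>x. exp (l * - u k x))"
        by (rule borel_prob_integrable_bounded[OF \<sigma> _ bounded_exp_mult[OF u_bdd(2)]]) measurable
      show "exp (- l * \<bar>g x\<bar>) \<le> exp (l * - u k x)" for x
        using l by (simp add: u_def mult_left_mono)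
    qed
    also have "\<dots> \<le> exp (l * (LINT x|\<sigma>. - u k x) + C)"
      using lb lipschitz_clamp(3)[OF g] u_bdd(2)[of k] unfolding laplace_bounded_def u_def by blast
    finally have "\<delta> \<le> exp (- l * ?m + C)" by simp
    then have "exp (l * ?m + C) * \<delta> \<le> exp (l * ?m + C) * exp (- l * ?m + C)"
      by (rule mult_left_mono) simp
    also have "\<dots> = exp (2 * C)" by (simp flip: exp_add)
    finally have "exp (l * ?m + C) \<le> exp (2 * C) / \<delta>" using \<delta> by (simp add: field_simps)
    with 1 show ?thesis by simp
  qed
  have "(\<integral>\<^sup>+x. ennreal (exp (l * \<bar>g x\<bar>)) \<partial>\<sigma>) \<le> (\<integral>\<^sup>+x. liminf (\<lambda>k. ennreal (exp (l * u k x))) \<partial>\<sigma>)"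
  proof (rule nn_integral_mono)
    fix x
    obtain k0 :: nat where "\<bar>g x\<bar> \<le> real k0" using real_arch_simple by blast
    then have "\<And>k. k0 \<le> k \<Longrightarrow> exp (l * u k x) = exp (l * \<bar>g x\<bar>)" by (auto simp: u_def min_def)
    then have "eventually (\<lambda>k. ennreal (exp (l * u k x)) = ennreal (exp (l * \<bar>g x\<bar>))) sequentially"
      by (auto simp: eventually_sequentially intro!: exI[of _ k0])
    then show "ennreal (exp (l * \<bar>g x\<bar>)) \<le> liminf (\<lambda>k. ennreal (exp (l * u k x)))"
      by (intro Liminf_bounded) (auto elim!: eventually_mono)
  qed
  also have "\<dots> \<le> liminf (\<lambda>k. \<integral>\<^sup>+x. ennreal (exp (l * u k x)) \<partial>\<sigma>)"
    by (rule nn_integral_liminf) measurable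
  also have "\<dots> \<le> liminf (\<lambda>k. ennreal (exp (2 * C) / \<delta>))"
  proof (rule Liminf_mono, rule always_eventually, rule allI)
    fix k
    have "integrable \<sigma> (\<lambda>x. exp (l * u k x))"
      by (rule borel_prob_integrable_bounded[OF \<sigma> _ bounded_exp_mult[OF u_bdd(1)]]) measurable
    then show "(\<integral>\<^sup>+x. ennreal (exp (l * u k x)) \<partial>\<sigma>) \<le> ennreal (exp (2 * C) / \<delta>)"
      using bound[of k] by (subst nn_integral_eq_integral) (auto intro!: ennreal_leI)
  qed
  also have "\<dots> < \<infinity>" by (simp add: Liminf_const)
  finally show ?thesis by (intro integrableI_nonneg) auto
qed

text \<open>Clamping to \<open>[- k, k]\<close> keeps the Lipschitz constant, and
  \<open>exp (l * |g|)\<close> yields a common majorant for both sides, since it also dominates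
  \<open>l * |g|\<close>.\<close>

lemma laplace_bounded_unbounded:
  fixes \<sigma> :: "'a::metric_space measure"
  assumes \<sigma>: "borel_prob \<sigma>" and l: "0 < l" and lb: "laplace_bounded l C \<sigma>"
    and g: "1-lipschitz_on UNIV g"
  shows "integrable \<sigma> g" and "integrable \<sigma> (\<lambda>x. exp (l * g x))"
    and "(LINT x|\<sigma>. exp (l * g x)) \<le> exp (l * (LINT x|\<sigma>. g x) + C)"
proof -
  interpret \<sigma>: prob_space \<sigma> using \<sigma> by (simp add: borel_prob_def)
  have [measurable_cong]: "sets \<sigma> = sets borel" using \<sigma> by (simp add: borel_prob_def)
  have [measurable]: "g \<in> borel_measurable borel" by (rule lipschitz_on_UNIV_measurable[OF g])
  have ie: "integrable \<sigma> (\<lambda>x. exp (l * \<bar>g x\<bar>))"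
    by (rule laplace_bounded_integrable_exp_abs[OF \<sigma> _ lb g]) (use l in simp)
  have abs_le: "\<bar>g x\<bar> \<le> exp (l * \<bar>g x\<bar>) / l" for x
  proof -
    have "l * \<bar>g x\<bar> \<le> exp (l * \<bar>g x\<bar>)"
      using exp_ge_add_one_self[of "l * \<bar>g x\<bar>"] by linarith
    then show ?thesis using l by (simp add: pos_le_divide_eq mult.commute)
  qed
  have iw: "integrable \<sigma> (\<lambda>x. exp (l * \<bar>g x\<bar>) / l)" using ie by simp
  show "integrable \<sigma> g"
    by (rule Bochner_Integration.integrable_bound[OF iw]) (use abs_le l in \<open>auto simp: abs_of_pos\<close>)
  show "integrable \<sigma> (\<lambda>x. exp (l * g x))"
    by (rule Bochner_Integration.integrable_bound[OF ie]) (use l in \<open>auto intro!: AE_I2 mult_left_mono\<close>)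
  define v where "v = (\<lambda>k::nat. \<lambda>x. max (- real k) (min (real k) (g x)))"
  have v_abs: "\<bar>v k x\<bar> \<le> \<bar>g x\<bar>" for k x by (auto simp: v_def)
  have [measurable]: "v k \<in> borel_measurable borel" for k unfolding v_def by measurable
  have v_lim: "(\<lambda>k. v k x) \<longlonglongrightarrow> g x" for x
  proof (rule tendsto_eventually)
    obtain k0 :: nat where "\<bar>g x\<bar> \<le> real k0" using real_arch_simple by blast
    then have "\<And>k. k0 \<le> k \<Longrightarrow> v k x = g x" by (auto simp: v_def min_def max_def)
    then show "eventually (\<lambda>k. v k x = g x) sequentially"
      by (auto simp: eventually_sequentially)
  qed
  have L1: "(\<lambda>k. LINT x|\<sigma>. exp (l * v k x)) \<longlonglongrightarrow> (LINT x|\<sigma>. exp (l * g x))"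
  proof (rule integral_dominated_convergence[OF _ _ ie])
    show "AE x in \<sigma>. (\<lambda>k. exp (l * v k x)) \<longlonglongrightarrow> exp (l * g x)"
      by (intro AE_I2 tendsto_intros v_lim)
    show "AE x in \<sigma>. norm (exp (l * v k x)) \<le> exp (l * \<bar>g x\<bar>)" for k
    proof (rule AE_I2)
      fix x
      have "v k x \<le> \<bar>g x\<bar>" using v_abs[of k x] by linarith
      then show "norm (exp (l * v k x)) \<le> exp (l * \<bar>g x\<bar>)" using l by simp
    qed
  qed measurable
  have L2: "(\<lambda>k. LINT x|\<sigma>. v k x) \<longlonglongrightarrow> (LINT x|\<sigma>. g x)"
  proof (rule integral_dominated_convergence[OF _ _ iw])
    show "AE x in \<sigma>. (\<lambda>k. v k x) \<longlonglongrightarrow> g x" by (intro AE_I2 v_lim)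
    show "AE x in \<sigma>. norm (v k x) \<le> exp (l * \<bar>g x\<bar>) / l" for k
    proof (rule AE_I2)
      fix x
      show "norm (v k x) \<le> exp (l * \<bar>g x\<bar>) / l" using v_abs[of k x] abs_le[of x] by simp
    qed
  qed measurable
  show "(LINT x|\<sigma>. exp (l * g x)) \<le> exp (l * (LINT x|\<sigma>. g x) + C)"
  proof (rule LIMSEQ_le[OF L1])
    show "(\<lambda>k. exp (l * (LINT x|\<sigma>. v k x) + C)) \<longlonglongrightarrow> exp (l * (LINT x|\<sigma>. g x) + C)"
      by (intro tendsto_intros L2)
    have "bounded (range (v k))" for k by (auto simp: v_def bounded_iff intro!: exI[of _ "real k"])
    then have "(LINT x|\<sigma>. exp (l * v k x)) \<le> exp (l * (LINT x|\<sigma>. v k x) + C)" for k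
      using lb lipschitz_clamp(1)[OF g, of "real k"] by (simp add: laplace_bounded_def v_def)
    then show "\<exists>N. \<forall>k\<ge>N. (LINT x|\<sigma>. exp (l * v k x)) \<le> exp (l * (LINT x|\<sigma>. v k x) + C)" by blast
  qed
qed

lemma laplace_bounded_deviation:
  fixes \<sigma> :: "'a::metric_space measure"
  assumes \<sigma>: "borel_prob \<sigma>" and l: "0 < l" and lb: "laplace_bounded l C \<sigma>"
    and g: "1-lipschitz_on UNIV g"
  shows "measure \<sigma> {x. g x \<ge> (LINT y|\<sigma>. g y) + t} \<le> exp (C - l * t)"
proof -
  interpret \<sigma>: prob_space \<sigma> using \<sigma> by (simp add: borel_prob_def)
  have [measurable_cong]: "sets \<sigma> = sets borel" using \<sigma> by (simp add: borel_prob_def)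
  have [measurable]: "g \<in> borel_measurable borel" by (rule lipschitz_on_UNIV_measurable[OF g])
  let ?m = "LINT y|\<sigma>. g y"
  let ?S = "{x. g x \<ge> ?m + t}"
  note U = laplace_bounded_unbounded[OF \<sigma> l lb g]
  have S: "?S \<in> sets \<sigma>" by measurable
  have "measure \<sigma> ?S = (LINT x|\<sigma>. indicator ?S x)"
    using S by simp
  also have "\<dots> \<le> (LINT x|\<sigma>. exp (- l * (?m + t)) * exp (l * g x))"
  proof (rule integral_mono)
    show "integrable \<sigma> (\<lambda>x. exp (- l * (?m + t)) * exp (l * g x))" using U(2) by simp
    show "indicator ?S x \<le> exp (- l * (?m + t)) * exp (l * g x)" for x
      using mult_left_mono[of "?m + t" "g x" l] l
      by (auto split: split_indicator simp flip: exp_add)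
    show "integrable \<sigma> (indicator ?S :: 'a \<Rightarrow> real)"
      by (rule integrable_real_indicator[OF S]) (simp add: \<sigma>.emeasure_finite less_top[symmetric])
  qed
  also have "\<dots> \<le> exp (- l * (?m + t)) * exp (l * ?m + C)"
    using U(3) by simp
  also have "\<dots> = exp (C - l * t)" by (simp flip: exp_add add: algebra_simps)
  finally show ?thesis .
qed

section \<open>The tail moment function\<close>

lemma exp_minus_one_le: "exp a - 1 \<le> a * exp (a::real)"
proof -
  have "exp a * (1 - a) \<le> exp a * exp (- a)"
    using exp_ge_add_one_self[of "- a"] by (intro mult_left_mono) auto
  then show ?thesis by (simp add: algebra_simps flip: exp_add)
qed

locale exp_moment_measure =
  fixes M :: "'a::real_normed_vector measure"
  assumes levy: "levy_measure M"
    and exp_moment: "\<And>s. 0 < s \<Longrightarrow> (\<integral>\<^sup>+y. ennreal ((norm y)\<^sup>2 * exp (s * norm y)) \<partial>M) < \<infinity>"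
begin

lemma sets_M [measurable_cong]: "sets M = sets borel"
  using levy by (simp add: levy_measure_def)

lemma integrable_moment:
  assumes "0 < s"
  shows "integrable M (\<lambda>y. (norm y)\<^sup>2 * exp (s * norm y))"
  by (rule integrableI_nonneg) (use exp_moment[OF assms] in auto)

lemma integrable_second_moment: "integrable M (\<lambda>y. (norm y)\<^sup>2)"
proof (rule Bochner_Integration.integrable_bound[OF integrable_moment[of 1]])
  show "AE y in M. norm ((norm y)\<^sup>2) \<le> norm ((norm y)\<^sup>2 * exp (1 * norm y))"
  proof (rule AE_I2)
    fix y :: 'a
    show "norm ((norm y)\<^sup>2) \<le> norm ((norm y)\<^sup>2 * exp (1 * norm y))"
      using mult_left_mono[of 1 "exp (norm y)" "(norm y)\<^sup>2"] by simp
  qed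
qed simp_all

abbreviation "tail_integrand s y \<equiv> indicator (- ball 0 1) y *\<^sub>R (norm y * exp (s * norm y)) :: real"

lemma tail_exp_moment_eq: "tail_exp_moment M s = (LINT y|M. tail_integrand s y)"
  by (simp add: tail_exp_moment_def set_lebesgue_integral_def)

text \<open>Outside the unit ball \<open>norm y \<le> (norm y)\<^sup>2\<close>, so the second
  exponential moment is a majorant, uniform over exponents up to \<open>s'\<close>.\<close>

lemma tail_integrand_le:
  assumes "s \<le> s'"
  shows "norm (tail_integrand s y) \<le> (norm y)\<^sup>2 * exp (s' * norm y)"
proof (cases "y \<in> ball 0 1")
  case False
  have "norm y * exp (s * norm y) \<le> (norm y * norm y) * exp (s' * norm y)"
    using assms False mult_left_mono[of 1 "norm y" "norm y"]
    by (intro mult_mono) (auto intro: mult_right_mono)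
  then show ?thesis using False by (simp add: power2_eq_square)
qed simp

lemma integrable_tail: "integrable M (tail_integrand s)"
proof (rule Bochner_Integration.integrable_bound[OF integrable_moment[of "max 1 s"]])
  show "AE y in M. norm (tail_integrand s y) \<le> norm ((norm y)\<^sup>2 * exp (max 1 s * norm y))"
  proof (rule AE_I2)
    fix y :: 'a
    show "norm (tail_integrand s y) \<le> norm ((norm y)\<^sup>2 * exp (max 1 s * norm y))"
      using tail_integrand_le[of s "max 1 s" y] by simp
  qed
qed simp_all

text \<open>Zero belongs to the interval so that the right limit in \<open>ext_inverse\<close>
  becomes the value at 0.\<close>

lemma continuous_on_tail_exp_moment: "continuous_on {0..} (tail_exp_moment M)"
  unfolding continuous_on_sequentially comp_def tail_exp_moment_eq
proof safe
  fix X :: "nat \<Rightarrow> real" and s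
  assume X: "\<forall>n. X n \<in> {0..}" and lim: "X \<longlonglongrightarrow> s"
  obtain K where K: "\<And>n. \<bar>X n\<bar> \<le> K"
    using convergent_imp_bounded[OF lim] by (auto simp: bounded_iff)
  show "(\<lambda>n. LINT y|M. tail_integrand (X n) y) \<longlonglongrightarrow> (LINT y|M. tail_integrand s y)"
  proof (rule integral_dominated_convergence[OF _ _ integrable_moment[of "max 1 K"]])
    show "AE y in M. (\<lambda>n. tail_integrand (X n) y) \<longlonglongrightarrow> tail_integrand s y"
      by (intro AE_I2 tendsto_intros lim)
    show "AE y in M. norm (tail_integrand (X n) y) \<le> (norm y)\<^sup>2 * exp (max 1 K * norm y)" for n
    proof (rule AE_I2, rule tail_integrand_le)
      show "X n \<le> max 1 K" using K[of n] by linarith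
    qed
  qed simp_all
qed

text \<open>On the domain of integration \<open>norm y \<ge> 1\<close>, hence
  \<open>exp (d * norm y) \<ge> exp d\<close>. With positivity, this one inequality yields strict
  monotonicity, divergence, and the logarithmic control of the inverse.\<close>

lemma tail_exp_moment_add:
  assumes d: "0 \<le> d"
  shows "exp d * tail_exp_moment M s \<le> tail_exp_moment M (s + d)"
proof -
  have "exp d * tail_exp_moment M s = (LINT y|M. exp d * tail_integrand s y)"
    by (simp add: tail_exp_moment_eq)
  also have "\<dots> \<le> (LINT y|M. tail_integrand (s + d) y)"
  proof (rule integral_mono[OF integrable_mult_right[OF integrable_tail] integrable_tail])
    fix y
    show "exp d * tail_integrand s y \<le> tail_integrand (s + d) y"
    proof (cases "y \<in> ball 0 1")
      case False
      have "exp d * exp (s * norm y) \<le> exp ((s + d) * norm y)"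
        using d False mult_left_mono[of 1 "norm y" d] by (simp add: algebra_simps flip: exp_add)
      then have "norm y * (exp d * exp (s * norm y)) \<le> norm y * exp ((s + d) * norm y)"
        by (rule mult_left_mono) simp
      then show ?thesis using False by (simp add: mult_ac)
    qed simp
  qed
  finally show ?thesis by (simp add: tail_exp_moment_eq)
qed

lemma tail_exp_moment_nonneg: "0 \<le> tail_exp_moment M s"
  unfolding tail_exp_moment_eq by (intro integral_nonneg_AE AE_I2) simp

text \<open>Positivity does not depend on the exponent: it says that \<open>M\<close> charges the
  complement of the unit ball. The growth hypothesis provides it at \<open>s0\<close>.\<close>

lemma tail_exp_moment_pos:
  assumes "0 < tail_exp_moment M s"
  shows "0 < tail_exp_moment M r"
proof (rule ccontr)
  assume "\<not> ?thesis"
  then have "tail_exp_moment M r = 0"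
    using tail_exp_moment_nonneg[of r] by linarith
  then have "(LINT y|M. tail_integrand r y) = 0"
    by (simp only: tail_exp_moment_eq)
  then have "AE y in M. tail_integrand r y = 0"
    using integral_nonneg_eq_0_iff_AE[OF integrable_tail[of r]] by simp
  then have "AE y in M. tail_integrand s y = 0"
    by (rule eventually_mono) auto
  then have "tail_exp_moment M s = 0"
    unfolding tail_exp_moment_eq by (rule integral_eq_zero_AE)
  then show False using assms by simp
qed

text \<open>Quadratic behaviour for small \<open>l\<close>: the source of the Gaussian
  regime.\<close>

lemma exp_remainder_small:
  assumes "0 \<le> l" "l \<le> 1"
  shows "(LINT x|M. exp (l * norm x) - 1 - l * norm x) \<le> l\<^sup>2 * (LINT x|M. (norm x)\<^sup>2 * exp (norm x))"
proof -
  have "(LINT x|M. exp (l * norm x) - 1 - l * norm x) \<le> (LINT x|M. l\<^sup>2 * ((norm x)\<^sup>2 * exp (norm x)))"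
  proof (rule integral_mono)
    show "integrable M (\<lambda>x. exp (l * norm x) - 1 - l * norm x)"
      by (rule integrable_exp_remainder[OF sets_M assms(1) exp_moment])
    show "integrable M (\<lambda>x. l\<^sup>2 * ((norm x)\<^sup>2 * exp (norm x)))"
      using integrable_moment[of 1] by simp
    fix x :: 'a
    have "exp (l * norm x) - 1 - l * norm x \<le> (l * norm x)\<^sup>2 * exp (l * norm x)"
      using assms by (intro exp_remainder_le) simp
    also have "\<dots> \<le> (l * norm x)\<^sup>2 * exp (norm x)"
      using assms mult_right_mono[of l 1 "norm x"] by (intro mult_left_mono) auto
    finally show "exp (l * norm x) - 1 - l * norm x \<le> l\<^sup>2 * ((norm x)\<^sup>2 * exp (norm x))"
      by (simp add: power_mult_distrib)
  qed
  then show ?thesis by simp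
qed

text \<open>Inside the unit ball the remainder is quadratic. Outside, the first-order estimate
  \<open>a * exp a\<close> is used, because it matches the weight \<open>norm y\<close> in
  \<open>tail_exp_moment\<close> exactly.\<close>

lemma exp_remainder_large:
  assumes l: "0 \<le> l"
  shows "(LINT x|M. exp (l * norm x) - 1 - l * norm x) \<le>
    l\<^sup>2 * exp l * (LINT x|M. (norm x)\<^sup>2) + l * tail_exp_moment M l"
proof -
  have "(LINT x|M. exp (l * norm x) - 1 - l * norm x) \<le>
      (LINT x|M. l\<^sup>2 * exp l * (norm x)\<^sup>2 + l * tail_integrand l x)"
  proof (rule integral_mono)
    show "integrable M (\<lambda>x. exp (l * norm x) - 1 - l * norm x)"
      by (rule integrable_exp_remainder[OF sets_M l exp_moment])
    show "integrable M (\<lambda>x. l\<^sup>2 * exp l * (norm x)\<^sup>2 + l * tail_integrand l x)"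
      by (intro Bochner_Integration.integrable_add integrable_mult_right integrable_second_moment integrable_tail)
    fix x :: 'a
    show "exp (l * norm x) - 1 - l * norm x \<le> l\<^sup>2 * exp l * (norm x)\<^sup>2 + l * tail_integrand l x"
    proof (cases "x \<in> ball 0 1")
      case True
      have "exp (l * norm x) - 1 - l * norm x \<le> (l * norm x)\<^sup>2 * exp (l * norm x)"
        using l by (intro exp_remainder_le) simp
      also have "\<dots> \<le> (l * norm x)\<^sup>2 * exp l"
        using l True mult_left_mono[of "norm x" 1 l] by (intro mult_left_mono) auto
      finally show ?thesis using True by (simp add: power_mult_distrib mult_ac)
    next
      case False
      have "exp (l * norm x) - 1 - l * norm x \<le> l * norm x * exp (l * norm x)"
        using exp_minus_one_le[of "l * norm x"] mult_nonneg_nonneg[OF l norm_ge_zero[of x]] by linarith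
      moreover have "0 \<le> l\<^sup>2 * exp l * (norm x)\<^sup>2" by simp
      moreover have "l * tail_integrand l x = l * norm x * exp (l * norm x)" using False by simp
      ultimately show ?thesis by linarith
    qed
  qed
  also have "\<dots> = l\<^sup>2 * exp l * (LINT x|M. (norm x)\<^sup>2) + l * tail_exp_moment M l"
    using integrable_tail integrable_second_moment by (simp add: tail_exp_moment_eq)
  finally show ?thesis .
qed

end

section \<open>Inverse of a function of at least exponential growth\<close>

locale exp_growth =
  fixes \<psi> :: "real \<Rightarrow> real"
  assumes cont: "continuous_on {0..} \<psi>"
    and add: "\<And>s d. 0 \<le> d \<Longrightarrow> exp d * \<psi> s \<le> \<psi> (s + d)"
    and pos: "\<And>s. 0 < \<psi> s"
begin

lemma strict: "s < s' \<Longrightarrow> \<psi> s < \<psi> s'"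
proof -
  assume "s < s'"
  then have "1 * \<psi> s < exp (s' - s) * \<psi> s" using pos[of s] by (intro mult_strict_right_mono) auto
  also have "\<dots> \<le> \<psi> s'" using add[of "s' - s" s] \<open>s < s'\<close> by simp
  finally show "\<psi> s < \<psi> s'" by simp
qed

lemma le_iff: "\<psi> s \<le> \<psi> s' \<longleftrightarrow> s \<le> s'"
  using strict[of s s'] strict[of s' s] by (cases s s' rule: linorder_cases) auto

lemma right_limit: "Lim (at_right 0) \<psi> = \<psi> 0"
proof (rule tendsto_Lim)
  have "(\<psi> \<longlongrightarrow> \<psi> 0) (at 0 within {0..})" using cont by (simp add: continuous_on_def)
  then show "(\<psi> \<longlongrightarrow> \<psi> 0) (at_right 0)" by (rule tendsto_within_subset) auto
qed simp

lemma ext_inverse_eq_0: "r \<le> \<psi> 0 \<Longrightarrow> ext_inverse \<psi> r = 0"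
  by (simp add: ext_inverse_def right_limit)

lemma ext_inverse:
  assumes r: "\<psi> 0 < r"
  shows "0 < ext_inverse \<psi> r" and "\<psi> (ext_inverse \<psi> r) = r"
proof -
  \<comment> \<open>\<open>exp S * \<psi> 0\<close> reaches \<open>r\<close>, so the intermediate
    value theorem applies on \<open>{0..S}\<close>.\<close>
  define S where "S = max 0 (ln (r / \<psi> 0))"
  have S0: "0 \<le> S" by (simp add: S_def)
  have "r / \<psi> 0 \<le> exp S"
    using r pos[of 0] by (simp add: S_def max_def)
  then have "r \<le> exp S * \<psi> 0" using pos[of 0] by (simp add: field_simps)
  also have "\<dots> \<le> \<psi> S" using add[of S 0] by (simp add: S_def)
  finally have "r \<le> \<psi> S" .
  moreover have "continuous_on {0..S} \<psi>" by (rule continuous_on_subset[OF cont]) auto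
  ultimately obtain s where s: "0 \<le> s" "\<psi> s = r"
    using IVT'[of \<psi> 0 r S] r by (auto simp: S0)
  have "s \<noteq> 0" using s r by auto
  have inj: "inj_on \<psi> {0<..}" by (rule inj_onI) (metis le_iff order_antisym order_refl)
  have "ext_inverse \<psi> r = the_inv_into {0<..} \<psi> r"
    using r by (simp add: ext_inverse_def right_limit)
  also have "\<dots> = s"
    using the_inv_into_f_f[OF inj, of s] s \<open>s \<noteq> 0\<close> by simp
  finally show "0 < ext_inverse \<psi> r" and "\<psi> (ext_inverse \<psi> r) = r"
    using s \<open>s \<noteq> 0\<close> by auto
qed

lemma ext_inverse_nonneg: "0 \<le> ext_inverse \<psi> r"
  using ext_inverse(1)[of r] ext_inverse_eq_0[of r] by (cases "r \<le> \<psi> 0") auto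

lemma ext_inverse_mono:
  assumes "r \<le> r'"
  shows "ext_inverse \<psi> r \<le> ext_inverse \<psi> r'"
proof (cases "r \<le> \<psi> 0")
  case True
  then show ?thesis using ext_inverse_nonneg by (simp add: ext_inverse_eq_0)
next
  case False
  then have "\<psi> (ext_inverse \<psi> r) \<le> \<psi> (ext_inverse \<psi> r')"
    using assms ext_inverse(2)[of r] ext_inverse(2)[of r'] by simp
  then show ?thesis by (simp add: le_iff)
qed

lemma ext_inverse_ge:
  assumes "0 < s" "\<psi> s \<le> r"
  shows "s \<le> ext_inverse \<psi> r"
proof -
  have "\<psi> 0 < r" using strict[OF assms(1)] assms(2) by simp
  then show ?thesis using ext_inverse(2)[of r] assms(2) le_iff[of s "ext_inverse \<psi> r"] by simp
qed

lemma ext_inverse_mult: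
  assumes K: "1 \<le> K" and r: "\<psi> 0 < r"
  shows "ext_inverse \<psi> (K * r) \<le> ext_inverse \<psi> r + ln K"
proof -
  have "1 * r \<le> K * r" using K r pos[of 0] by (intro mult_right_mono) auto
  then have "\<psi> 0 < K * r" using r by simp
  then have "\<psi> (ext_inverse \<psi> (K * r)) = exp (ln K) * \<psi> (ext_inverse \<psi> r)"
    using K r by (simp add: ext_inverse(2))
  also have "\<dots> \<le> \<psi> (ext_inverse \<psi> r + ln K)" using K by (intro add) simp
  finally show ?thesis by (simp add: le_iff)
qed

end

section \<open>Concentration\<close>

text \<open>If \<open>g x\<close> lies between \<open>m + j\<close> and \<open>m + j + 1\<close>,
  then \<open>g x \<le> 2 * j\<close> for large \<open>j\<close>, and the inverse at
  \<open>2 * j\<close> exceeds the one at \<open>c2 * j\<close> by at most the constant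
  \<open>D = ln (2 / c2)\<close>, hence is at most twice as large. With
  \<open>c \<le> 1 / 32\<close> the exponent is at most half the decay rate of the tail, and what is
  left of the decay is dominated by a geometric series.\<close>

lemma (in exp_growth) exp_integrable_of_tail:
  fixes g :: "'x::topological_space \<Rightarrow> real"
  assumes \<sigma>: "borel_prob \<sigma>" and g [measurable]: "g \<in> borel_measurable borel"
    and c2: "0 < c2" "c2 \<le> 1" and c: "0 < c" "c \<le> 1 / 32"
    and tail: "\<And>t. t0 \<le> t \<Longrightarrow> measure \<sigma> {x. g x \<ge> m + t} \<le> exp (- (1 / 4) * t * ext_inverse \<psi> (c2 * t))"
  shows "(\<integral>\<^sup>+x. ennreal (exp (c * g x * ext_inverse \<psi> \<bar>g x\<bar>)) \<partial>\<sigma>) < \<infinity>"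
proof -
  interpret \<sigma>: prob_space \<sigma> using \<sigma> by (simp add: borel_prob_def)
  have [measurable_cong]: "sets \<sigma> = sets borel" using \<sigma> by (simp add: borel_prob_def)
  let ?\<rho> = "ext_inverse \<psi>"
  define D where "D = ln (2 / c2)"
  have D: "0 \<le> D" using c2 by (simp add: D_def)
  \<comment> \<open>From \<open>j0\<close> on the tail bound is available,
    \<open>m + 1 \<le> j\<close> gives \<open>g x \<le> 2 * j\<close>, and the inverse at
    \<open>c2 * j\<close> is at least \<open>D\<close> and at least 1.\<close>
  obtain j0 :: nat where j0: "max (max t0 (\<bar>m\<bar> + 1)) (\<psi> (max 1 D) / c2) \<le> real j0"
    using real_arch_simple by blast
  have jD: "max 1 D \<le> ?\<rho> (c2 * real j)" "\<psi> 0 < c2 * real j" if j: "j0 \<le> j" for j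
  proof -
    have "real j0 \<le> real j" using j by simp
    then have "\<psi> (max 1 D) / c2 \<le> real j" using j0 by simp
    then have le: "\<psi> (max 1 D) \<le> c2 * real j" using c2 by (simp add: field_simps)
    then show "max 1 D \<le> ?\<rho> (c2 * real j)" by (intro ext_inverse_ge) auto
    show "\<psi> 0 < c2 * real j" using le strict[of 0 "max 1 D"] by linarith
  qed
  define a where "a = (\<lambda>j. exp ((1 / 8) * real j * ?\<rho> (c2 * real j)))"
  \<comment> \<open>Superlevel sets instead of shells: the series has to dominate through a single
    index only, and their measures are exactly what the tail hypothesis bounds.\<close>
  define S where "S = (\<lambda>j. {x. g x \<ge> m + real (j + j0)})"
  define K where "K = exp (c * (\<bar>m\<bar> + real j0) * ?\<rho> (\<bar>m\<bar> + real j0))"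
  have S [measurable]: "S j \<in> sets \<sigma>" for j unfolding S_def by measurable
  have pt: "ennreal (exp (c * g x * ?\<rho> \<bar>g x\<bar>)) \<le> ennreal (1 + K) + (\<Sum>j. ennreal (a (j + j0)) * indicator (S j) x)" for x
  proof (cases "g x \<le> 0")
    case True
    then have "c * g x * ?\<rho> \<bar>g x\<bar> \<le> 0"
      using c ext_inverse_nonneg by (simp add: mult_nonpos_nonneg mult_nonneg_nonpos)
    then have "exp (c * g x * ?\<rho> \<bar>g x\<bar>) \<le> 1 + K" by (simp add: K_def add_increasing2)
    then show ?thesis by (simp add: ennreal_leI add_increasing2)
  next
    case pos: False
    show ?thesis
    proof (cases "g x < m + real j0")
      case True
      have "g x * ?\<rho> \<bar>g x\<bar> \<le> (\<bar>m\<bar> + real j0) * ?\<rho> (\<bar>m\<bar> + real j0)"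
        using pos True by (intro mult_mono ext_inverse_mono ext_inverse_nonneg) auto
      then have "c * (g x * ?\<rho> \<bar>g x\<bar>) \<le> c * ((\<bar>m\<bar> + real j0) * ?\<rho> (\<bar>m\<bar> + real j0))"
        using c by (intro mult_left_mono) auto
      then have "exp (c * g x * ?\<rho> \<bar>g x\<bar>) \<le> 1 + K" by (simp add: K_def mult.assoc add_increasing)
      then show ?thesis by (simp add: ennreal_leI add_increasing2)
    next
      case False
      define i where "i = nat \<lfloor>g x - m - real j0\<rfloor>"
      define j where "j = i + j0"
      have i: "real i \<le> g x - m - real j0" "g x - m - real j0 < real i + 1"
        using False unfolding i_def by (simp_all add: of_nat_nat)
      have xS: "x \<in> S i" using i(1) by (simp add: S_def)
      have jj: "j0 \<le> j" by (simp add: j_def)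
      have "\<bar>m\<bar> + 1 \<le> real j0" using j0 by simp
      then have "m + 1 \<le> real j0" by linarith
      then have "g x \<le> 2 * real j" using i(2) by (simp add: j_def)
      have rj: "max 1 D \<le> ?\<rho> (c2 * real j)" "\<psi> 0 < c2 * real j" using jD[OF jj] by auto
      have "?\<rho> \<bar>g x\<bar> \<le> ?\<rho> ((2 / c2) * (c2 * real j))"
        using pos \<open>g x \<le> 2 * real j\<close> c2 by (intro ext_inverse_mono) simp
      also have "\<dots> \<le> ?\<rho> (c2 * real j) + D"
        unfolding D_def using c2 rj by (intro ext_inverse_mult) auto
      also have "\<dots> \<le> 2 * ?\<rho> (c2 * real j)" using rj by simp
      finally have "g x * ?\<rho> \<bar>g x\<bar> \<le> (2 * real j) * (2 * ?\<rho> (c2 * real j))"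
        using pos \<open>g x \<le> 2 * real j\<close> ext_inverse_nonneg by (intro mult_mono) auto
      then have "c * (g x * ?\<rho> \<bar>g x\<bar>) \<le> (1 / 32) * ((2 * real j) * (2 * ?\<rho> (c2 * real j)))"
        by (rule mult_mono[OF c(2)]) (use pos ext_inverse_nonneg in auto)
      then have "exp (c * g x * ?\<rho> \<bar>g x\<bar>) \<le> a j" by (simp add: a_def mult.assoc)
      then have "ennreal (exp (c * g x * ?\<rho> \<bar>g x\<bar>)) \<le> ennreal (a (i + j0)) * indicator (S i) x"
        using xS by (simp add: j_def ennreal_leI)
      also have "\<dots> \<le> (\<Sum>j. ennreal (a (j + j0)) * indicator (S j) x)"
      proof -
        define F where "F = (\<lambda>j. ennreal (a (j + j0)) * indicator (S j) x)"
        have "F i \<le> suminf F" using sum_le_suminf[of F "{i}"] by simp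
        then show ?thesis by (simp only: F_def)
      qed
      finally show ?thesis by (simp add: add_increasing)
    qed
  qed
  have meas: "ennreal (a (j + j0)) * emeasure \<sigma> (S j) \<le> ennreal (exp (- 1 / 8) ^ j)" for j
  proof -
    let ?k = "j + j0"
    let ?r = "?\<rho> (c2 * real ?k)"
    have "t0 \<le> real ?k" using j0 by simp
    then have "measure \<sigma> (S j) \<le> exp (- (1 / 4) * real ?k * ?r)"
      using tail[of "real ?k"] by (simp add: S_def)
    then have "a ?k * measure \<sigma> (S j) \<le> a ?k * exp (- (1 / 4) * real ?k * ?r)"
      by (rule mult_left_mono) (simp add: a_def)
    also have "\<dots> = exp (- (1 / 8) * (real ?k * ?r))"
      by (simp add: a_def flip: exp_add)
    also have "\<dots> \<le> exp (- (1 / 8) * (real j * 1))"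
    proof -
      have "real j * 1 \<le> real ?k * ?r" using jD(1)[of ?k] by (intro mult_mono) auto
      then show ?thesis by simp
    qed
    also have "\<dots> = exp (- 1 / 8) ^ j" by (simp flip: exp_of_nat_mult)
    finally show ?thesis
      by (simp add: \<sigma>.emeasure_eq_measure a_def flip: ennreal_mult)
  qed
  have "(\<integral>\<^sup>+x. ennreal (exp (c * g x * ?\<rho> \<bar>g x\<bar>)) \<partial>\<sigma>) \<le>
      (\<integral>\<^sup>+x. ennreal (1 + K) + (\<Sum>j. ennreal (a (j + j0)) * indicator (S j) x) \<partial>\<sigma>)"
    by (rule nn_integral_mono) (rule pt)
  also have "\<dots> = ennreal (1 + K) + (\<Sum>j. ennreal (a (j + j0)) * emeasure \<sigma> (S j))"
    by (subst nn_integral_add) (auto simp: nn_integral_suminf nn_integral_cmult_indicator \<sigma>.emeasure_space_1)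
  also have "\<dots> \<le> ennreal (1 + K) + (\<Sum>j. ennreal (exp (- 1 / 8) ^ j))"
    by (intro add_left_mono suminf_le meas) auto
  also have "\<dots> < \<infinity>"
  proof -
    have "summable (\<lambda>j. exp (- 1 / 8 :: real) ^ j)" by (rule summable_geometric) simp
    then have "(\<Sum>j. ennreal (exp (- 1 / 8) ^ j)) = ennreal (\<Sum>j. exp (- 1 / 8) ^ j)"
      by (intro suminf_ennreal2) auto
    then show ?thesis by simp
  qed
  finally show ?thesis .
qed

theorem theorem5p3:
  fixes T :: "real \<Rightarrow> 'a::{real_inner, banach, polish_space} \<Rightarrow>\<^sub>L 'a"
    and b :: 'a
    and M :: "'a measure"
    and \<mu> :: "real \<Rightarrow> 'a measure"
    and \<sigma> :: "'a measure"
    and h :: "real \<Rightarrow> real"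
    and C0 \<gamma> s0 :: real
  assumes semigroup: "C0_semigroup T"
    and levy: "levy_measure M"
    and sazonov: "continuous_map sazonov_topology euclidean (levy_exponent b M)"
    and mehler: "mehler_measures T b M \<mu>"
    and eigenbasis: "\<exists>H. orthonormal_basis H \<and>
          (\<forall>v\<in>H. eigenvector_of_graph (adjoint_graph (generator_dom T) (generator T)) v)"
    and moment1: "(\<integral>\<^sup>+x\<in>- ball 0 1. ennreal (norm x) \<partial>M) < \<infinity>"
    and drift: "\<exists>b_inf. (mehler_drift T b M \<longlongrightarrow> b_inf) at_top"
    and levy_inf: "(\<integral>\<^sup>+s\<in>{0<..}. (\<integral>\<^sup>+x. ennreal (min 1 ((norm (T s x))\<^sup>2)) \<partial>M) \<partial>lborel) < \<infinity>"
    and stable: "\<And>x. ((\<lambda>t. T t x) \<longlongrightarrow> 0) at_top"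
    and h_pos: "\<And>t. 0 < t \<Longrightarrow> 0 < h t"
    and h_int: "set_integrable lborel {0<..} h"
    and h_dom: "\<And>t B. 0 < t \<Longrightarrow> B \<in> sets borel \<Longrightarrow>
          emeasure (distr M borel (blinfun_apply (T t))) B \<le> ennreal (h t) * emeasure M B"
    and exp_moment: "\<And>s. 0 < s \<Longrightarrow>
          (\<integral>\<^sup>+y. ennreal ((norm y)\<^sup>2 * exp (s * norm y)) \<partial>M) < \<infinity>"
    and C0: "0 < C0" and \<gamma>: "1 \<le> \<gamma>" and s0: "0 < s0"
    and growth: "\<And>s. s0 \<le> s \<Longrightarrow> C0 * exp (\<gamma> * s) \<le> tail_exp_moment M s"
    and invariant: "invariant_measure (mehler T \<mu>) \<sigma>"
  shows "(\<forall>g :: 'a \<Rightarrow> real. 1-lipschitz_on UNIV g \<longrightarrow> integrable \<sigma> g) \<and>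
    (\<exists>c0>0. \<exists>c1>0. \<exists>c2>0. \<exists>t0>0. \<forall>g :: 'a \<Rightarrow> real. 1-lipschitz_on UNIV g \<longrightarrow>
       (\<forall>t. 0 < t \<and> t < t0 \<longrightarrow>
          measure \<sigma> {x. g x \<ge> (LINT y|\<sigma>. g y) + t} \<le> exp (- c0 * t\<^sup>2)) \<and>
       (\<forall>t\<ge>t0.
          measure \<sigma> {x. g x \<ge> (LINT y|\<sigma>. g y) + t} \<le> exp (- c1 * t * ext_inverse (tail_exp_moment M) (c2 * t)))) \<and>
    (\<exists>\<epsilon>>0. \<forall>c. 0 < c \<and> c < \<epsilon> \<longrightarrow> (\<forall>g :: 'a \<Rightarrow> real. 1-lipschitz_on UNIV g \<longrightarrow>
       (\<integral>\<^sup>+x. ennreal (exp (c * g x * ext_inverse (tail_exp_moment M) \<bar>g x\<bar>)) \<partial>\<sigma>) < \<infinity>))"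
proof -
  let ?\<psi> = "tail_exp_moment M"
  let ?\<rho> = "ext_inverse ?\<psi>"
  obtain H :: "'a set" where H: "orthonormal_basis H" using eigenbasis by blast
  have \<sigma>: "borel_prob \<sigma>" using invariant by (simp add: invariant_measure_def borel_prob_def)
  interpret exp_moment_measure M by standard (fact levy exp_moment)+
  have "0 < C0 * exp (\<gamma> * s0)" using C0 by simp
  then have "0 < ?\<psi> s0" using growth[of s0] by simp
  then interpret exp_growth ?\<psi>
    using continuous_on_tail_exp_moment tail_exp_moment_add tail_exp_moment_pos[of s0]
    by unfold_locales auto
  define H1 where "H1 = (LINT s:{0<..}|lborel. h s)"
  have H1: "0 \<le> H1"
    unfolding H1_def set_lebesgue_integral_def using h_pos
    by (intro integral_nonneg_AE AE_I2) (simp add: indicator_def less_imp_le)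
  define E where "E = (\<lambda>l. LINT x|M. exp (l * norm x) - 1 - l * norm x)"
  have lap: "laplace_bounded l (H1 * E l) \<sigma>" if l: "0 \<le> l" for l
  proof (rule invariant_measure_laplace_bounded[OF mehler invariant stable])
    fix t :: real assume t: "0 < t"
    show "laplace_bounded l (H1 * E l) (\<mu> t)"
      unfolding H1_def E_def
      by (rule mehler_laplace_bounded[where T = T and b = b and h = h and H = H])
         (fact semigroup levy mehler H h_pos h_int h_dom exp_moment t l)+
  qed
  have dev: "measure \<sigma> {x. g x \<ge> (LINT y|\<sigma>. g y) + t} \<le> exp (H1 * E l - l * t)"
    if "0 < l" "1-lipschitz_on UNIV g" for l t and g :: "'a \<Rightarrow> real"
    using laplace_bounded_deviation[OF \<sigma> that(1) lap that(2)] that(1) by simp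
  have integ: "integrable \<sigma> g" if "1-lipschitz_on UNIV g" for g :: "'a \<Rightarrow> real"
    using laplace_bounded_unbounded(1)[OF \<sigma> _ lap that, of 1] by simp
  define V where "V = (LINT x|M. (norm x)\<^sup>2)"
  have V: "0 \<le> V" by (simp add: V_def)
  \<comment> \<open>The added 1 makes \<open>W\<close> a legitimate divisor in \<open>c0\<close>; in
    the same way the one in \<open>K\<close> below secures \<open>K \<ge> 1\<close>.\<close>
  define W where "W = H1 * (LINT x|M. (norm x)\<^sup>2 * exp (norm x)) + 1"
  have W: "0 < W" using H1 by (simp add: W_def add_nonneg_pos)
  have small: "H1 * E l \<le> W * l\<^sup>2" if "0 \<le> l" "l \<le> 1" for l
  proof -
    have "H1 * E l \<le> H1 * (l\<^sup>2 * (LINT x|M. (norm x)\<^sup>2 * exp (norm x)))"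
      unfolding E_def by (intro mult_left_mono exp_remainder_small that H1)
    also have "\<dots> \<le> W * l\<^sup>2" by (simp add: W_def algebra_simps)
    finally show ?thesis .
  qed
  \<comment> \<open>\<open>V / C0\<close> pays for the second-moment term, once
    \<open>l * exp l\<close> is replaced by \<open>\<psi> (2 * l) / C0\<close>; the 1 next to it
    pays for the jumps outside the ball.\<close>
  define K where "K = H1 * (V / C0 + 1) + 1"
  have K: "1 \<le> K" using H1 V C0 by (simp add: K_def)
  have large: "H1 * E l \<le> l * (K * ?\<psi> (2 * l))" if l: "0 \<le> l" "s0 \<le> 2 * l" for l
  proof -
    have "l \<le> exp l" using exp_ge_add_one_self[of l] by linarith
    then have "l * exp l \<le> exp l * exp l" by (rule mult_right_mono) simp
    also have "\<dots> = exp (2 * l)" by (simp flip: exp_add)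
    also have "\<dots> \<le> exp (\<gamma> * (2 * l))" using \<gamma> l mult_right_mono[of 1 \<gamma> "2 * l"] by simp
    also have "\<dots> \<le> ?\<psi> (2 * l) / C0" using growth[OF l(2)] C0 by (simp add: field_simps)
    finally have 1: "l * exp l \<le> ?\<psi> (2 * l) / C0" .
    have 2: "?\<psi> l \<le> ?\<psi> (2 * l)" using l by (simp add: le_iff)
    have "E l \<le> l * ((l * exp l) * V + ?\<psi> l)"
      using exp_remainder_large[OF l(1)] by (simp add: E_def V_def power2_eq_square algebra_simps)
    also have "\<dots> \<le> l * (?\<psi> (2 * l) / C0 * V + ?\<psi> (2 * l))"
      by (intro mult_left_mono add_mono mult_right_mono 1 2 V l)
    finally have "H1 * E l \<le> H1 * (l * (?\<psi> (2 * l) / C0 * V + ?\<psi> (2 * l)))"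
      using H1 by (rule mult_left_mono)
    also have "\<dots> = l * ((K - 1) * ?\<psi> (2 * l))" by (simp add: K_def algebra_simps)
    also have "\<dots> \<le> l * (K * ?\<psi> (2 * l))"
      using l pos[of "2 * l"] by (intro mult_left_mono mult_right_mono) auto
    finally show ?thesis .
  qed
  \<comment> \<open>Makes \<open>K * (c2 * t) = t / 2\<close>, so half of the Chernoff exponent
    \<open>l * t\<close> survives; with \<open>l\<close> half the inverse at \<open>c2 * t\<close>
    this gives the rate \<open>1 / 4\<close>.\<close>
  define c2 where "c2 = 1 / (2 * K)"
  have c2: "0 < c2" "c2 \<le> 1" using K by (auto simp: c2_def)
  \<comment> \<open>From \<open>t0\<close> on the inverse at \<open>c2 * t\<close> is at least
    \<open>s0\<close>, where the growth hypothesis is in force.\<close>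
  define t0 where "t0 = ?\<psi> s0 / c2"
  have t0: "0 < t0" using pos[of s0] c2 by (simp add: t0_def)
  \<comment> \<open>Chosen for \<open>l = 2 * c0 * t\<close>: the first entry gives
    \<open>W * l\<^sup>2 \<le> l * t / 2\<close>, and the second keeps \<open>l \<le> 1\<close> up
    to \<open>t0\<close>, so the quadratic bound covers the whole range below
    \<open>t0\<close>.\<close>
  define c0 where "c0 = min (1 / (2 * W)) (1 / t0) / 2"
  have c0: "0 < c0" using W t0 by (simp add: c0_def)
  have tail_small: "measure \<sigma> {x. g x \<ge> (LINT y|\<sigma>. g y) + t} \<le> exp (- c0 * t\<^sup>2)"
    if g: "1-lipschitz_on UNIV g" and t: "0 < t" "t < t0" for g :: "'a \<Rightarrow> real" and t
  proof -
    define l where "l = 2 * c0 * t"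
    have l0: "0 < l" using c0 t by (simp add: l_def)
    have "2 * c0 \<le> 1 / t0" by (simp add: c0_def)
    then have "l \<le> 1 / t0 * t0"
      unfolding l_def using t c0 t0 by (intro mult_mono) auto
    then have l1: "l \<le> 1" using t0 by simp
    have "2 * c0 \<le> 1 / (2 * W)" by (simp add: c0_def)
    then have cW: "2 * c0 * W \<le> 1 / 2" using W by (simp add: field_simps)
    have "W * l\<^sup>2 - l * t = 2 * c0 * t\<^sup>2 * (2 * c0 * W - 1)"
      by (simp add: l_def power2_eq_square algebra_simps)
    also have "\<dots> \<le> 2 * c0 * t\<^sup>2 * (- 1 / 2)"
      using c0 cW by (intro mult_left_mono) auto
    finally have "H1 * E l - l * t \<le> - c0 * t\<^sup>2" using small[of l] l0 l1 by simp
    then show ?thesis using dev[OF l0 g, of t] by (meson exp_le_cancel_iff order_trans)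
  qed
  have tail_large: "measure \<sigma> {x. g x \<ge> (LINT y|\<sigma>. g y) + t} \<le> exp (- (1 / 4) * t * ?\<rho> (c2 * t))"
    if g: "1-lipschitz_on UNIV g" and t: "t0 \<le> t" for g :: "'a \<Rightarrow> real" and t
  proof -
    define l where "l = ?\<rho> (c2 * t) / 2"
    have ct: "?\<psi> s0 \<le> c2 * t" using t c2 by (simp add: t0_def field_simps)
    have l: "s0 \<le> 2 * l" using ext_inverse_ge[OF s0 ct] by (simp add: l_def)
    then have l0: "0 < l" using s0 by simp
    have "?\<psi> 0 < c2 * t" using strict[OF s0] ct by simp
    then have "?\<psi> (2 * l) = c2 * t" by (simp add: l_def ext_inverse(2))
    then have "H1 * E l \<le> l * (K * (c2 * t))" using large[OF _ l] l0 by simp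
    also have "K * (c2 * t) = t / 2" using K by (simp add: c2_def)
    finally have "H1 * E l \<le> l * (t / 2)" .
    moreover have "l * (t / 2) - l * t = - (1 / 4) * t * ?\<rho> (c2 * t)"
      by (simp add: l_def field_simps)
    ultimately have "H1 * E l - l * t \<le> - (1 / 4) * t * ?\<rho> (c2 * t)" by linarith
    then show ?thesis using dev[OF l0 g, of t] by (meson exp_le_cancel_iff order_trans)
  qed
  have exp_int: "(\<integral>\<^sup>+x. ennreal (exp (c * g x * ?\<rho> \<bar>g x\<bar>)) \<partial>\<sigma>) < \<infinity>"
    if g: "1-lipschitz_on UNIV g" and c: "0 < c" "c < 1 / 32" for g :: "'a \<Rightarrow> real" and c
    by (rule exp_integrable_of_tail[OF \<sigma> lipschitz_on_UNIV_measurable[OF g] c2 c(1) _ tail_large[OF g]])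
       (use c in auto)
  show ?thesis
  proof (intro conjI)
    show "\<forall>g :: 'a \<Rightarrow> real. 1-lipschitz_on UNIV g \<longrightarrow> integrable \<sigma> g" using integ by blast
    show "\<exists>c0>0. \<exists>c1>0. \<exists>c2>0. \<exists>t0>0. \<forall>g :: 'a \<Rightarrow> real. 1-lipschitz_on UNIV g \<longrightarrow>
       (\<forall>t. 0 < t \<and> t < t0 \<longrightarrow>
          measure \<sigma> {x. g x \<ge> (LINT y|\<sigma>. g y) + t} \<le> exp (- c0 * t\<^sup>2)) \<and>
       (\<forall>t\<ge>t0.
          measure \<sigma> {x. g x \<ge> (LINT y|\<sigma>. g y) + t} \<le> exp (- c1 * t * ?\<rho> (c2 * t)))"
    proof (rule exI[of _ c0], intro conjI c0, rule exI[of _ "1 / 4"], intro conjI,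
        simp, rule exI[of _ c2], intro conjI c2, rule exI[of _ t0], intro conjI t0 allI impI)
      fix g :: "'a \<Rightarrow> real" and t
      assume g: "1-lipschitz_on UNIV g" and t: "0 < t \<and> t < t0"
      then show "measure \<sigma> {x. g x \<ge> (LINT y|\<sigma>. g y) + t} \<le> exp (- c0 * t\<^sup>2)"
        by (intro tail_small) auto
    next
      fix g :: "'a \<Rightarrow> real" and t
      assume "1-lipschitz_on UNIV g" and "t0 \<le> t"
      then show "measure \<sigma> {x. g x \<ge> (LINT y|\<sigma>. g y) + t} \<le> exp (- (1 / 4) * t * ?\<rho> (c2 * t))"
        by (rule tail_large)
    qed
    show "\<exists>\<epsilon>>0. \<forall>c. 0 < c \<and> c < \<epsilon> \<longrightarrow> (\<forall>g :: 'a \<Rightarrow> real. 1-lipschitz_on UNIV g \<longrightarrow>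
       (\<integral>\<^sup>+x. ennreal (exp (c * g x * ?\<rho> \<bar>g x\<bar>)) \<partial>\<sigma>) < \<infinity>)"
    proof (rule exI[of _ "1 / 32"], intro conjI allI impI)
      fix c :: real and g :: "'a \<Rightarrow> real"
      assume "0 < c \<and> c < 1 / 32" "1-lipschitz_on UNIV g"
      then show "(\<integral>\<^sup>+x. ennreal (exp (c * g x * ?\<rho> \<bar>g x\<bar>)) \<partial>\<sigma>) < \<infinity>"
        using exp_int by blast
    qed simp
  qed
qed

end
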